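(* Let $k\ge 0$ be an integer. Then, as $n\to\infty$, \begin{align*} M_{2k}(n) =\ & \pi \xi_{2k}\cdot (24 n-1)^{k - 3/4} I_{3/2-2k}(y_{n}) + \xi'_{2k} \cdot(24n-1)^{k-5/4}I_{3/2-2k+1}(y_{n})\\ & +O\!\left(n^{k-7/4}\cdot n^{-1/4} \exp( y_{n}) \right), \end{align*} where $y_n:=\frac{\pi}{6}\sqrt{24n-1}$, $\xi_{2k}:=(-1)^k\,2\,B_{2k}(1/2)$, $\xi'_0:=0$ and $\xi'_{2k}:=-\frac14(2k)(2k-1)\xi_{2k-2}$ for $k>0$.
   Context: Define integers $\mathcal{M}(m,n)$ by $\sum_{m\in\mathbb Z,\, n\ge0}\mathcal{M}(m,n)x^mq^n=\prod_{n\ge1}\frac{1-q^n}{(1-xq^n)(1-x^{-1}q^n)}$ (the crank counts), and let $M_{2k}(n):=\sum_{m\in\mathbb Z} m^{2k}\mathcal{M}(m,n)$. $B_n(x)$ is the $n$-th Bernoulli polynomial and $I_\nu$ the modified Bessel function of the first kind of order $\nu$. The implied constant may depend on $k$. *)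

theory Defs
  imports "HOL-Analysis.Analysis" "HOL-Library.Landau_Symbols"
    "HOL-Computational_Algebra.Formal_Laurent_Series"
begin

text \<open>
  The crank generating function is a formal power series in \<open>q\<close> whose coefficients are formal
  Laurent series in \<open>x\<close> over the integers; the infinite product converges in the topology of
  formal power series. Division is not available over the integers, so
  \<open>1 / ((1 - x q\<^sup>n) (1 - x\<inverse> q\<^sup>n))\<close> is written with \<^term>\<open>fps_right_inverse\<close>, whose second argument is
  the constant coefficient of the inverse.
\<close>

definition crank_denom :: "nat \<Rightarrow> int fls fps" where
  "crank_denom n =
     (1 - fps_const fls_X * fps_X ^ n) * (1 - fps_const fls_X_inv * fps_X ^ n)"

lemma crank_denom_mult_inverse:
  assumes "n \<ge> 1"
  shows "crank_denom n * fps_right_inverse (crank_denom n) 1 = 1"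
  by (rule fps_right_inverse) (use assms in \<open>simp add: crank_denom_def\<close>)

definition crank_gf :: "int fls fps" where
  "crank_gf =
     prodinf (\<lambda>i. (1 - fps_X ^ Suc i) * fps_right_inverse (crank_denom (Suc i)) 1)"

definition crank_count :: "int \<Rightarrow> nat \<Rightarrow> int" where
  "crank_count m n = fls_nth (fps_nth crank_gf n) m"

text \<open>
  For fixed \<open>n\<close> only finitely many \<open>m\<close> have a nonzero crank count, so the sum over all integers \<open>m\<close>
  is the sum over the support. Note that \<open>0 ^ 0 = 1\<close>.
\<close>

definition crank_moment :: "nat \<Rightarrow> nat \<Rightarrow> int" where
  "crank_moment j n = (\<Sum>m | crank_count m n \<noteq> 0. m ^ j * crank_count m n)"

text \<open>Generating function \<open>t e\<^bsup>xt\<^esup> / (e\<^sup>t - 1) = \<Sum> B\<^sub>n(x) t\<^sup>n / n!\<close>.\<close>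

definition bernoulli_poly :: "nat \<Rightarrow> real \<Rightarrow> real" where
  "bernoulli_poly n x = fact n * fps_nth (fps_X * fps_exp x / (fps_exp 1 - 1)) n"

text \<open>
  The modified Bessel function of the first kind, for real order and \<open>x > 0\<close> (for other \<open>x\<close> the
  real power function is not the intended one). The function \<^term>\<open>rGamma\<close> is \<open>1 / \<Gamma>\<close>, with value 0 at the
  poles of \<open>\<Gamma>\<close>.
\<close>

definition bessel_I :: "real \<Rightarrow> real \<Rightarrow> real" where
  "bessel_I \<nu> x =
     (\<Sum>j. rGamma (real j + \<nu> + 1) / fact j * (x / 2) powr (2 * real j + \<nu>))"

definition crank_y :: "nat \<Rightarrow> real" where
  "crank_y n = pi / 6 * sqrt (24 * real n - 1)"

text \<open>\<open>crank_xi k\<close> and \<open>crank_xi' k\<close> are the constants \<open>\<xi>\<close> and \<open>\<xi>'\<close> with index \<open>2k\<close>.\<close>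

definition crank_xi :: "nat \<Rightarrow> real" where
  "crank_xi k = (-1) ^ k * 2 * bernoulli_poly (2 * k) (1 / 2)"

definition crank_xi' :: "nat \<Rightarrow> real" where
  "crank_xi' k =
     (if k = 0 then 0
      else - (1 / 4) * (2 * real k) * (2 * real k - 1) * crank_xi (k - 1))"

end

theory Submission
  imports Defs "HOL-Complex_Analysis.Complex_Analysis" "HOL-Real_Asymp.Real_Asymp"
    "HOL-Probability.Distributions"
begin

text \<open>
  Put \<open>q = e\<^bsup>-s\<^esup>\<close>. Logarithmic differentiation of the crank product in \<open>x\<close> and in \<open>q\<close> shows that
  the generating function of the \<open>M\<^sub>2\<^sub>k(n)\<close> is the partition generating function times a polynomial in
  Lambert series, determined recursively in \<open>k\<close>. Near \<open>s = 0\<close> the polynomial is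
  \<open>\<alpha>\<^sub>k s\<^bsup>-2k\<^esup> + \<beta>\<^sub>k s\<^bsup>1-2k\<^esup>\<close> up to a smaller error, where the recursion identifies \<open>\<alpha>\<^sub>k\<close> and \<open>\<beta>\<^sub>k\<close> with
  coefficients of the reciprocal of a sine quotient, that is, with the values of Bernoulli polynomials
  at \<open>1/2\<close>, and the logarithm of the partition generating function is
  \<open>\<pi>\<^sup>2/(6s) + ln(s/2\<pi>)/2 - s/24\<close> up to an exponentially small error. Cauchy's formula on the circle
  \<open>Re s = 2\<pi> / \<surd>(24n - 1)\<close> then gives the result: the arc
  \<open>\<bar>Im s\<bar> \<le> Re s\<close> contributes integrals that satisfy the recurrence of the Bessel functions up to
  exponentially small errors, so that their identification reduces to the elementary functions of order
  \<open>\<plusminus>1/2\<close>, and the rest of the circle is exponentially smaller.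
\<close>

unbundle fps_syntax
unbundle no vec_syntax

section \<open>Recurrences for the crank moments\<close>

text \<open>The circle is placed so that (n - 1/24) x and pi^2/(6 x) coincide; with s = x t the
  exponent becomes (y/2) (t + 1/t), whose saddle is t = 1. Since x has order n^(-1/2), the other
  factors matter only up to a relative O(s^2): two terms give those of the theorem, and O(s^2) gives
  its error. Accordingly the logarithm of the partition generating function is expanded with error
  O(s^2) by elementary means. The trapezoidal rule gives its derivative; the constant -ln (2 pi)/2,
  lost in differentiation, is recovered by comparison with the product for sinh at two step widths,
  combined so that an unknown integral cancels. The sector |Im s| <= Re s serves two ends: the
  regular parts of the Lambert series decay there uniformly, and at its edge Re (t + 1/t) = 3/2 < 2,
  so the endpoint terms of the recurrence are O(e^(3y/4)). Schlaefli's integral would give Bessel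
  functions of order 2k - 3/2 and 2k - 5/2; those of opposite order satisfy the same recurrence and
  differ from them by exponentially decaying functions, which is why the orders 3/2 - 2k and 5/2 -
  2k can stand in the theorem.\<close>

definition divsum :: "nat \<Rightarrow> nat \<Rightarrow> nat" where
  "divsum r n = (\<Sum>d | d dvd n. d ^ r)"

text \<open>\<open>{d. d dvd 0}\<close> is infinite, so the sum is the junk value 0;
  the Lambert series can thus be summed from \<open>n = 0\<close>.\<close>

lemma divsum_0 [simp]: "divsum r 0 = 0"
  by (simp add: divsum_def)

text \<open>The expansion of a q^i / (1 - a q^i), i.e. the sum of a^m q^(i m) over m >= 1. Up to a
  constant factor it is the logarithmic derivative of 1 - a q^i, with respect to q as well as to
  x.\<close>

definition fps_geo :: "'a \<Rightarrow> nat \<Rightarrow> 'a::comm_ring_1 fps" where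
  "fps_geo a i = Abs_fps (\<lambda>n. if i dvd n \<and> n > 0 then a ^ (n div i) else 0)"

lemma fps_geo_eq:
  assumes "i \<ge> 1"
  shows "(1 - fps_const a * fps_X ^ i) * fps_geo a i = fps_const a * fps_X ^ i"
proof (rule fps_ext)
  fix n
  show "((1 - fps_const a * fps_X ^ i) * fps_geo a i) $ n = (fps_const a * fps_X ^ i) $ n"
  proof (cases "n < i")
    case True
    then have "\<not> (i dvd n \<and> n > 0)" by (auto dest: dvd_imp_le)
    with True show ?thesis
      by (auto simp: algebra_simps fps_X_power_mult_nth fps_geo_def)
  next
    case False
    then obtain m where m: "n = m + i" by (metis add.commute le_add_diff_inverse not_less)
    show ?thesis using assms
      by (cases "m = 0") (auto simp: m algebra_simps fps_X_power_mult_nth fps_geo_def)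
  qed
qed

section \<open>The derivations q d/dq and x d/dx\<close>

definition fps_theta :: "'a::comm_ring_1 fps \<Rightarrow> 'a fps" where
  "fps_theta F = fps_X * fps_deriv F"

definition fls_theta :: "'a::comm_ring_1 fls \<Rightarrow> 'a fls" where
  "fls_theta c = fls_X * fls_deriv c"

definition fps_fls_theta :: "'a::comm_ring_1 fls fps \<Rightarrow> 'a fls fps" where
  "fps_fls_theta F = Abs_fps (\<lambda>n. fls_theta (F $ n))"

lemma fps_theta_nth [simp]: "fps_theta F $ n = of_nat n * F $ n"
  by (cases n) (auto simp: fps_theta_def)

lemma fls_theta_nth [simp]: "fls_theta c $$ m = of_int m * c $$ m"
  by (simp add: fls_theta_def fls_X_times_conv_shift)

lemma fls_theta_mult: "fls_theta (a * b) = a * fls_theta b + fls_theta a * b"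
  by (simp add: fls_theta_def algebra_simps)

lemma fls_theta_add: "fls_theta (a + b) = fls_theta a + fls_theta b"
  by (simp add: fls_theta_def algebra_simps)

lemma fls_theta_sum: "fls_theta (sum f A) = (\<Sum>x\<in>A. fls_theta (f x))"
  by (induction A rule: infinite_finite_induct) (auto simp: fls_theta_add, auto simp: fls_theta_def)

lemma fps_fls_theta_nth [simp]: "fps_fls_theta F $ n = fls_theta (F $ n)"
  by (simp add: fps_fls_theta_def)

text \<open>Common to q d/dq and to x d/dx applied to each coefficient, so that logarithmic
  derivatives of products and quotients are computed once for both.\<close>

locale ring_derivation =
  fixes \<delta> :: "'a::idom \<Rightarrow> 'a"
  assumes deriv_mult: "\<delta> (a * b) = a * \<delta> b + \<delta> a * b"
    and deriv_diff: "\<delta> (a - b) = \<delta> a - \<delta> b"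
begin

lemma deriv_one: "\<delta> 1 = 0"
  using deriv_mult[of 1 1] by (simp only: mult_1_left mult_1_right add_cancel_left_left add_cancel_right_right)

lemma deriv_prod:
  assumes "\<And>i. i \<in> A \<Longrightarrow> \<delta> (f i) = f i * g i"
  shows "\<delta> (prod f A) = prod f A * sum g A"
  using assms
  by (induction A rule: infinite_finite_induct) (auto simp: deriv_mult deriv_one algebra_simps)

text \<open>The logarithmic derivative of m / (d1 d2), phrased with \<open>f * d1 * d2 = m\<close>
  because the ring has no division; the cancellation uses that it is a domain.\<close>

lemma deriv_quotient:
  assumes "f * d1 * d2 = m" "d1 \<noteq> 0" "d2 \<noteq> 0"
    and "\<delta> m = m * g" "\<delta> d1 = d1 * g1" "\<delta> d2 = d2 * g2"
  shows "\<delta> f = f * (g - g1 - g2)"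
proof -
  have "m * g = \<delta> (f * d1 * d2)" using assms by simp
  also have "\<dots> = d1 * d2 * (f * g1 + f * g2 + \<delta> f)"
    unfolding deriv_mult assms(5,6) by (simp add: algebra_simps)
  finally have "d1 * d2 * (f * g1 + f * g2 + \<delta> f) = d1 * d2 * (f * g)"
    using assms(1) by (auto simp: algebra_simps)
  then have "f * g1 + f * g2 + \<delta> f = f * g" using assms by simp
  then show ?thesis by (simp add: algebra_simps eq_diff_eq)
qed

end

interpretation fps_theta: ring_derivation "fps_theta :: int fls fps \<Rightarrow> int fls fps"
  by standard (auto simp: fps_theta_def algebra_simps)

interpretation fps_fls_theta: ring_derivation "fps_fls_theta :: int fls fps \<Rightarrow> int fls fps"
proof
  show "fps_fls_theta (a * b) = a * fps_fls_theta b + fps_fls_theta a * b" for a b :: "int fls fps"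
    by (rule fps_ext) (simp add: fps_mult_nth fls_theta_sum fls_theta_mult sum.distrib)
  show "fps_fls_theta (a - b) = fps_fls_theta a - fps_fls_theta b" for a b :: "int fls fps"
    by (rule fps_ext) (simp add: fls_theta_def algebra_simps)
qed

definition crank_factor :: "nat \<Rightarrow> int fls fps" where
  "crank_factor i = (1 - fps_X ^ i) * fps_right_inverse (crank_denom i) 1"

lemma crank_factor_mult_denom:
  assumes "i \<ge> 1"
  shows "crank_factor i * (1 - fps_const fls_X * fps_X ^ i) * (1 - fps_const fls_X_inv * fps_X ^ i)
         = 1 - fps_X ^ i"
  using crank_denom_mult_inverse[OF assms]
  by (simp add: crank_factor_def crank_denom_def mult_ac)

lemma one_minus_monom_nonzero:
  assumes "i \<ge> 1"
  shows "1 - fps_const a * fps_X ^ i \<noteq> (0 :: 'a::comm_ring_1 fps)"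
proof
  assume "1 - fps_const a * fps_X ^ i = (0 :: 'a fps)"
  then have "(1 - fps_const a * fps_X ^ i) $ 0 = (0 :: 'a fps) $ 0" by (rule arg_cong)
  with assms show False by simp
qed

lemma fps_theta_one_minus:
  fixes a :: "'a::idom"
  assumes "i \<ge> 1"
  shows "fps_theta (1 - fps_const a * fps_X ^ i)
         = (1 - fps_const a * fps_X ^ i) * (- (of_nat i * fps_geo a i))"
proof -
  have "fps_theta (1 - fps_const a * fps_X ^ i) = - (of_nat i * (fps_const a * fps_X ^ i))"
    by (rule fps_ext) (auto simp: fps_of_nat[symmetric] simp del: fps_const_mult)
  also have "\<dots> = (1 - fps_const a * fps_X ^ i) * (- (of_nat i * fps_geo a i))"
    by (subst fps_geo_eq[OF assms, symmetric]) (simp add: algebra_simps)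
  finally show ?thesis .
qed

text \<open>Here \<open>a\<close> is an eigenvector of x d/dx: the instances are 1, x and 1/x, with
  eigenvalues 0, 1 and -1.\<close>

lemma fps_fls_theta_one_minus:
  assumes "i \<ge> 1" "fls_theta a = of_int e * a"
  shows "fps_fls_theta (1 - fps_const a * fps_X ^ i)
         = (1 - fps_const a * fps_X ^ i) * (- (of_int e * fps_geo a i))"
proof -
  have "fps_fls_theta (1 - fps_const a * fps_X ^ i) = - (of_int e * (fps_const a * fps_X ^ i))"
    using assms
    by (intro fps_ext) (auto simp: fps_of_int[symmetric] fls_theta_def simp del: fps_const_mult)
  also have "\<dots> = (1 - fps_const a * fps_X ^ i) * (- (of_int e * fps_geo a i))"
    by (subst fps_geo_eq[OF assms(1), symmetric]) (simp add: algebra_simps)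
  finally show ?thesis .
qed

lemma fps_theta_crank_factor:
  assumes "i \<ge> 1"
  shows "fps_theta (crank_factor i)
         = crank_factor i * (of_nat i * (fps_geo fls_X i + fps_geo fls_X_inv i - fps_geo 1 i))"
proof -
  have "fps_theta (1 - fps_X ^ i :: int fls fps) = (1 - fps_X ^ i) * (- (of_nat i * fps_geo 1 i))"
    using fps_theta_one_minus[OF assms, of 1] by (simp only: fps_const_1_eq_1 mult_1_left)
  from fps_theta.deriv_quotient[OF crank_factor_mult_denom[OF assms]
      one_minus_monom_nonzero[OF assms] one_minus_monom_nonzero[OF assms] this
      fps_theta_one_minus[OF assms] fps_theta_one_minus[OF assms]]
  show ?thesis by (simp add: algebra_simps)
qed

lemma fps_fls_theta_crank_factor:
  assumes "i \<ge> 1"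
  shows "fps_fls_theta (crank_factor i) = crank_factor i * (fps_geo fls_X i - fps_geo fls_X_inv i)"
proof -
  have 1: "fls_theta (1 :: int fls) = of_int 0 * 1" by (simp add: fls_theta_def)
  have 2: "fls_theta (fls_X :: int fls) = of_int 1 * fls_X" by (simp add: fls_theta_def)
  have 3: "fls_theta (fls_X_inv :: int fls) = of_int (-1) * fls_X_inv"
    by (rule fls_eqI) auto
  have 0: "fps_fls_theta (1 - fps_X ^ i :: int fls fps) = (1 - fps_X ^ i) * 0"
    using fps_fls_theta_one_minus[OF assms 1] by simp
  from fps_fls_theta.deriv_quotient[OF crank_factor_mult_denom[OF assms]
      one_minus_monom_nonzero[OF assms] one_minus_monom_nonzero[OF assms] 0
      fps_fls_theta_one_minus[OF assms 2] fps_fls_theta_one_minus[OF assms 3]]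
  show ?thesis by (simp add: algebra_simps)
qed

section \<open>The infinite product and its truncations\<close>

definition crank_prod :: "nat \<Rightarrow> int fls fps" where
  "crank_prod N = (\<Prod>i\<in>{1..N}. crank_factor i)"

text \<open>The factor is 1 + O(q^i): after its denominator has been multiplied out, every term
  except the factor itself and 1 carries q^i.\<close>

lemma crank_factor_nth:
  assumes "n < i"
  shows "crank_factor i $ n = (if n = 0 then 1 else 0)"
proof -
  have "i \<ge> 1" using assms by simp
  have "1 - fps_X ^ i = crank_factor i - fps_X ^ i * crank_factor i
      * (fps_const fls_X + fps_const fls_X_inv - fps_const (fls_X * fls_X_inv) * fps_X ^ i)"
    unfolding crank_factor_mult_denom[OF \<open>i \<ge> 1\<close>, symmetric] 
    by (simp only: ring_distribs mult_1_left mult_1_right mult_ac fps_const_mult[symmetric])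
       (simp add: algebra_simps)
  then have "(1 - fps_X ^ i :: int fls fps) $ n = crank_factor i $ n - (fps_X ^ i * (crank_factor i
      * (fps_const fls_X + fps_const fls_X_inv - fps_const (fls_X * fls_X_inv) * fps_X ^ i))) $ n"
    by (metis fps_sub_nth mult.assoc)
  with assms show ?thesis by (simp add: fps_X_power_mult_nth)
qed

lemma crank_prod_nth_Suc:
  assumes "n \<le> N"
  shows "crank_prod (Suc N) $ n = crank_prod N $ n"
proof -
  have "crank_prod (Suc N) $ n = (\<Sum>i=0..n. crank_prod N $ i * crank_factor (Suc N) $ (n - i))"
    by (simp add: crank_prod_def mult.commute[of "crank_factor _"] fps_mult_nth)
  also have "\<dots> = (\<Sum>i=0..n. if i = n then crank_prod N $ i else 0)"
    using assms by (intro sum.cong) (auto simp: crank_factor_nth)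
  finally show ?thesis by simp
qed

lemma crank_prod_nth_stable: "n \<le> N \<Longrightarrow> crank_prod N $ n = crank_prod n $ n"
  by (induction N rule: dec_induct) (auto simp: crank_prod_nth_Suc)

text \<open>Each coefficient of the partial products is eventually constant, which is convergence of
  formal power series. The definition of \<open>has_prod\<close> also asks for a nonzero limit; here
  the constant coefficient is 1.\<close>

lemma crank_gf_eq: "crank_gf = Abs_fps (\<lambda>n. crank_prod n $ n)"
proof -
  let ?F = "\<lambda>i. (1 - fps_X ^ Suc i) * fps_right_inverse (crank_denom (Suc i)) 1"
  have prods: "(\<Prod>i\<le>N. ?F i) = crank_prod (Suc N)" for N
  proof (induction N)
    case 0
    show ?case unfolding crank_prod_def crank_factor_def by simp
  next
    case (Suc N)
    have "crank_prod (Suc (Suc N)) = crank_factor (Suc (Suc N)) * crank_prod (Suc N)"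
      unfolding crank_prod_def by (rule prod.nat_ivl_Suc') simp
    then show ?case
      unfolding prod.atMost_Suc Suc crank_factor_def by (simp only: mult.commute)
  qed
  have "(\<lambda>N. \<Prod>i\<le>N. ?F i) \<longlonglongrightarrow> Abs_fps (\<lambda>n. crank_prod n $ n)"
    unfolding prods tendsto_fps_iff
  proof
    fix n
    show "\<forall>\<^sub>F N in sequentially. crank_prod (Suc N) $ n = Abs_fps (\<lambda>n. crank_prod n $ n) $ n"
      using eventually_ge_at_top[of n]
      by eventually_elim (simp only: crank_prod_nth_stable[OF le_SucI] fps_nth_Abs_fps)
  qed
  moreover have "Abs_fps (\<lambda>n. crank_prod n $ n) \<noteq> 0"
  proof
    assume "Abs_fps (\<lambda>n. crank_prod n $ n) = 0"
    then have "Abs_fps (\<lambda>n. crank_prod n $ n) $ 0 = (0 :: int fls fps) $ 0" by (rule arg_cong)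
    then show False by (simp add: crank_prod_def)
  qed
  ultimately have *: "?F has_prod Abs_fps (\<lambda>n. crank_prod n $ n)"
    unfolding has_prod_def raw_has_prod_def add_0_right by blast
  show ?thesis
    unfolding crank_gf_def prodinf_def
    by (rule the_equality, rule *, rule has_prod_unique2[OF _ *])
qed

lemma crank_gf_0: "crank_gf $ 0 = 1"
  by (simp add: crank_gf_eq crank_prod_def)

section \<open>Coefficient recurrences from the two logarithmic derivatives\<close>

lemma sum_fps_geo_nth:
  assumes "j \<le> n"
  shows "(\<Sum>i\<in>{1..n}. h i * fps_geo a i $ j) = (if j = 0 then 0 else \<Sum>i | i dvd j. h i * a ^ (j div i))"
proof (cases "j = 0")
  case False
  have "(\<Sum>i\<in>{1..n}. h i * fps_geo a i $ j) = (\<Sum>i | i dvd j. h i * fps_geo a i $ j)"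
  proof (rule sum.mono_neutral_right)
    show "{i. i dvd j} \<subseteq> {1..n}"
    proof
      fix i assume "i \<in> {i. i dvd j}"
      then have "i dvd j" by simp
      with False have "i \<le> j" "i > 0" by (auto simp: dvd_imp_le intro!: Nat.gr0I)
      with assms show "i \<in> {1..n}" by simp
    qed
  qed (auto simp: fps_geo_def)
  also have "\<dots> = (\<Sum>i | i dvd j. h i * a ^ (j div i))"
    using False by (intro sum.cong) (auto simp: fps_geo_def)
  finally show ?thesis using False by simp
qed (simp add: fps_geo_def)

text \<open>Only the first n factors influence the coefficients up to q^n, so the finite product
  \<open>crank_prod n\<close> can be differentiated in place of the infinite one.\<close>

lemma derivation_crank_gf_nth:
  fixes \<delta> :: "int fls fps \<Rightarrow> int fls fps"
  assumes "ring_derivation \<delta>" "\<And>i. i \<ge> 1 \<Longrightarrow> \<delta> (crank_factor i) = crank_factor i * G i"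
  shows "\<delta> (crank_prod n) $ n = (\<Sum>j=0..n. crank_gf $ (n - j) * (\<Sum>i\<in>{1..n}. G i $ j))"
proof -
  interpret ring_derivation \<delta> by fact
  have "\<delta> (crank_prod n) = crank_prod n * (\<Sum>i\<in>{1..n}. G i)"
    unfolding crank_prod_def by (rule deriv_prod) (use assms in auto)
  then have "\<delta> (crank_prod n) $ n = ((\<Sum>i\<in>{1..n}. G i) * crank_prod n) $ n"
    by (simp only: mult.commute)
  also have "\<dots> = (\<Sum>j=0..n. crank_prod n $ (n - j) * (\<Sum>i\<in>{1..n}. G i $ j))"
    unfolding fps_mult_nth fps_sum_nth by (rule sum.cong[OF refl], rule mult.commute)
  also have "\<dots> = (\<Sum>j=0..n. crank_gf $ (n - j) * (\<Sum>i\<in>{1..n}. G i $ j))"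
    by (intro sum.cong) (auto simp: crank_gf_eq crank_prod_nth_stable[of "n - _" n])
  finally show ?thesis .
qed

text \<open>This recurrence has two uses: it bounds the support of the counts, and at x = 1 it
  becomes the recurrence of the partition function.\<close>

lemma crank_gf_theta_q:
  "of_nat n * crank_gf $ n = (\<Sum>j=1..n. \<Sum>i | i dvd j.
     of_nat i * (fls_X ^ (j div i) + fls_X_inv ^ (j div i) - 1) * crank_gf $ (n - j))"
proof -
  have "of_nat n * crank_gf $ n = fps_theta (crank_prod n) $ n"
    by (simp add: crank_gf_eq)
  also have "\<dots> = (\<Sum>j=0..n. crank_gf $ (n - j) * 
      (\<Sum>i\<in>{1..n}. (of_nat i * (fps_geo fls_X i + fps_geo fls_X_inv i - fps_geo 1 i)) $ j))"
    by (rule derivation_crank_gf_nth)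
       (use fps_theta_crank_factor fps_theta.ring_derivation_axioms in auto)
  also have "\<dots> = (\<Sum>j=0..n. crank_gf $ (n - j) * ((\<Sum>i\<in>{1..n}. of_nat i * fps_geo fls_X i $ j)
      + (\<Sum>i\<in>{1..n}. of_nat i * fps_geo fls_X_inv i $ j) - (\<Sum>i\<in>{1..n}. of_nat i * fps_geo 1 i $ j)))"
    by (intro sum.cong refl arg_cong[where f = "\<lambda>x. _ * x"])
       (simp add: fps_of_nat[symmetric] algebra_simps sum.distrib sum_subtractf)
  also have "\<dots> = (\<Sum>j=0..n. crank_gf $ (n - j) * (if j = 0 then 0 else \<Sum>i | i dvd j.
      of_nat i * (fls_X ^ (j div i) + fls_X_inv ^ (j div i) - 1)))"
  proof (intro sum.cong refl, goal_cases)
    case (1 j)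
    then have "j \<le> n" by simp
    then show ?case
      unfolding sum_fps_geo_nth[OF \<open>j \<le> n\<close>]
      by (simp only: power_one mult_1_right ring_distribs sum.distrib sum_subtractf split: if_split) simp
  qed
  also have "\<dots> = (\<Sum>j=1..n. crank_gf $ (n - j) * (\<Sum>i | i dvd j.
      of_nat i * (fls_X ^ (j div i) + fls_X_inv ^ (j div i) - 1)))"
    by (intro sum.mono_neutral_cong_right) auto
  finally show ?thesis by (simp add: sum_distrib_left mult_ac)
qed

lemma sum_divisors_flip:
  fixes n :: nat
  assumes "n > 0"
  shows "(\<Sum>i | i dvd n. f (n div i)) = (\<Sum>d | d dvd n. f d)"
  by (rule sum.reindex_bij_witness[of _ "\<lambda>d. n div d" "\<lambda>d. n div d"]) (use assms in auto)

text \<open>On the coefficient of x^m the operator x d/dx is multiplication by m, which is what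
  raises the order of a moment. The divisor \<open>j div i\<close> is renamed to \<open>d\<close>,
  so that the exponent of x is the summation index.\<close>

lemma crank_gf_theta_x:
  "fls_theta (crank_gf $ n) = (\<Sum>j=1..n. \<Sum>d | d dvd j.
     (fls_X ^ d - fls_X_inv ^ d) * crank_gf $ (n - j))"
proof -
  have "fls_theta (crank_gf $ n) = fps_fls_theta (crank_prod n) $ n"
    by (simp add: crank_gf_eq)
  also have "\<dots> = (\<Sum>j=0..n. crank_gf $ (n - j) * 
      (\<Sum>i\<in>{1..n}. (fps_geo fls_X i - fps_geo fls_X_inv i) $ j))"
    by (rule derivation_crank_gf_nth)
       (use fps_fls_theta_crank_factor fps_fls_theta.ring_derivation_axioms in auto)
  also have "\<dots> = (\<Sum>j=0..n. crank_gf $ (n - j) * ((\<Sum>i\<in>{1..n}. 1 * fps_geo fls_X i $ j)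
      - (\<Sum>i\<in>{1..n}. 1 * fps_geo fls_X_inv i $ j)))"
    by (intro sum.cong refl arg_cong[where f = "\<lambda>x. _ * x"]) (simp add: sum_subtractf)
  also have "\<dots> = (\<Sum>j=0..n. crank_gf $ (n - j) * (if j = 0 then 0 else \<Sum>i | i dvd j.
      fls_X ^ (j div i) - fls_X_inv ^ (j div i)))"
  proof (intro sum.cong refl, goal_cases)
    case (1 j)
    then have "j \<le> n" by simp
    then show ?case
      unfolding sum_fps_geo_nth[OF \<open>j \<le> n\<close>] by (cases "j = 0") (simp_all add: sum_subtractf)
  qed
  also have "\<dots> = (\<Sum>j=1..n. crank_gf $ (n - j) * (\<Sum>d | d dvd j. fls_X ^ d - fls_X_inv ^ d))"
    by (intro sum.mono_neutral_cong_right)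
       (auto simp: sum_divisors_flip[of _ "\<lambda>d. fls_X ^ d - fls_X_inv ^ d"])
  finally show ?thesis by (simp add: sum_distrib_left mult_ac)
qed

lemma fls_of_nat_mult_nth: "(of_nat n * c :: 'a::comm_ring_1 fls) $$ m = of_nat n * c $$ m"
  by (induction n) (auto simp: algebra_simps)

lemma sum_swap_inner:
  "(\<Sum>m\<in>A. \<Sum>j\<in>B. \<Sum>d\<in>C j. f m j d) = (\<Sum>j\<in>B. \<Sum>d\<in>C j. \<Sum>m\<in>A. f m j d)"
  by (subst sum.swap, rule sum.cong[OF refl], rule sum.swap)

lemma crank_theta_coeff:
  "(of_nat i * (fls_X ^ d + fls_X_inv ^ d - 1) * c :: 'a::comm_ring_1 fls) $$ m
   = of_nat i * (c $$ (m - int d) + c $$ (m - (- int d)) - c $$ m)"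
proof -
  have "of_nat i * (fls_X ^ d + fls_X_inv ^ d - 1) * c
        = of_nat i * (fls_X ^ d * c + fls_X_inv ^ d * c - c)"
    by (simp add: algebra_simps)
  then show ?thesis
    by (simp only: fls_of_nat_mult_nth fls_X_power_times_conv_shift 
          fls_X_inv_power_times_conv_shift) simp
qed

text \<open>Induction by the recurrence for n times the coefficient of q^n: the terms with index n -
  j shift the exponent of x by 0 or by a divisor of j, hence by at most j. It makes all sums over m
  finite.\<close>

lemma crank_count_support: "crank_count m n \<noteq> 0 \<Longrightarrow> \<bar>m\<bar> \<le> int n"
proof (induction n arbitrary: m rule: less_induct)
  case (less n)
  show ?case
  proof (rule ccontr)
    assume m: "\<not> \<bar>m\<bar> \<le> int n"
    show False
    proof (cases "n = 0")
      case True
      with m less.prems show False by (simp add: crank_count_def crank_gf_0)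
    next
      case False
      have "of_nat n * crank_count m n = (of_nat n * crank_gf $ n) $$ m"
        by (simp add: crank_count_def fls_of_nat_mult_nth)
      also have "\<dots> = (\<Sum>j=1..n. \<Sum>i | i dvd j.
          int i * (crank_count (m - int (j div i)) (n - j) + crank_count (m + int (j div i)) (n - j)
            - crank_count m (n - j)))"
        unfolding crank_gf_theta_q fls_nth_sum
        by (simp only: crank_theta_coeff crank_count_def) simp
      also have "\<dots> = 0"
      proof (intro sum.neutral ballI)
        fix j i assume j: "j \<in> {1..n}" and i: "i \<in> {i. i dvd j}"
        have lt: "n - j < n" using j by auto
        have "j div i \<le> j" by simp
        then have "int (j div i) \<le> int j" by (simp only: of_nat_le_iff)
        moreover have "\<bar>m\<bar> > int n" using m by simp
        moreover have "int (n - j) = int n - int j" using j by (simp add: of_nat_diff)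
        ultimately have "\<not> \<bar>m - int (j div i)\<bar> \<le> int (n - j)" "\<not> \<bar>m + int (j div i)\<bar> \<le> int (n - j)"
            "\<not> \<bar>m\<bar> \<le> int (n - j)" 
          by linarith+
        then have "crank_count (m - int (j div i)) (n - j) = 0" "crank_count (m + int (j div i)) (n - j) = 0"
            "crank_count m (n - j) = 0"
          using less.IH[OF lt] by blast+
        then show "int i * (crank_count (m - int (j div i)) (n - j) + crank_count (m + int (j div i)) (n - j)
            - crank_count m (n - j)) = 0"
          by simp
      qed
      finally show False using False less.prems by simp
    qed
  qed
qed

section \<open>From counts to moments\<close>

lemma crank_moment_eq:
  assumes "n \<le> N"
  shows "crank_moment k n = (\<Sum>m\<in>{-int N..int N}. m ^ k * crank_count m n)"
  unfolding crank_moment_def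
proof (rule sum.mono_neutral_left)
  show "{m. crank_count m n \<noteq> 0} \<subseteq> {-int N..int N}"
  proof
    fix m assume "m \<in> {m. crank_count m n \<noteq> 0}"
    then have "\<bar>m\<bar> \<le> int n" by (intro crank_count_support) simp
    with assms show "m \<in> {-int N..int N}" by auto
  qed
qed auto

text \<open>Multiplication by x^e translates the counts by e, and the binomial expansion of (e +
  m)^k leads back to moments. The hypothesis says that the window {-N..N} contains the translated
  support.\<close>

lemma crank_moment_shift:
  assumes "n + nat \<bar>e\<bar> \<le> N"
  shows "(\<Sum>m\<in>{-int N..int N}. m ^ k * crank_count (m - e) n)
         = (\<Sum>r\<le>k. of_nat (k choose r) * e ^ r * crank_moment (k - r) n)"
proof -
  have "(\<Sum>m\<in>{-int N..int N}. m ^ k * crank_count (m - e) n)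
        = (\<Sum>m\<in>{-int n + e..int n + e}. m ^ k * crank_count (m - e) n)"
  proof (rule sum.mono_neutral_right)
    show "{-int n + e..int n + e} \<subseteq> {-int N..int N}" using assms by auto
    show "\<forall>m\<in>{-int N..int N} - {-int n + e..int n + e}. m ^ k * crank_count (m - e) n = 0"
    proof
      fix m assume m: "m \<in> {-int N..int N} - {-int n + e..int n + e}"
      then have "\<not> \<bar>m - e\<bar> \<le> int n" by auto
      then have "crank_count (m - e) n = 0" using crank_count_support by blast
      then show "m ^ k * crank_count (m - e) n = 0" by simp
    qed
  qed simp
  also have "\<dots> = (\<Sum>m\<in>{-int n..int n}. (e + m) ^ k * crank_count m n)"
    by (rule sum.reindex_bij_witness[of _ "\<lambda>m. m + e" "\<lambda>m. m - e"]) auto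
  also have "\<dots> = (\<Sum>m\<in>{-int n..int n}. \<Sum>r\<le>k. of_nat (k choose r) * e ^ r * (m ^ (k - r) * crank_count m n))"
    by (subst binomial_ring) (simp only: sum_distrib_right mult.assoc)
  also have "\<dots> = (\<Sum>r\<le>k. of_nat (k choose r) * e ^ r * crank_moment (k - r) n)"
    by (subst sum.swap) (simp only: sum_distrib_left crank_moment_eq[OF order_refl])
  finally show ?thesis .
qed

lemma crank_moment_0_0: "crank_moment k 0 = 0 ^ k"
proof -
  have "crank_moment k 0 = (\<Sum>m\<in>{0}. m ^ k * crank_count m 0)"
    using crank_moment_eq[of 0 0 k] by simp
  then show ?thesis by (simp add: crank_count_def crank_gf_0)
qed

text \<open>At x = 1 the bracket x^d + x^(-d) - 1 equals 1; what remains is the recurrence n p(n) =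
  sum of sigma(j) p(n - j) of the partition function.\<close>

lemma crank_moment_0_rec:
  "int n * crank_moment 0 n = (\<Sum>j=1..n. int (divsum 1 j) * crank_moment 0 (n - j))"
proof -
  have "int n * crank_moment 0 n = (\<Sum>m\<in>{-int n..int n}. (of_nat n * crank_gf $ n) $$ m)"
    by (simp only: crank_moment_eq[OF order_refl] crank_count_def fls_of_nat_mult_nth sum_distrib_left
        power_0 mult_1_left of_nat_id)
  also have "\<dots> = (\<Sum>m\<in>{-int n..int n}. \<Sum>j=1..n. \<Sum>i | i dvd j.
          int i * (crank_count (m - int (j div i)) (n - j) + crank_count (m - (- int (j div i))) (n - j)
            - crank_count m (n - j)))"
    unfolding crank_gf_theta_q fls_nth_sum
    by (simp only: crank_theta_coeff crank_count_def)
  also have "\<dots> = (\<Sum>j=1..n. \<Sum>i | i dvd j. int i *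
      ((\<Sum>m\<in>{-int n..int n}. m ^ 0 * crank_count (m - int (j div i)) (n - j))
       + (\<Sum>m\<in>{-int n..int n}. m ^ 0 * crank_count (m - (- int (j div i))) (n - j))
       - (\<Sum>m\<in>{-int n..int n}. m ^ 0 * crank_count m (n - j))))"
    by (subst sum_swap_inner)
       (simp only: sum_distrib_left sum.distrib sum_subtractf distrib_left right_diff_distrib power_0 mult_1_left)
  also have "\<dots> = (\<Sum>j=1..n. \<Sum>i | i dvd j. int i * crank_moment 0 (n - j))"
  proof (intro sum.cong refl, goal_cases)
    case (1 j i)
    have "j div i \<le> j" by simp
    then have "n - j + j div i \<le> n" using 1 unfolding atLeastAtMost_iff by linarith
    then have "n - j + nat \<bar>int (j div i)\<bar> \<le> n" "n - j + nat \<bar>- int (j div i)\<bar> \<le> n"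
      by simp_all
    then show ?case
      unfolding crank_moment_shift[OF \<open>n - j + nat \<bar>int (j div i)\<bar> \<le> n\<close>]
        crank_moment_shift[OF \<open>n - j + nat \<bar>- int (j div i)\<bar> \<le> n\<close>]
        crank_moment_eq[OF diff_le_self, symmetric]
      by simp
  qed
  finally show ?thesis by (simp only: divsum_def sum_distrib_right power_one_right of_nat_sum)
qed

text \<open>One factor of m^(2k+2) is absorbed by x d/dx. The shifts by d and -d enter with opposite
  signs, so only odd powers of d survive, and with them only even moments.\<close>

lemma crank_moment_rec:
  "crank_moment (2 * k + 2) n = (\<Sum>j=1..n. \<Sum>l\<le>k. of_nat ((2 * k + 1) choose (2 * l + 1)) *
     (2 * int (divsum (2 * l + 1) j)) * crank_moment (2 * (k - l)) (n - j))"
proof -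
  let ?K = "2 * k + 1"
  have "crank_moment (2 * k + 2) n = (\<Sum>m\<in>{-int n..int n}. m ^ ?K * fls_theta (crank_gf $ n) $$ m)"
    unfolding crank_moment_eq[OF order_refl] crank_count_def fls_theta_nth
    by (rule sum.cong) (simp_all add: power_add power2_eq_square)
  also have "\<dots> = (\<Sum>m\<in>{-int n..int n}. \<Sum>j=1..n. \<Sum>d | d dvd j.
          m ^ ?K * (crank_count (m - int d) (n - j) - crank_count (m - (- int d)) (n - j)))"
    unfolding crank_gf_theta_x fls_nth_sum
    by (simp only: crank_count_def left_diff_distrib fls_X_power_times_conv_shift
            fls_X_inv_power_times_conv_shift sum_distrib_left) simp
  also have "\<dots> = (\<Sum>j=1..n. \<Sum>d | d dvd j. 
      (\<Sum>m\<in>{-int n..int n}. m ^ ?K * crank_count (m - int d) (n - j))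
       - (\<Sum>m\<in>{-int n..int n}. m ^ ?K * crank_count (m - (- int d)) (n - j)))"
    by (subst sum_swap_inner) (simp only: right_diff_distrib sum_subtractf)
  also have "\<dots> = (\<Sum>j=1..n. \<Sum>d | d dvd j. \<Sum>l\<le>k. 
      of_nat (?K choose (2 * l + 1)) * (2 * int d ^ (2 * l + 1)) * crank_moment (2 * (k - l)) (n - j))"
  proof (intro sum.cong refl, goal_cases)
    case (1 j d)
    have "d \<le> j" using 1 by (auto intro: dvd_imp_le)
    then have "n - j + nat \<bar>int d\<bar> \<le> n" "n - j + nat \<bar>- int d\<bar> \<le> n"
      using 1 by auto
    then have "(\<Sum>m\<in>{-int n..int n}. m ^ ?K * crank_count (m - int d) (n - j))
       - (\<Sum>m\<in>{-int n..int n}. m ^ ?K * crank_count (m - (- int d)) (n - j))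
      = (\<Sum>r\<le>?K. of_nat (?K choose r) * (int d ^ r - (- int d) ^ r) * crank_moment (?K - r) (n - j))"
      unfolding crank_moment_shift[OF \<open>n - j + nat \<bar>int d\<bar> \<le> n\<close>]
        crank_moment_shift[OF \<open>n - j + nat \<bar>- int d\<bar> \<le> n\<close>]
      by (simp only: sum_subtractf[symmetric] left_diff_distrib right_diff_distrib)
    also have "\<dots> = (\<Sum>r\<in>(\<lambda>l. 2 * l + 1) ` {..k}. of_nat (?K choose r) * (int d ^ r - (- int d) ^ r) * crank_moment (?K - r) (n - j))"
    proof (rule sum.mono_neutral_right)
      show "\<forall>i\<in>{..?K} - (\<lambda>l. 2 * l + 1) ` {..k}. 
          of_nat (?K choose i) * (int d ^ i - (- int d) ^ i) * crank_moment (?K - i) (n - j) = 0"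
      proof
        fix i assume i: "i \<in> {..?K} - (\<lambda>l. 2 * l + 1) ` {..k}"
        have "even i"
        proof (rule ccontr)
          assume "odd i"
          then obtain l where "i = 2 * l + 1" by (elim oddE)
          with i show False by auto
        qed
        then show "of_nat (?K choose i) * (int d ^ i - (- int d) ^ i) * crank_moment (?K - i) (n - j) = 0"
          by simp
      qed
    qed auto
    also have "\<dots> = (\<Sum>l\<le>k. of_nat (?K choose (2 * l + 1)) * (2 * int d ^ (2 * l + 1)) * crank_moment (2 * (k - l)) (n - j))"
      by (subst sum.reindex) (auto simp: inj_on_def diff_mult_distrib2)
    finally show ?case .
  qed
  also have "\<dots> = (\<Sum>j=1..n. \<Sum>l\<le>k. \<Sum>d | d dvd j.
      of_nat (?K choose (2 * l + 1)) * (2 * int d ^ (2 * l + 1)) * crank_moment (2 * (k - l)) (n - j))"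
    by (rule sum.cong[OF refl], rule sum.swap)
  also have "\<dots> = (\<Sum>j=1..n. \<Sum>l\<le>k. of_nat (?K choose (2 * l + 1)) *
     (2 * int (divsum (2 * l + 1) j)) * crank_moment (2 * (k - l)) (n - j))"
    by (simp only: divsum_def sum_distrib_left sum_distrib_right of_nat_sum of_nat_power)
  finally show ?thesis .
qed

section \<open>The functions $\sum_d d^r e^{-dw}$ near and away from the origin\<close>

lemma summable_power_weight:
  fixes x :: real
  assumes "0 \<le> x" "x < 1"
  shows "summable (\<lambda>n. real n ^ r * x ^ n)"
proof (rule root_test_convergence)
  have "(\<lambda>n. root n (real n) ^ r * x) \<longlonglongrightarrow> 1 ^ r * x"
    by (intro tendsto_intros LIMSEQ_root)
  then have "(\<lambda>n. root n (real n) ^ r * x) \<longlonglongrightarrow> x" by simp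
  moreover have "\<forall>\<^sub>F n in sequentially. root n (real n) ^ r * x = root n (norm (real n ^ r * x ^ n))"
    using eventually_gt_at_top[of 0]
    by eventually_elim (use assms in \<open>simp add: real_root_mult real_root_power real_root_power_cancel abs_mult power_abs\<close>)
  ultimately show "(\<lambda>n. root n (norm (real n ^ r * x ^ n))) \<longlonglongrightarrow> x"
    by (rule Lim_transform_eventually)
qed fact

text \<open>The term n = 0 is 1 for r = 0 and 0 otherwise; this is the extra 1 in
  \<open>lser_0\<close> and \<open>lser_eq\<close>.\<close>

definition lser :: "nat \<Rightarrow> complex \<Rightarrow> complex" where
  "lser r w = (\<Sum>n. of_nat n ^ r * exp (- w) ^ n)"

lemma summable_norm_lser:
  assumes "Re w > 0"
  shows "summable (\<lambda>n. norm (of_nat n ^ r * exp (- w) ^ n :: complex))"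
  using summable_power_weight[of "exp (- Re w)" r] assms
  by (simp add: norm_mult norm_power)

lemma summable_lser:
  assumes "Re w > 0"
  shows "summable (\<lambda>n. of_nat n ^ r * exp (- w) ^ n :: complex)"
  using summable_norm_lser[OF assms] by (rule summable_norm_cancel)

lemma exp_neq_1_right:
  assumes "Re w > 0"
  shows "exp w \<noteq> (1 :: complex)"
proof
  assume "exp w = 1"
  then have "norm (exp w) = 1" by simp
  with assms show False by simp
qed

lemma lser_0:
  assumes "Re w > 0"
  shows "lser 0 w = 1 / (exp w - 1) + 1"
proof -
  have "norm (exp (- w)) < 1" using assms by simp
  then have "lser 0 w = 1 / (1 - exp (- w))" by (simp add: lser_def suminf_geometric)
  also have "\<dots> = 1 / (exp w - 1) + 1"
    using exp_neq_1_right[OF assms] by (simp add: exp_minus field_simps)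
  finally show ?thesis .
qed

text \<open>Termwise differentiation of a power series in e^(-w). The coefficients are arbitrary
  because both the powers n^r and the logarithm of the partition generating function are treated
  this way.\<close>

lemma has_field_derivative_exp_series:
  fixes a :: "nat \<Rightarrow> complex"
  assumes sum: "\<And>x. 0 < x \<Longrightarrow> x < 1 \<Longrightarrow> summable (\<lambda>n. norm (a n) * x ^ n)" and w: "Re w > 0"
  shows "((\<lambda>w. \<Sum>n. a n * exp (- w) ^ n) has_field_derivative
           - (\<Sum>n. of_nat n * a n * exp (- w) ^ n)) (at w)"
proof -
  define x where "x = exp (- (Re w / 2))"
  have x: "0 < x" "x < 1" "norm (exp (- w)) < norm (complex_of_real x)" using w by (auto simp: x_def)
  have sumx: "summable (\<lambda>n. a n * complex_of_real x ^ n)"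
    using x sum[OF x(1,2)] by (intro summable_norm_cancel[of "\<lambda>n. _ n * _ n"]) (simp add: norm_mult norm_power)
  from termdiffs_strong[OF this x(3)]
  have "DERIV (\<lambda>z. \<Sum>n. a n * z ^ n) (exp (- w)) :> (\<Sum>n. diffs a n * exp (- w) ^ n)" .
  moreover have "((\<lambda>w. exp (- w)) has_field_derivative - exp (- w)) (at w)"
    by (auto intro!: derivative_eq_intros)
  ultimately have "((\<lambda>w. \<Sum>n. a n * exp (- w) ^ n) has_field_derivative
      (\<Sum>n. diffs a n * exp (- w) ^ n) * - exp (- w)) (at w)"
    by (rule DERIV_chain2)
  moreover have "(\<Sum>n. diffs a n * exp (- w) ^ n) * exp (- w) = (\<Sum>n. of_nat n * a n * exp (- w) ^ n)"
  proof -
    have sd: "summable (\<lambda>n. diffs a n * exp (- w) ^ n)"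
      by (rule termdiff_converges[OF x(3)], rule powser_inside[OF sumx]) auto
    have eq: "diffs a n * exp (- w) ^ n * exp (- w) = of_nat (Suc n) * a (Suc n) * exp (- w) ^ Suc n" for n
      by (simp add: diffs_def)
    have "summable (\<lambda>n. of_nat (Suc n) * a (Suc n) * exp (- w) ^ Suc n)"
      using summable_mult2[OF sd, of "exp (- w)"] unfolding eq .
    then have S: "summable (\<lambda>n. of_nat n * a n * exp (- w) ^ n)" by (subst (asm) summable_Suc_iff)
    have "(\<Sum>n. diffs a n * exp (- w) ^ n) * exp (- w) = (\<Sum>n. of_nat (Suc n) * a (Suc n) * exp (- w) ^ Suc n)"
      unfolding eq[symmetric] by (rule suminf_mult2[OF sd])
    also have "\<dots> = (\<Sum>n. of_nat n * a n * exp (- w) ^ n)"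
      using suminf_split_head[OF S] by simp
    finally show ?thesis .
  qed
  ultimately show ?thesis by simp
qed

lemma has_field_derivative_lser:
  assumes "Re w > 0"
  shows "(lser r has_field_derivative - lser (Suc r) w) (at w)"
  using has_field_derivative_exp_series[of "\<lambda>n. of_nat n ^ r" w] assms summable_power_weight[of _ r]
  by (simp add: lser_def[abs_def] norm_power)

text \<open>For n >= 1 and Re w >= 1, n Re w >= n + Re w - 1, so a factor e^(1 - Re w) can be pulled
  out of every term; the term n = 0 vanishes as r >= 1.\<close>

lemma norm_lser_le:
  assumes "Re w \<ge> 1" "r \<ge> 1"
  shows "norm (lser r w) \<le> (\<Sum>n. real n ^ r * exp (-1) ^ n) * exp (1 - Re w)"
proof -
  have w: "Re w > 0" using assms by simp
  have S: "summable (\<lambda>n. real n ^ r * exp (-1) ^ n)" by (rule summable_power_weight) auto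
  have "norm (lser r w) \<le> (\<Sum>n. norm (of_nat n ^ r * exp (- w) ^ n :: complex))"
    unfolding lser_def by (rule summable_norm[OF summable_norm_lser[OF w]])
  also have "\<dots> \<le> (\<Sum>n. real n ^ r * exp (-1) ^ n * exp (1 - Re w))"
  proof (rule suminf_le)
    fix n
    show "norm (of_nat n ^ r * exp (- w) ^ n :: complex) \<le> real n ^ r * exp (-1) ^ n * exp (1 - Re w)"
    proof (cases "n = 0")
      case False
      have "0 \<le> (real n - 1) * (Re w - 1)" using False assms by (intro mult_nonneg_nonneg) auto
      then have "real n * - Re w \<le> real n * (-1) + (1 - Re w)" by (simp add: algebra_simps)
      then have "exp (- Re w) ^ n \<le> exp (-1) ^ n * exp (1 - Re w)"
        by (simp add: exp_of_nat_mult[symmetric] exp_add[symmetric])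
      then have "real n ^ r * exp (- Re w) ^ n \<le> real n ^ r * (exp (-1) ^ n * exp (1 - Re w))"
        by (intro mult_left_mono) auto
      then show ?thesis by (simp add: norm_mult norm_power mult.assoc)
    qed (use assms in \<open>simp add: power_0_left\<close>)
  qed (use summable_norm_lser[OF w] summable_mult2[OF S] in auto)
  also have "\<dots> = (\<Sum>n. real n ^ r * exp (-1) ^ n) * exp (1 - Re w)"
    by (rule suminf_mult2[OF S, symmetric])
  finally show ?thesis .
qed

section \<open>The regular part of 1/(e^w - 1)\<close>

definition expquot :: "complex \<Rightarrow> complex" where
  "expquot w = (if w = 0 then 1 else (exp w - 1) / w)"

text \<open>\<open>bfun\<close> is $1/(e^w-1) - 1/w$ with its removable singularity at 0 filled in.\<close>

definition bfun :: "complex \<Rightarrow> complex" where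
  "bfun w = (if w = 0 then deriv (\<lambda>w. 1 / expquot w) 0 else 1 / (exp w - 1) - 1 / w)"

text \<open>The radius 6 is below 2 pi, the distance from 0 to the nearest other pole of 1/(e^w -
  1).\<close>

definition bdom :: "complex set" where
  "bdom = {w. Re w > 0} \<union> ball 0 6"

lemma open_bdom: "open bdom"
  unfolding bdom_def by (intro open_Un open_halfspace_Re_gt open_ball)

lemma exp_neq_1_bdom:
  assumes "w \<in> bdom" "w \<noteq> 0"
  shows "exp w \<noteq> 1"
proof (cases "Re w > 0")
  case False
  then have w: "norm w < 6" using assms by (auto simp: bdom_def)
  show ?thesis
  proof
    assume "exp w = 1"
    then obtain n :: int where n: "Re w = 0" "Im w = of_int (2 * n) * pi"
      by (auto simp: exp_eq_1)
    with assms have "n \<noteq> 0" by (auto simp: complex_eq_iff)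
    then have "1 \<le> \<bar>real_of_int n\<bar>" by linarith
    then have "2 * pi \<le> \<bar>Im w\<bar>" unfolding n by (simp add: abs_mult)
    also have "\<dots> \<le> norm w" by (rule abs_Im_le_cmod)
    finally show False using w pi_gt3 by simp
  qed
qed (rule exp_neq_1_right)

lemma expquot_holomorphic: "expquot holomorphic_on UNIV"
proof -
  have "(\<lambda>z. if z = 0 then deriv exp 0 else (exp z - exp 0) / (z - 0 :: complex)) holomorphic_on UNIV"
    by (rule pole_lemma) (auto intro: holomorphic_intros)
  moreover have "deriv exp (0::complex) = 1" by (rule DERIV_imp_deriv) (auto intro!: derivative_eq_intros)
  ultimately show ?thesis by (simp add: expquot_def[abs_def] cong: if_cong)
qed

lemma expquot_nonzero: "w \<in> bdom \<Longrightarrow> expquot w \<noteq> 0"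
  using exp_neq_1_bdom by (auto simp: expquot_def)

lemma zero_in_bdom [simp]: "0 \<in> bdom"
  by (simp add: bdom_def)

text \<open>Away from 0, 1/(e^w - 1) - 1/w is the difference quotient at 0 of
  1/\<open>expquot\<close>, and difference quotients of holomorphic functions extend.\<close>

lemma bfun_holomorphic: "bfun holomorphic_on bdom"
proof -
  have "(\<lambda>w. 1 / expquot w) holomorphic_on bdom"
    using expquot_nonzero by (intro holomorphic_intros holomorphic_on_subset[OF expquot_holomorphic]) auto
  then have "(\<lambda>z. if z = 0 then deriv (\<lambda>w. 1 / expquot w) 0
      else (1 / expquot z - 1 / expquot 0) / (z - 0)) holomorphic_on bdom"
    by (rule pole_lemma) (simp add: interior_open[OF open_bdom])
  also have "?this \<longleftrightarrow> bfun holomorphic_on bdom"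
    using exp_neq_1_bdom by (intro holomorphic_cong) (auto simp: bfun_def expquot_def divide_simps)
  finally show ?thesis .
qed

text \<open>With this sign the derivative of \<open>bder r\<close> is \<open>- bder (Suc r)\<close>,
  the same rule as for \<open>lser\<close>.\<close>

definition bder :: "nat \<Rightarrow> complex \<Rightarrow> complex" where
  "bder r w = (-1) ^ r * (deriv ^^ r) bfun w"

lemma bder_holomorphic: "bder r holomorphic_on bdom"
  unfolding bder_def[abs_def]
  by (intro holomorphic_intros holomorphic_higher_deriv bfun_holomorphic open_bdom)

lemma has_field_derivative_bder:
  assumes "w \<in> bdom"
  shows "(bder r has_field_derivative - bder (Suc r) w) (at w)"
proof -
  have "((deriv ^^ r) bfun has_field_derivative deriv ((deriv ^^ r) bfun) w) (at w)"
    using holomorphic_higher_deriv[OF bfun_holomorphic open_bdom] assms open_bdom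
    by (auto intro: holomorphic_derivI)
  then show ?thesis unfolding bder_def[abs_def] by (auto intro!: derivative_eq_intros)
qed

text \<open>Repeated differentiation of the case r = 0, where 1/(e^w - 1) = 1/w +
  \<open>bfun w\<close>; the constant 1 disappears in the first step.\<close>

lemma lser_eq:
  assumes "Re w > 0"
  shows "lser r w = fact r / w ^ (r + 1) + bder r w + (if r = 0 then 1 else 0)"
  using assms
proof (induction r arbitrary: w)
  case 0
  then show ?case by (auto simp: lser_0 bder_def bfun_def)
next
  case (Suc r)
  have w: "w \<noteq> 0" "w \<in> bdom" using Suc.prems by (auto simp: bdom_def)
  have *: "((\<lambda>w. fact r / w ^ (r + 1)) has_field_derivative - (fact (Suc r) / w ^ (Suc r + 1))) (at w)"
  proof -
    have "((\<lambda>w. w ^ (r + 1)) has_field_derivative of_nat (r + 1) * w ^ r) (at w)"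
      using DERIV_power[OF DERIV_ident, of "r + 1" w] by simp
    then show ?thesis
      by (rule DERIV_cong[OF DERIV_divide[OF DERIV_const]]) (use w(1) in \<open>simp_all add: field_simps\<close>)
  qed
  have "((\<lambda>w. fact r / w ^ (r + 1) + bder r w + (if r = 0 then 1 else 0)) has_field_derivative
         - (fact (Suc r) / w ^ (Suc r + 1)) + - bder (Suc r) w + 0) (at w)"
    by (intro DERIV_add * has_field_derivative_bder w DERIV_const)
  then have "(lser r has_field_derivative - (fact (Suc r) / w ^ (Suc r + 1)) + - bder (Suc r) w + 0) (at w)"
    by (rule has_field_derivative_transform_within_open[where S = "{w. Re w > 0}"])
       (use Suc in \<open>auto simp: open_halfspace_Re_gt\<close>)
  from DERIV_unique[OF this has_field_derivative_lser[OF Suc.prems]] show ?case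
    by (simp add: algebra_simps)
qed

text \<open>For s = x (1 + i u) with x > 0 this is |u| <= 1. Norm and real part are comparable here,
  which turns exponential decay in Re w into decay in |w|.\<close>

definition sector :: "complex set" where
  "sector = {w. \<bar>Im w\<bar> \<le> Re w}"

lemma sector_Re_pos: "w \<in> sector \<Longrightarrow> w \<noteq> 0 \<Longrightarrow> Re w > 0"
  by (auto simp: sector_def complex_eq_iff)

lemma sector_subset_bdom: "sector \<subseteq> bdom"
  using sector_Re_pos by (fastforce simp: bdom_def)

lemma sector_norm_sq: "w \<in> sector \<Longrightarrow> norm w ^ 2 \<le> 2 * Re w ^ 2"
  unfolding sector_def cmod_power2 by (auto simp: abs_le_square_iff[symmetric])

lemma sector_Re_ge: "w \<in> sector \<Longrightarrow> norm w / 2 \<le> Re w"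
  unfolding sector_def using cmod_le[of w] by auto

lemma closed_sector: "closed sector"
  unfolding sector_def by (intro closed_Collect_le continuous_intros)

lemma convex_sector: "convex sector"
proof -
  have "sector = {w. Im w \<le> Re w} \<inter> {w. - Im w \<le> Re w}" by (auto simp: sector_def)
  moreover have "convex {w. Im w \<le> Re w}" "convex {w. - Im w \<le> Re w}"
    by (auto simp: convex_def; smt (verit) distrib_left mult_left_mono mult_minus_right)+
  ultimately show ?thesis by (metis convex_Int)
qed

lemma sector_scale: "w \<in> sector \<Longrightarrow> x \<ge> 0 \<Longrightarrow> of_real x * w \<in> sector"
  by (auto simp: sector_def abs_mult mult_left_mono)

text \<open>Continuity takes care of the compact part. Farther out \<open>lser\<close> decays
  exponentially, and the polar term r!/w^(r+1) is O(1/|w|^2) because r >= 1; for r = 0 the bound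
  would fail, as \<open>bfun\<close> behaves like -1/w.\<close>

lemma norm_bder_le:
  assumes "r \<ge> 1"
  obtains C where "C > 0" "\<And>w. w \<in> sector \<Longrightarrow> norm (bder r w) \<le> C / (1 + norm w ^ 2)"
proof -
  have "continuous_on (sector \<inter> cball 0 2) (bder r)"
    using sector_subset_bdom
    by (intro holomorphic_on_imp_continuous_on holomorphic_on_subset[OF bder_holomorphic]) auto
  then have "compact (bder r ` (sector \<inter> cball 0 2))"
    by (rule compact_continuous_image) (intro closed_Int_compact closed_sector compact_cball)
  then have "bounded (bder r ` (sector \<inter> cball 0 2))" by (rule compact_imp_bounded)
  then obtain B where "B > 0" "\<forall>x\<in>bder r ` (sector \<inter> cball 0 2). norm x \<le> B"
    unfolding bounded_pos by blast
  then have B: "B > 0" "\<And>w. w \<in> sector \<inter> cball 0 2 \<Longrightarrow> norm (bder r w) \<le> B" by auto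
  define S where "S = (\<Sum>n. real n ^ r * exp (-1) ^ n)"
  have "S \<ge> 0" unfolding S_def by (intro suminf_nonneg summable_power_weight) auto
  \<comment> \<open>One summand for each source: |w| <= 2 gives 5 B; outside, 1 + |w|^2 <= 5 e^(Re
    w) gives the second and 1 + |w|^2 <= 2 |w|^(r+1) the third.\<close>
  define C where "C = 5 * B + 5 * exp 1 * S + 2 * fact r"
  have "C > 0" unfolding C_def using B(1) \<open>S \<ge> 0\<close> by (intro add_pos_nonneg add_nonneg_pos) auto
  moreover have "norm (bder r w) \<le> C / (1 + norm w ^ 2)" if w: "w \<in> sector" for w
  proof -
    have pos: "0 < 1 + norm w ^ 2" by (simp add: add_pos_nonneg)
    have "norm (bder r w) * (1 + norm w ^ 2) \<le> C"
    proof (cases "norm w \<le> 2")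
      case True
      have "norm w ^ 2 \<le> 2 ^ 2" using True by (intro power_mono) auto
      then have "norm (bder r w) * (1 + norm w ^ 2) \<le> B * 5"
        using True w B(1) by (intro mult_mono B) auto
      then show ?thesis unfolding C_def using \<open>S \<ge> 0\<close> by (simp add: add_increasing2)
    next
      case False
      define x where "x = Re w"
      have x: "x \<ge> 1" using sector_Re_ge[OF w] False by (simp add: x_def)
      have "1 + x + x\<^sup>2 / 2 \<le> exp x" using x by (intro exp_lower_Taylor_quadratic) auto
      then have "1 + norm w ^ 2 \<le> 5 * exp x" using sector_norm_sq[OF w] x zero_le_power2[of x]
        unfolding x_def by linarith
      then have "S * exp (1 - x) * (1 + norm w ^ 2) \<le> S * exp (1 - x) * (5 * exp x)"
        using \<open>S \<ge> 0\<close> by (intro mult_left_mono) auto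
      also have "\<dots> = 5 * exp 1 * S" by (simp add: exp_diff)
      finally have "S * exp (1 - x) * (1 + norm w ^ 2) \<le> 5 * exp 1 * S" .
      moreover have "norm (lser r w) \<le> S * exp (1 - x)"
        using norm_lser_le[of w r] x assms by (simp add: S_def x_def)
      ultimately have 1: "norm (lser r w) * (1 + norm w ^ 2) \<le> 5 * exp 1 * S"
        using mult_right_mono[of "norm (lser r w)" "S * exp (1 - x)" "1 + norm w ^ 2"] pos by linarith
      have "norm w ^ 2 \<le> norm w ^ (r + 1)" using False assms by (intro power_increasing) auto
      moreover have "1 \<le> norm w ^ 2" using False by (intro one_le_power) auto
      ultimately have "1 + norm w ^ 2 \<le> 2 * norm w ^ (r + 1)" by simp
      then have "fact r * (1 + norm w ^ 2) \<le> fact r * (2 * norm w ^ (r + 1))"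
        by (intro mult_left_mono) auto
      moreover have "norm w ^ (r + 1) > 0" using False by (intro zero_less_power) auto
      ultimately have 2: "norm (fact r / w ^ (r + 1)) * (1 + norm w ^ 2) \<le> 2 * fact r"
        by (simp add: norm_divide norm_power norm_mult field_simps)
      have "bder r w = lser r w - fact r / w ^ (r + 1)"
        using lser_eq[of w r] x assms by (simp add: x_def)
      then have "norm (bder r w) \<le> norm (lser r w) + norm (fact r / w ^ (r + 1))"
        by (simp only: norm_triangle_ineq4)
      then have "norm (bder r w) * (1 + norm w ^ 2)
          \<le> (norm (lser r w) + norm (fact r / w ^ (r + 1))) * (1 + norm w ^ 2)"
        using pos by (intro mult_right_mono) auto
      also have "\<dots> \<le> 5 * exp 1 * S + 2 * fact r" using 1 2 by (simp only: distrib_right)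
      finally show ?thesis unfolding C_def using B(1) by simp
    qed
    then show ?thesis using pos by (simp add: field_simps)
  qed
  ultimately show ?thesis using that by blast
qed

text \<open>Continuity and differentiability at 0 being known, the values may be computed as real
  limits along the positive axis. They are the source of the terms -1/(2s) and 1/24 in
  \<open>Phi_1_asymp\<close>.\<close>

lemma bder_at_0: "bder 0 0 = - 1 / 2" "bder 1 0 = - 1 / 12"
proof -
  have lim0: "((\<lambda>x::real. 1 / (exp x - 1) - 1 / x) \<longlongrightarrow> - 1 / 2) (at_right 0)" by real_asymp
  have lim1: "((\<lambda>x::real. (1 / (exp x - 1) - 1 / x - (- 1 / 2)) / x) \<longlongrightarrow> 1 / 12) (at_right 0)" by real_asymp
  have f: "filterlim complex_of_real (at 0) (at_right 0)"
    unfolding filterlim_at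
    by (auto intro!: tendsto_eq_intros simp: eventually_at_filter)
  have "isCont bfun 0"
    using bfun_holomorphic open_bdom zero_in_bdom
    by (metis continuous_on_eq_continuous_at holomorphic_on_imp_continuous_on)
  then have "((\<lambda>x. bfun (of_real x)) \<longlongrightarrow> bfun 0) (at_right 0)"
    unfolding isCont_def by (rule filterlim_compose[OF _ f])
  moreover have "((\<lambda>x. bfun (of_real x)) \<longlongrightarrow> of_real (- 1 / 2)) (at_right 0)"
    by (rule Lim_transform_eventually[OF tendsto_of_real[OF lim0]])
       (simp add: eventually_at_filter bfun_def exp_of_real)
  ultimately have b0: "bfun 0 = of_real (- 1 / 2)"
    by (rule tendsto_unique[rotated]) simp
  then show "bder 0 0 = - 1 / 2" by (simp add: bder_def)
  have "(bfun has_field_derivative deriv bfun 0) (at 0)"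
    using bfun_holomorphic open_bdom zero_in_bdom by (auto intro: holomorphic_derivI)
  then have "((\<lambda>w. (bfun w - bfun 0) / (w - 0)) \<longlongrightarrow> deriv bfun 0) (at 0)"
    by (simp add: has_field_derivative_iff)
  then have "((\<lambda>x. (bfun (of_real x) - bfun 0) / (of_real x - 0)) \<longlongrightarrow> deriv bfun 0) (at_right 0)"
    by (rule filterlim_compose[OF _ f])
  moreover have "((\<lambda>x. (bfun (of_real x) - bfun 0) / (of_real x - 0)) \<longlongrightarrow> of_real (1 / 12)) (at_right 0)"
    unfolding b0
    by (rule Lim_transform_eventually[OF tendsto_of_real[OF lim1]])
       (simp add: eventually_at_filter bfun_def exp_of_real)
  ultimately have "deriv bfun 0 = of_real (1 / 12)"
    by (rule tendsto_unique[rotated]) simp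
  then show "bder 1 0 = - 1 / 12" by (simp add: bder_def)
qed

section \<open>Lambert series near the origin\<close>

text \<open>The divisors of n + 1 correspond to its factorizations (e + 1)(d + 1), so both series
  sum the same absolutely summable family. General coefficients cover d^r for \<open>Phi\<close> and
  1/d for \<open>Lam\<close>.\<close>

lemma lambert_sums:
  fixes c :: "nat \<Rightarrow> complex"
  assumes z: "norm z < 1" and c: "\<And>d. norm (c (Suc d)) \<le> real (Suc d) ^ R"
  shows "\<exists>S. (\<lambda>n. (\<Sum>d | d dvd Suc n. c d) * z ^ Suc n) sums S
             \<and> (\<lambda>e. \<Sum>d. c (Suc d) * (z ^ Suc e) ^ Suc d) sums S"
proof -
  define f where "f = (\<lambda>(e, d). c (Suc d) * (z ^ Suc e) ^ Suc d)"
  define x where "x = norm z"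
  have x: "0 \<le> x" "x < 1" using z by (auto simp: x_def)
  define b where "b = (\<lambda>d. real (Suc d) ^ R * x ^ Suc d)"
  have "summable b"
    unfolding b_def using summable_power_weight[OF x, of R] by (subst summable_Suc_iff)
  have b_nonneg: "b d \<ge> 0" for d unfolding b_def using x by simp
  have f_le: "norm (f (e, d)) \<le> x ^ e * b d" for e d
  proof -
    \<comment> \<open>Dropping e d from the exponent separates the variables: the family is
      dominated by a geometric series in e times a power-weighted series in d.\<close>
    have "Suc e * Suc d = e * d + (e + Suc d)" by simp
    then have "(x ^ Suc e) ^ Suc d = x ^ (e * d) * (x ^ e * x ^ Suc d)"
      by (simp only: power_mult[symmetric] power_add)
    also have "\<dots> \<le> 1 * (x ^ e * x ^ Suc d)"
      using x by (intro mult_right_mono power_le_one mult_nonneg_nonneg zero_le_power) auto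
    finally have "norm (c (Suc d)) * (x ^ Suc e) ^ Suc d \<le> real (Suc d) ^ R * (x ^ e * x ^ Suc d)"
      using x by (intro mult_mono c) auto
    then show ?thesis
      by (simp only: f_def prod.case norm_mult norm_power x_def[symmetric] b_def) (simp only: mult_ac)
  qed
  have "(b has_sum suminf b) UNIV"
    using \<open>summable b\<close> b_nonneg by (intro sums_nonneg_imp_has_sum) (auto simp: summable_sums)
  moreover have "(\<lambda>e. x ^ e) summable_on UNIV"
    using x by (intro summable_nonneg_imp_summable_on summable_geometric) auto
  ultimately have "(\<lambda>(e, d). x ^ e * b d) summable_on UNIV \<times> UNIV"
    using x b_nonneg
    by (intro summable_on_SigmaI[where g = "\<lambda>e. x ^ e * suminf b"])
       (auto intro: has_sum_cmult_right summable_on_cmult_left)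
  then have "(\<lambda>p. norm (f p)) summable_on UNIV \<times> UNIV"
    by (rule summable_on_comparison_test) (use f_le in auto)
  then have "f summable_on UNIV \<times> UNIV" by (rule abs_summable_summable)
  then obtain S where S: "(f has_sum S) (UNIV \<times> UNIV)" by (auto simp: summable_on_def)
  have inner: "((\<lambda>d. f (e, d)) has_sum (\<Sum>d. c (Suc d) * (z ^ Suc e) ^ Suc d)) UNIV" for e
  proof (rule norm_summable_imp_has_sum)
    show *: "summable (\<lambda>d. norm (f (e, d)))"
      by (rule summable_comparison_test'[where g = "\<lambda>d. x ^ e * b d" and N = 0])
         (use f_le \<open>summable b\<close> in auto)
    show "(\<lambda>d. f (e, d)) sums (\<Sum>d. c (Suc d) * (z ^ Suc e) ^ Suc d)"
      using summable_sums[OF summable_norm_cancel[OF *]] by (simp add: f_def)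
  qed
  have 1: "(\<lambda>e. \<Sum>d. c (Suc d) * (z ^ Suc e) ^ Suc d) sums S"
    by (rule has_sum_imp_sums, rule has_sum_SigmaD[OF S]) (rule inner)
  have "((\<lambda>(n, d). c d * z ^ Suc n) has_sum S) (SIGMA n:UNIV. {d. d dvd Suc n})
        \<longleftrightarrow> (f has_sum S) (UNIV \<times> UNIV)"
  proof (rule has_sum_reindex_bij_witness[where i = "\<lambda>(e, d). (Suc e * Suc d - 1, Suc d)"
        and j = "\<lambda>(n, d). (Suc n div d - 1, d - 1)"], goal_cases)
    case (1 a)
    then obtain n d k where a: "a = (n, d)" "Suc n = d * k" by (auto simp: dvd_def)
    then have pos: "d > 0" "k > 0" by (auto intro!: Nat.gr0I)
    then have "Suc (Suc n div d - 1) * Suc (d - 1) = Suc n" unfolding a(2) by simp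
    then show ?case using pos unfolding a(1) prod.case by simp
  next
    case (3 b)
    obtain e d where b: "b = (e, d)" by force
    have "Suc (Suc e * Suc d - 1) = Suc e * Suc d" by simp
    then show ?case unfolding b prod.case by (simp only: nonzero_mult_div_cancel_right) simp
  next
    case (4 b)
    obtain e d where b: "b = (e, d)" by force
    have "Suc (Suc e * Suc d - 1) = Suc e * Suc d" by simp
    then show ?case unfolding b prod.case by (auto simp del: mult_Suc mult_Suc_right)
  next
    case (5 a)
    then obtain n d k where a: "a = (n, d)" "Suc n = d * k" by (auto simp: dvd_def)
    then have pos: "d > 0" "k > 0" by (auto intro!: Nat.gr0I)
    then have *: "Suc (Suc n div d - 1) * d = Suc n" unfolding a(2) by simp
    have "Suc (d - 1) = d" using pos by simp
    then show ?case
      unfolding a(1) by (simp only: prod.case f_def power_mult[symmetric] *)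
  qed auto
  with S have "((\<lambda>(n, d). c d * z ^ Suc n) has_sum S) (SIGMA n:UNIV. {d. d dvd Suc n})" by simp
  then have "((\<lambda>n. (\<Sum>d | d dvd Suc n. c d) * z ^ Suc n) has_sum S) UNIV"
    by (rule has_sum_SigmaD) (auto intro!: has_sum_finiteI simp: sum_distrib_right)
  then have 2: "(\<lambda>n. (\<Sum>d | d dvd Suc n. c d) * z ^ Suc n) sums S" by (rule has_sum_imp_sums)
  from 1 2 show ?thesis by blast
qed

lemma divsum_le: "divsum r n \<le> n ^ Suc r"
proof (cases "n = 0")
  case False
  have le: "divsum r n \<le> (\<Sum>d | d dvd n. n ^ r)"
    unfolding divsum_def by (intro sum_mono power_mono) (use False in \<open>auto intro: dvd_imp_le\<close>)
  have "{d. d dvd n} \<subseteq> {1..n}"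
    using False by (auto dest: dvd_imp_le intro!: Suc_leI Nat.gr0I)
  then have "card {d. d dvd n} \<le> n" using card_mono[of "{1..n}" "{d. d dvd n}"] by simp
  then have "(\<Sum>d | d dvd n. n ^ r) \<le> n ^ Suc r" by simp
  with le show ?thesis by (rule order_trans)
qed simp

text \<open>The series of sigma_r(n) q^n at q = e^(-s); for odd r it is an Eisenstein series of
  weight r + 1 up to a factor and the constant term.\<close>

definition Phi :: "nat \<Rightarrow> complex \<Rightarrow> complex" where
  "Phi r s = (\<Sum>n. of_nat (divsum r n) * exp (- s) ^ n)"

text \<open>As sigma_1(n)/n is the sum of 1/d over the divisors d of n, this is the logarithm of the
  product of all 1/(1 - q^n), with q = e^(-s).\<close>

definition Lam :: "complex \<Rightarrow> complex" where
  "Lam s = (\<Sum>n. of_nat (divsum 1 n) / of_nat n * exp (- s) ^ n)"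

lemma summable_divsum:
  fixes x :: real
  assumes "0 \<le> x" "x < 1"
  shows "summable (\<lambda>n. real (divsum r n) * x ^ n)"
proof (rule summable_comparison_test'[where N = 0])
  show "summable (\<lambda>n. real n ^ Suc r * x ^ n)" by (rule summable_power_weight) fact+
  fix n
  have "real (divsum r n) \<le> real n ^ Suc r" using divsum_le[of r n] by (metis of_nat_le_iff of_nat_power)
  then have "real (divsum r n) * x ^ n \<le> real n ^ Suc r * x ^ n"
    using assms by (intro mult_right_mono) auto
  then show "norm (real (divsum r n) * x ^ n) \<le> real n ^ Suc r * x ^ n" using assms by simp
qed

lemma summable_divsum_over:
  fixes x :: real
  assumes "0 \<le> x" "x < 1"
  shows "summable (\<lambda>n. real (divsum 1 n) / real n * x ^ n)"
proof (rule summable_comparison_test'[OF summable_divsum[OF assms, of 1], where N = 1])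
  fix n :: nat assume "n \<ge> 1"
  then have "real (divsum 1 n) / real n \<le> real (divsum 1 n) / 1"
    by (intro divide_left_mono) auto
  then have "real (divsum 1 n) / real n \<le> real (divsum 1 n)" by simp
  then have "real (divsum 1 n) / real n * x ^ n \<le> real (divsum 1 n) * x ^ n"
    using assms by (intro mult_right_mono) auto
  then show "norm (real (divsum 1 n) / real n * x ^ n) \<le> real (divsum 1 n) * x ^ n" using assms by simp
qed

lemma summable_Lam:
  assumes "Re s > 0"
  shows "summable (\<lambda>n. of_nat (divsum 1 n) / of_nat n * exp (- s) ^ n :: complex)"
  using summable_divsum_over[of "exp (- Re s)"] assms
  by (intro summable_norm_cancel[of "\<lambda>n. _ n * _ n"]) (simp add: norm_mult norm_power norm_divide)

lemma has_field_derivative_Lam: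
  assumes "Re s > 0"
  shows "(Lam has_field_derivative - Phi 1 s) (at s)"
proof -
  have eq: "of_nat n * (of_nat (divsum 1 n) / of_nat n) = (of_nat (divsum 1 n) :: complex)" for n
    by (cases "n = 0") auto
  have "summable (\<lambda>n. norm (of_nat (divsum 1 n) / of_nat n :: complex) * x ^ n)"
    if "0 < x" "x < 1" for x :: real
    using summable_divsum_over[of x] that by (simp add: norm_divide)
  from has_field_derivative_exp_series[OF this assms] show ?thesis
    unfolding eq Lam_def[abs_def] Phi_def .
qed

lemma Phi_sums_lser:
  assumes "Re s > 0" "r \<ge> 1"
  shows "(\<lambda>e. lser r (of_nat (Suc e) * s)) sums Phi r s"
proof -
  define z where "z = exp (- s)"
  have "norm z < 1" using assms by (simp add: z_def)
  from lambert_sums[OF this, of "\<lambda>d. of_nat d ^ r" r] obtain S where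
    S: "(\<lambda>n. (\<Sum>d | d dvd Suc n. of_nat d ^ r) * z ^ Suc n) sums S"
       "(\<lambda>e. \<Sum>d. of_nat (Suc d) ^ r * (z ^ Suc e) ^ Suc d) sums S"
    by (auto simp: norm_power simp del: of_nat_Suc)
  have "lser r (of_nat (Suc e) * s) = (\<Sum>d. of_nat (Suc d) ^ r * (z ^ Suc e) ^ Suc d)" for e
  proof -
    have "exp (- (of_nat (Suc e) * s)) = z ^ Suc e"
      unfolding z_def exp_of_nat_mult[symmetric] by (simp only: mult_minus_right)
    moreover have "Re (of_nat (Suc e) * s) > 0" using assms by (simp del: of_nat_Suc)
    ultimately show ?thesis
      using suminf_split_head[OF summable_lser[of "of_nat (Suc e) * s" r]] assms
      by (simp add: lser_def power_0_left)
  qed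
  moreover have "S = Phi r s"
  proof -
    have "(\<lambda>n. of_nat (divsum r (Suc n)) * z ^ Suc n) sums S"
      using S(1) by (simp add: divsum_def)
    then have "(\<lambda>n. of_nat (divsum r n) * z ^ n) sums S" by (subst (asm) sums_Suc_iff) simp
    then show ?thesis by (simp add: Phi_def z_def sums_iff)
  qed
  ultimately show ?thesis using S(2) by simp
qed

text \<open>With coefficients 1/d the inner sums of the Lambert rearrangement are logarithms. Real
  arguments suffice for finding the constant term of the logarithm.\<close>

lemma Lam_sums_ln:
  assumes "x > 0"
  shows "(\<lambda>e. - ln (1 - exp (- (real (Suc e) * x)))) sums Re (Lam (of_real x))"
proof -
  define z where "z = complex_of_real (exp (- x))"
  have "norm z < 1" using assms by (simp add: z_def)
  moreover have "norm (1 / of_nat (Suc d) :: complex) \<le> real (Suc d) ^ 0" for d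
    by (simp add: norm_divide divide_le_eq del: of_nat_Suc)
  ultimately obtain S where
    S: "(\<lambda>n. (\<Sum>d | d dvd Suc n. 1 / of_nat d) * z ^ Suc n) sums S"
       "(\<lambda>e. \<Sum>d. 1 / of_nat (Suc d) * (z ^ Suc e) ^ Suc d) sums S"
    using lambert_sums[of z "\<lambda>d. 1 / of_nat d" 0] by blast
  have "(\<Sum>d. 1 / of_nat (Suc d) * (z ^ Suc e) ^ Suc d) = of_real (- ln (1 - exp (- (real (Suc e) * x))))" for e
  proof -
    define y where "y = exp (- (real (Suc e) * x))"
    have y: "0 < y" "y < 1" using assms by (auto simp: y_def simp del: of_nat_Suc)
    have zy: "z ^ Suc e = of_real y"
      unfolding z_def y_def of_real_power[symmetric] exp_of_nat_mult[symmetric] by (simp only: mult_minus_right)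
    have "(\<lambda>n. - ((- (- y)) ^ n) / of_nat n) sums ln (1 + - y)"
      by (rule ln_series') (use y in auto)
    then have "(\<lambda>n. - (y ^ n / of_nat n)) sums ln (1 - y)" by simp
    then have "(\<lambda>n. y ^ n / of_nat n) sums - ln (1 - y)" using sums_minus by fastforce
    then have "(\<lambda>n. y ^ Suc n / of_nat (Suc n)) sums - ln (1 - y)" by (subst sums_Suc_iff) simp
    then have "(\<lambda>n. complex_of_real (y ^ Suc n / of_nat (Suc n))) sums of_real (- ln (1 - y))"
      by (rule sums_of_real)
    then show ?thesis unfolding zy y_def[symmetric] by (simp add: sums_iff)
  qed
  then have "(\<lambda>e. complex_of_real (- ln (1 - exp (- (real (Suc e) * x))))) sums S" using S(2) by simp
  then have "(\<lambda>e. - ln (1 - exp (- (real (Suc e) * x)))) sums Re S"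
    using sums_Re by fastforce
  moreover have "S = Lam (of_real x)"
  proof -
    have eq: "(\<Sum>d | d dvd Suc n. 1 / of_nat d) = (of_nat (divsum 1 (Suc n)) / of_nat (Suc n) :: complex)" for n
    proof -
      have "(\<Sum>d | d dvd Suc n. 1 / of_nat d :: complex) = (\<Sum>d | d dvd Suc n. 1 / of_nat (Suc n div d))"
        by (subst sum_divisors_flip) auto
      also have "\<dots> = (\<Sum>d | d dvd Suc n. of_nat d / of_nat (Suc n))"
      proof (intro sum.cong refl)
        fix d assume "d \<in> {d. d dvd Suc n}"
        then obtain k where k: "Suc n = d * k" by (auto simp: dvd_def)
        then have "d > 0" "k > 0" by (auto intro!: Nat.gr0I)
        then show "1 / of_nat (Suc n div d) = (of_nat d / of_nat (Suc n) :: complex)"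
          unfolding k by simp
      qed
      finally show ?thesis by (simp add: divsum_def sum_divide_distrib)
    qed
    have "(\<lambda>n. of_nat (divsum 1 (Suc n)) / of_nat (Suc n) * z ^ Suc n) sums S"
      using S(1) unfolding eq .
    then have "(\<lambda>n. of_nat (divsum 1 n) / of_nat n * z ^ n) sums S" by (subst (asm) sums_Suc_iff) simp
    moreover have "z = exp (- complex_of_real x)" by (metis exp_of_real of_real_minus z_def)
    ultimately show ?thesis by (simp add: Lam_def sums_iff)
  qed
  ultimately show ?thesis by simp
qed

text \<open>Comparison with the integral of 1/(1 + t^2): the increments of arctan telescope, and
  arctan stays below 2.\<close>

lemma sum_inverse_quadratic:
  fixes x :: real
  assumes "x > 0"
  shows "summable (\<lambda>e. 1 / (1 + (real e * x)\<^sup>2))" "(\<Sum>e. 1 / (1 + (real e * x)\<^sup>2)) \<le> 1 + 2 / x"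
proof -
  have step: "1 / (1 + (real (Suc e) * x)\<^sup>2) \<le> (arctan (real (Suc e) * x) - arctan (real e * x)) / x" for e
  proof -
    have lt: "real e * x < real (Suc e) * x" using assms by simp
    have "\<exists>z. real e * x < z \<and> z < real (Suc e) * x \<and>
      arctan (real (Suc e) * x) - arctan (real e * x) = (real (Suc e) * x - real e * x) * inverse (1 + z\<^sup>2)"
      by (rule MVT2[OF lt]) (rule DERIV_arctan)
    then obtain z where z: "real e * x < z" "z < real (Suc e) * x"
      "arctan (real (Suc e) * x) - arctan (real e * x) = (real (Suc e) * x - real e * x) * inverse (1 + z\<^sup>2)"
      by blast
    have "0 \<le> real e * x" using assms by simp
    with z have "z\<^sup>2 \<le> (real (Suc e) * x)\<^sup>2" by (intro power_mono) linarith+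
    then have "1 / (1 + (real (Suc e) * x)\<^sup>2) \<le> 1 / (1 + z\<^sup>2)"
      by (intro divide_left_mono) (auto simp: add_pos_nonneg)
    also have "\<dots> = (arctan (real (Suc e) * x) - arctan (real e * x)) / x"
      unfolding z(3) using assms by (simp add: inverse_eq_divide left_diff_distrib[symmetric])
    finally show ?thesis .
  qed
  have partial: "(\<Sum>e<n. 1 / (1 + (real e * x)\<^sup>2)) \<le> 1 + 2 / x" for n
  proof (cases n)
    case (Suc m)
    have "(\<Sum>e<n. 1 / (1 + (real e * x)\<^sup>2)) = 1 + (\<Sum>e<m. 1 / (1 + (real (Suc e) * x)\<^sup>2))"
      unfolding Suc by (subst sum.lessThan_Suc_shift) simp
    also have "\<dots> \<le> 1 + (\<Sum>e<m. (arctan (real (Suc e) * x) - arctan (real e * x)) / x)"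
      by (intro add_left_mono sum_mono step)
    also have "(\<Sum>e<m. (arctan (real (Suc e) * x) - arctan (real e * x)) / x) = arctan (real m * x) / x"
      by (simp only: sum_divide_distrib[symmetric] sum_lessThan_telescope[of "\<lambda>e. arctan (real e * x)"]) simp
    also have "arctan (real m * x) \<le> 2" using arctan_ubound[of "real m * x"] pi_less_4 by linarith
    finally show ?thesis using assms by (simp add: divide_right_mono)
  qed (use assms in simp)
  show s: "summable (\<lambda>e. 1 / (1 + (real e * x)\<^sup>2))"
    by (rule summableI_nonneg_bounded[OF _ partial]) simp
  show "(\<Sum>e. 1 / (1 + (real e * x)\<^sup>2)) \<le> 1 + 2 / x"
    by (rule suminf_le_const[OF s partial])
qed

lemma summable_bder:
  assumes "s \<in> sector" "s \<noteq> 0" "\<And>w. w \<in> sector \<Longrightarrow> norm (bder r w) \<le> C / (1 + norm w ^ 2)"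
  shows "summable (\<lambda>e. norm (bder r (of_nat e * s)))"
    and "(\<Sum>e. norm (bder r (of_nat e * s))) \<le> C * (1 + 2 / norm s)"
proof -
  have x: "norm s > 0" using assms by simp
  have "C \<ge> 0"
    using order_trans[OF norm_ge_zero assms(3)[of 0]] by (simp add: sector_def)
  have le: "norm (bder r (of_nat e * s)) \<le> C * (1 / (1 + (real e * norm s)\<^sup>2))" for e
    using assms(3)[OF sector_scale[OF assms(1), of "real e"]] by (simp add: norm_mult)
  have sm: "summable (\<lambda>e. C * (1 / (1 + (real e * norm s)\<^sup>2)))"
    by (rule summable_mult) (rule sum_inverse_quadratic[OF x])
  then show s: "summable (\<lambda>e. norm (bder r (of_nat e * s)))"
    by (rule summable_comparison_test'[where N = 0]) (use le in auto)
  have "(\<Sum>e. norm (bder r (of_nat e * s))) \<le> (\<Sum>e. C * (1 / (1 + (real e * norm s)\<^sup>2)))"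
    by (rule suminf_le[OF le s sm])
  also have "\<dots> = C * (\<Sum>e. 1 / (1 + (real e * norm s)\<^sup>2))"
    by (rule suminf_mult) (rule sum_inverse_quadratic[OF x])
  also have "\<dots> \<le> C * (1 + 2 / norm s)"
    using \<open>C \<ge> 0\<close> by (intro mult_left_mono sum_inverse_quadratic[OF x])
  finally show "(\<Sum>e. norm (bder r (of_nat e * s))) \<le> C * (1 + 2 / norm s)" .
qed

section \<open>Polar parts of the Lambert series\<close>

definition zeta :: "nat \<Rightarrow> real" where
  "zeta m = (\<Sum>e. 1 / real (Suc e) ^ m)"

lemma summable_zeta: "m \<ge> 2 \<Longrightarrow> summable (\<lambda>e. 1 / real (Suc e) ^ m)"
  using inverse_power_summable[of m, where 'a = real]
  by (subst summable_Suc_iff) (simp add: inverse_eq_divide)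

text \<open>\<open>Phi r s\<close> is the sum of \<open>lser r\<close> over the positive multiples
  of s. The poles r!/((e + 1) s)^(r+1) add up to a zeta value, and the regular parts are
  left.\<close>

lemma Phi_eq:
  assumes "s \<in> sector" "s \<noteq> 0" "r \<ge> 1"
  shows "Phi r s = fact r * of_real (zeta (r + 1)) / s ^ (r + 1) + (\<Sum>e. bder r (of_nat (Suc e) * s))"
    and "summable (\<lambda>e. norm (bder r (of_nat (Suc e) * s)))"
proof -
  have Re: "Re s > 0" using sector_Re_pos assms by blast
  obtain C where C: "\<And>w. w \<in> sector \<Longrightarrow> norm (bder r w) \<le> C / (1 + norm w ^ 2)"
    using norm_bder_le[OF assms(3)] by blast
  show sm: "summable (\<lambda>e. norm (bder r (of_nat (Suc e) * s)))"
    by (subst summable_Suc_iff[of "\<lambda>e. norm (bder r (of_nat e * s))"])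
       (rule summable_bder(1)[OF assms(1,2) C])
  have "(\<lambda>e. complex_of_real (1 / real (Suc e) ^ (r + 1))) sums of_real (zeta (r + 1))"
    unfolding zeta_def by (intro sums_of_real summable_sums summable_zeta) (use assms in auto)
  then have "(\<lambda>e. fact r / s ^ (r + 1) * complex_of_real (1 / real (Suc e) ^ (r + 1)))
      sums (fact r / s ^ (r + 1) * of_real (zeta (r + 1)))"
    by (rule sums_mult)
  from sums_add[OF this summable_sums[OF summable_norm_cancel[OF sm]]]
  have "(\<lambda>e. lser r (of_nat (Suc e) * s)) sums
      (fact r / s ^ (r + 1) * of_real (zeta (r + 1)) + (\<Sum>e. bder r (of_nat (Suc e) * s)))"
  proof (rule sums_cong[THEN iffD1, rotated])
    fix e
    have "Re (of_nat (Suc e) * s) > 0" using Re by (simp del: of_nat_Suc)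
    from lser_eq[OF this, of r] assms(3)
    show "fact r / s ^ (r + 1) * complex_of_real (1 / real (Suc e) ^ (r + 1)) + bder r (of_nat (Suc e) * s)
        = lser r (of_nat (Suc e) * s)"
      by (simp add: power_mult_distrib field_simps del: of_nat_Suc)
  qed
  from sums_unique2[OF Phi_sums_lser[OF Re assms(3)] this]
  show "Phi r s = fact r * of_real (zeta (r + 1)) / s ^ (r + 1) + (\<Sum>e. bder r (of_nat (Suc e) * s))"
    by simp
qed

text \<open>After multiplication by s^(r+1) this error is O(|s|^r), good enough in the expansion for
  r >= 3. For r = 1 it would swallow the term -1/(2s), whence the sharper
  \<open>Phi_1_asymp\<close>.\<close>

lemma Phi_asymp_weak:
  assumes "r \<ge> 1"
  obtains K where "K > 0" "\<And>s. s \<in> sector \<Longrightarrow> s \<noteq> 0 \<Longrightarrow> norm s \<le> 1 \<Longrightarrow>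
    norm (Phi r s - fact r * of_real (zeta (r + 1)) / s ^ (r + 1)) \<le> K / norm s"
proof -
  obtain C where C: "C > 0" "\<And>w. w \<in> sector \<Longrightarrow> norm (bder r w) \<le> C / (1 + norm w ^ 2)"
    using norm_bder_le[OF assms] by blast
  have "norm (Phi r s - fact r * of_real (zeta (r + 1)) / s ^ (r + 1)) \<le> 3 * C / norm s"
    if s: "s \<in> sector" "s \<noteq> 0" "norm s \<le> 1" for s
  proof -
    have x: "norm s > 0" using s by simp
    have "norm (\<Sum>e. bder r (of_nat (Suc e) * s)) \<le> (\<Sum>e. norm (bder r (of_nat (Suc e) * s)))"
      by (rule summable_norm[OF Phi_eq(2)[OF s(1,2) assms]])
    also have "\<dots> \<le> (\<Sum>e. norm (bder r (of_nat e * s)))"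
      using suminf_split_head[OF summable_bder(1)[OF s(1,2) C(2)]] by simp
    also have "\<dots> \<le> C * (1 + 2 / norm s)" by (rule summable_bder(2)[OF s(1,2) C(2)])
    also have "\<dots> \<le> C * (3 / norm s)"
      using s x C(1) by (intro mult_left_mono) (auto simp: field_simps)
    finally show ?thesis unfolding Phi_eq(1)[OF s(1,2) assms] by (simp add: mult.commute)
  qed
  then show ?thesis using that[of "3 * C"] C(1) by simp
qed

section \<open>The logarithm of the partition generating function near 1\<close>

text \<open>Because \<open>bder 0\<close> has derivative \<open>- bder 1\<close>, the difference of
  its values is the integral of \<open>bder 1\<close> over one step. The trapezoidal error involves
  two more derivatives, hence \<open>bder 3\<close>, whose decay makes the errors summable over
  e.\<close>

lemma trapezoid_bder:
  assumes s: "s \<in> sector" and C: "\<And>w. w \<in> sector \<Longrightarrow> norm (bder 3 w) \<le> C / (1 + norm w ^ 2)" "C \<ge> 0"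
  defines "z \<equiv> \<lambda>e. of_nat e * s"
  shows "norm (s / 2 * (bder 1 (z e) + bder 1 (z (Suc e))) - (bder 0 (z e) - bder 0 (z (Suc e))))
         \<le> C * norm s ^ 3 * (1 / (1 + (real e * norm s)\<^sup>2))"
proof -
  define B where "B = C * (1 / (1 + (real e * norm s)\<^sup>2))"
  define S where "S = closed_segment (z e) (z (Suc e))"
  have seg: "\<exists>t\<ge>real e. w = of_real t * s" if "w \<in> S" for w
  proof -
    from that obtain u where u: "0 \<le> u" "w = (1 - u) *\<^sub>R z e + u *\<^sub>R z (Suc e)"
      unfolding S_def closed_segment_def by auto
    then have "w = of_real (real e + u) * s" by (simp add: z_def scaleR_conv_of_real algebra_simps)
    then show ?thesis using u by (intro exI[of _ "real e + u"]) simp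
  qed
  have S_sector: "S \<subseteq> sector"
    using seg sector_scale[OF s] by (metis of_nat_0_le_iff order_trans subsetI)
  have B: "norm (bder 3 w) \<le> B" if w: "w \<in> S" for w
  proof -
    from seg[OF w] obtain t where t: "t \<ge> real e" "w = of_real t * s" by blast
    have "(real e * norm s)\<^sup>2 \<le> norm w ^ 2"
      using t by (intro power_mono) (auto simp: norm_mult intro!: mult_right_mono)
    then have "C / (1 + norm w ^ 2) \<le> C / (1 + (real e * norm s)\<^sup>2)"
      using C(2) by (intro divide_left_mono) (auto simp: add_pos_nonneg)
    then show ?thesis using C(1)[of w] w S_sector by (auto simp: B_def)
  qed
  have der: "((\<lambda>w. (-1) ^ i * bder (j + i) w) has_field_derivative (-1) ^ Suc i * bder (j + Suc i) w) (at w within S)"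
    if "w \<in> S" for i j w
    using S_sector sector_subset_bdom that
    by (auto intro!: derivative_eq_intros has_field_derivative_at_within[OF has_field_derivative_bder])
  have ends: "z e \<in> S" "z (Suc e) \<in> S" by (auto simp: S_def)
  have diff: "z (Suc e) - z e = s" by (simp add: z_def algebra_simps)
  \<comment> \<open>Taylor expansions to second order for \<open>bder 0\<close> and to first order
    for \<open>bder 1\<close>: in the trapezoidal combination the terms with \<open>bder 2\<close>
    cancel.\<close>
  have "norm ((\<lambda>i w. (-1) ^ i * bder (0 + i) w) 0 (z (Suc e))
        - (\<Sum>i\<le>2. (\<lambda>i w. (-1) ^ i * bder (0 + i) w) i (z e) * (z (Suc e) - z e) ^ i / fact i))
        \<le> B * norm (z (Suc e) - z e) ^ Suc 2 / fact 2"
    by (rule complex_Taylor[where S = S])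
       (use der[of _ _ 0] ends B in \<open>auto simp: S_def norm_mult norm_power numeral_3_eq_3 numeral_2_eq_2\<close>)
  then have 1: "norm (bder 0 (z (Suc e)) - bder 0 (z e) + bder 1 (z e) * s - bder 2 (z e) * s\<^sup>2 / 2)
      \<le> B * norm s ^ 3 / 2"
    unfolding diff by (simp add: numeral_2_eq_2 numeral_3_eq_3 algebra_simps)
  have "norm ((\<lambda>i w. (-1) ^ i * bder (1 + i) w) 0 (z (Suc e))
        - (\<Sum>i\<le>1. (\<lambda>i w. (-1) ^ i * bder (1 + i) w) i (z e) * (z (Suc e) - z e) ^ i / fact i))
        \<le> B * norm (z (Suc e) - z e) ^ Suc 1 / fact 1"
    by (rule complex_Taylor[where S = S])
       (use der[of _ _ 1] ends B in \<open>auto simp: S_def norm_mult norm_power numeral_3_eq_3\<close>)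
  then have 2: "norm (bder 1 (z (Suc e)) - bder 1 (z e) + bder 2 (z e) * s) \<le> B * norm s ^ 2"
    unfolding diff by (simp add: numeral_2_eq_2 algebra_simps)
  have "s / 2 * (bder 1 (z e) + bder 1 (z (Suc e))) - (bder 0 (z e) - bder 0 (z (Suc e)))
      = (bder 0 (z (Suc e)) - bder 0 (z e) + bder 1 (z e) * s - bder 2 (z e) * s\<^sup>2 / 2)
        + s / 2 * (bder 1 (z (Suc e)) - bder 1 (z e) + bder 2 (z e) * s)"
    by (simp add: power2_eq_square algebra_simps)
  also have "norm \<dots> \<le> B * norm s ^ 3 / 2 + norm (s / 2) * (B * norm s ^ 2)"
    by (intro norm_triangle_le add_mono 1) (simp only: norm_mult, intro mult_left_mono 2, simp)
  also have "\<dots> = B * norm s ^ 3" by (simp add: norm_divide power3_eq_cube power2_eq_square)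
  finally show ?thesis by (simp add: B_def mult_ac)
qed

text \<open>The limit of the telescoping sum. It needs a separate argument since
  \<open>bder 0\<close> decays only like 1/|w|.\<close>

lemma bder_0_tendsto:
  assumes "s \<in> sector" "s \<noteq> 0"
  shows "(\<lambda>e. bder 0 (of_nat e * s)) \<longlonglongrightarrow> 0"
proof (rule Lim_null_comparison)
  have Re: "Re s > 0" using sector_Re_pos assms by blast
  show "\<forall>\<^sub>F e in sequentially. norm (bder 0 (of_nat e * s)) \<le> (1 / Re s + 1 / norm s) * (1 / real e)"
    using eventually_gt_at_top[of 0]
  proof eventually_elim
    case (elim e)
    define w where "w = of_nat e * s"
    have w: "Re w > 0" "w \<noteq> 0" using elim Re assms by (auto simp: w_def)
    have "Re w \<le> exp (Re w) - 1" using exp_ge_add_one_self[of "Re w"] by linarith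
    also have "\<dots> \<le> norm (exp w - 1)" using norm_triangle_ineq2[of "exp w" 1] by simp
    finally have "norm (1 / (exp w - 1)) \<le> 1 / Re w"
      using w exp_neq_1_right by (auto simp: norm_divide intro!: divide_left_mono)
    then have "norm (1 / (exp w - 1) - 1 / w) \<le> 1 / Re w + norm (1 / w)"
      by (intro norm_triangle_le_diff add_mono) auto
    also have "\<dots> = (1 / Re s + 1 / norm s) * (1 / real e)"
      using elim Re by (simp add: w_def norm_divide norm_mult field_simps)
    finally show ?case using w(2) by (simp add: bder_def bfun_def w_def)
  qed
  show "(\<lambda>e. (1 / Re s + 1 / norm s) * (1 / real e)) \<longlonglongrightarrow> 0"
    using tendsto_mult[OF tendsto_const lim_1_over_n] by simp
qed

lemma zeta_2: "zeta 2 = pi\<^sup>2 / 6"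
  using inverse_squares_sums by (simp add: zeta_def sums_iff)

text \<open>Summed over the points e s, the trapezoidal rule telescopes to \<open>bder 0 0\<close>,
  that is -1/2. For the sum S of the regular parts this says s S - s/24 = -1/2 + O(|s|^2); division
  by s gives both correction terms.\<close>

lemma Phi_1_asymp:
  obtains K where "K > 0" "\<And>s. s \<in> sector \<Longrightarrow> s \<noteq> 0 \<Longrightarrow> norm s \<le> 1 \<Longrightarrow>
    norm (Phi 1 s - (of_real (pi\<^sup>2 / 6) / s\<^sup>2 - 1 / (2 * s) + 1 / 24)) \<le> K * norm s"
proof -
  obtain C where C: "C > 0" "\<And>w. w \<in> sector \<Longrightarrow> norm (bder 3 w) \<le> C / (1 + norm w ^ 2)"
    using norm_bder_le[of 3] by auto
  have "norm (Phi 1 s - (of_real (pi\<^sup>2 / 6) / s\<^sup>2 - 1 / (2 * s) + 1 / 24)) \<le> 3 * C * norm s"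
    if s: "s \<in> sector" "s \<noteq> 0" "norm s \<le> 1" for s
  proof -
    have x: "norm s > 0" using s by simp
    define b1 where "b1 = (\<lambda>e. bder 1 (of_nat e * s))"
    define b0 where "b0 = (\<lambda>e. bder 0 (of_nat e * s))"
    define S where "S = (\<Sum>e. b1 (Suc e))"
    define T where "T = (\<lambda>e. s / 2 * (b1 e + b1 (Suc e)) - (b0 e - b0 (Suc e)))"
    have "(\<lambda>e. b1 (Suc e)) sums S"
      unfolding S_def b1_def 
      by (rule summable_sums[OF summable_norm_cancel[OF Phi_eq(2)[OF s(1,2)]]]) simp
    moreover from this have "b1 sums (S + b1 0)" by (subst (asm) sums_Suc_iff) simp
    moreover have "(\<lambda>e. b0 e - b0 (Suc e)) sums (b0 0 - 0)"
      unfolding b0_def by (rule telescope_sums'[OF bder_0_tendsto[OF s(1,2)]])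
    ultimately have "T sums (s / 2 * (S + b1 0 + S) - (b0 0 - 0))"
      unfolding T_def by (intro sums_diff[OF sums_mult[OF sums_add]])
    \<comment> \<open>The point e = 0 carries only half the weight of the others, and
      \<open>bder 1 0 = - 1 / 12\<close> turns into s/24.\<close>
    also have "s / 2 * (S + b1 0 + S) - (b0 0 - 0) = s * S - s / 24 + 1 / 2"
      by (simp add: b1_def b0_def bder_at_0[unfolded One_nat_def] algebra_simps)
    finally have T: "T sums (s * S - s / 24 + 1 / 2)" .
    have sm: "summable (\<lambda>e. C * norm s ^ 3 * (1 / (1 + (real e * norm s)\<^sup>2)))"
      by (rule summable_mult) (rule sum_inverse_quadratic[OF x])
    have Tle: "norm (T e) \<le> C * norm s ^ 3 * (1 / (1 + (real e * norm s)\<^sup>2))" for e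
      unfolding T_def b1_def b0_def by (rule trapezoid_bder[OF s(1) C(2)]) (use C(1) in auto)
    have sT: "summable (\<lambda>e. norm (T e))"
      by (rule summable_comparison_test'[OF sm, where N = 0]) (use Tle in auto)
    have "norm (s * S - s / 24 + 1 / 2) \<le> (\<Sum>e. norm (T e))"
      using summable_norm[OF sT] T by (simp add: sums_iff)
    also have "\<dots> \<le> (\<Sum>e. C * norm s ^ 3 * (1 / (1 + (real e * norm s)\<^sup>2)))"
      by (rule suminf_le[OF Tle sT sm])
    also have "\<dots> = C * norm s ^ 3 * (\<Sum>e. 1 / (1 + (real e * norm s)\<^sup>2))"
      by (rule suminf_mult) (rule sum_inverse_quadratic[OF x])
    also have "\<dots> \<le> C * norm s ^ 3 * (1 + 2 / norm s)"
      using C(1) by (intro mult_left_mono sum_inverse_quadratic[OF x]) auto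
    also have "\<dots> \<le> C * norm s ^ 3 * (3 / norm s)"
      using s x C(1) by (intro mult_left_mono) (auto simp: field_simps)
    also have "\<dots> = 3 * C * norm s * norm s" using x by (simp add: power3_eq_cube)
    finally have le: "norm (s * S - s / 24 + 1 / 2) \<le> 3 * C * norm s * norm s" .
    have "Phi 1 s = of_real (pi\<^sup>2 / 6) / s\<^sup>2 + S"
      using Phi_eq(1)[OF s(1,2), of 1] by (simp add: S_def b1_def numeral_2_eq_2[symmetric] zeta_2)
    then have "Phi 1 s - (of_real (pi\<^sup>2 / 6) / s\<^sup>2 - 1 / (2 * s) + 1 / 24)
        = 1 / (2 * s) - 1 / 24 + S" by simp
    also have "\<dots> = (s * S - s / 24 + 1 / 2) / s"
      using s by (simp add: field_simps)
    finally have "Phi 1 s - (of_real (pi\<^sup>2 / 6) / s\<^sup>2 - 1 / (2 * s) + 1 / 24)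
        = (s * S - s / 24 + 1 / 2) / s" .
    then show ?thesis using le x by (simp add: norm_divide divide_le_eq)
  qed
  then show ?thesis using that[of "3 * C"] C(1) by simp
qed

section \<open>The remainder in the expansion of the logarithm\<close>

definition LamD :: "complex \<Rightarrow> complex" where
  "LamD s = Lam s - of_real (pi\<^sup>2 / 6) / s - Ln s / 2 + s / 24"

text \<open>The derivative of \<open>LamD\<close> is minus the remainder of
  \<open>Phi_1_asymp\<close>, hence O(|w|), and the part of the sector with Re w > 0 and |w| <= m is
  convex, of diameter at most 2 m.\<close>

lemma LamD_lipschitz:
  obtains K where "K > 0" "\<And>s t m. s \<in> sector \<Longrightarrow> t \<in> sector \<Longrightarrow> s \<noteq> 0 \<Longrightarrow> t \<noteq> 0 \<Longrightarrow>
    norm s \<le> m \<Longrightarrow> norm t \<le> m \<Longrightarrow> m \<le> 1 \<Longrightarrow> norm (LamD s - LamD t) \<le> K * m\<^sup>2"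
proof -
  obtain K where K: "K > 0" "\<And>s. s \<in> sector \<Longrightarrow> s \<noteq> 0 \<Longrightarrow> norm s \<le> 1 \<Longrightarrow>
    norm (Phi 1 s - (of_real (pi\<^sup>2 / 6) / s\<^sup>2 - 1 / (2 * s) + 1 / 24)) \<le> K * norm s"
    using Phi_1_asymp by blast
  have "norm (LamD s - LamD t) \<le> 2 * K * m\<^sup>2"
    if st: "s \<in> sector" "t \<in> sector" "s \<noteq> 0" "t \<noteq> 0" "norm s \<le> m" "norm t \<le> m" "m \<le> 1" for s t m
  proof -
    define S where "S = sector \<inter> cball 0 m \<inter> {w. Re w > 0}"
    have "convex S" unfolding S_def by (intro convex_Int convex_sector convex_cball convex_halfspace_Re_gt)
    moreover have "(LamD has_field_derivative
        - (Phi 1 w - (of_real (pi\<^sup>2 / 6) / w\<^sup>2 - 1 / (2 * w) + 1 / 24))) (at w within S)" if "w \<in> S" for w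
    proof -
      have w: "Re w > 0" "w \<noteq> 0" using that by (auto simp: S_def)
      then have "w \<notin> \<real>\<^sub>\<le>\<^sub>0" by (auto simp: complex_nonpos_Reals_iff)
      define c where "c = complex_of_real (pi\<^sup>2 / 6)"
      have "((\<lambda>s. c / s) has_field_derivative - (c / w\<^sup>2)) (at w)"
        using w by (auto intro!: derivative_eq_intros simp: power2_eq_square)
      note D1 = DERIV_diff[OF has_field_derivative_Lam[OF w(1)] this]
      note D2 = DERIV_diff[OF D1 DERIV_cdivide[OF has_field_derivative_Ln[OF \<open>w \<notin> \<real>\<^sub>\<le>\<^sub>0\<close>], of 2]]
      note D3 = DERIV_add[OF D2 DERIV_cdivide[OF DERIV_ident, of 24]]
      have E: "LamD = (\<lambda>s. Lam s - c / s - Ln s / 2 + s / 24)"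
        by (rule ext) (simp only: LamD_def c_def)
      have "(LamD has_field_derivative - Phi 1 w - - (c / w\<^sup>2) - inverse w / 2 + 1 / 24) (at w)"
        by (subst E) (rule D3)
      then show ?thesis
        unfolding c_def[symmetric]
        by (rule has_field_derivative_at_within[THEN DERIV_cong]) (simp add: inverse_eq_divide)
    qed
    moreover have "norm (- (Phi 1 w - (of_real (pi\<^sup>2 / 6) / w\<^sup>2 - 1 / (2 * w) + 1 / 24))) \<le> K * m"
      if "w \<in> S" for w
    proof -
      have "norm w \<le> m" "w \<in> sector" "w \<noteq> 0" using that by (auto simp: S_def)
      moreover have "K * norm w \<le> K * m" using K(1) calculation by (intro mult_left_mono) auto
      ultimately show ?thesis using K(2)[of w] st(7) unfolding norm_minus_cancel by linarith
    qed
    moreover have "s \<in> S" "t \<in> S" using st sector_Re_pos by (auto simp: S_def)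
    ultimately have "norm (LamD s - LamD t) \<le> K * m * norm (s - t)"
      by (intro field_differentiable_bound[where S = S])
    also have "\<dots> \<le> K * m * (2 * m)"
      using st K(1) norm_triangle_ineq4[of s t] order_trans[OF norm_ge_zero st(5)]
      by (intro mult_left_mono mult_nonneg_nonneg) auto
    finally show ?thesis by (simp add: power2_eq_square)
  qed
  then show ?thesis using that[of "2 * K"] K(1) by simp
qed

text \<open>The values along 1/(n + 1) form a Cauchy sequence, and the same estimate compares any
  point of the sector with its limit. The derivative cannot reveal what the limit is; that is left
  to \<open>LamD_asymp'\<close>.\<close>

lemma LamD_asymp:
  obtains c K where "K > 0" "\<And>s. s \<in> sector \<Longrightarrow> s \<noteq> 0 \<Longrightarrow> norm s \<le> 1 \<Longrightarrow> norm (LamD s - c) \<le> K * norm s ^ 2"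
proof -
  obtain K where K: "K > 0" "\<And>s t m. s \<in> sector \<Longrightarrow> t \<in> sector \<Longrightarrow> s \<noteq> 0 \<Longrightarrow> t \<noteq> 0 \<Longrightarrow>
    norm s \<le> m \<Longrightarrow> norm t \<le> m \<Longrightarrow> m \<le> 1 \<Longrightarrow> norm (LamD s - LamD t) \<le> K * m\<^sup>2"
    using LamD_lipschitz by blast
  define u where "u = (\<lambda>n. complex_of_real (1 / real (Suc n)))"
  have u: "u n \<in> sector" "u n \<noteq> 0" "norm (u n) = 1 / real (Suc n)" "norm (u n) \<le> 1" for n
    by (auto simp: u_def sector_def norm_divide simp del: of_nat_Suc)
  have u0: "(\<lambda>n. norm (u n)) \<longlonglongrightarrow> 0"
    unfolding u(3) using LIMSEQ_inverse_real_of_nat by (simp add: inverse_eq_divide)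
  have "Cauchy (\<lambda>n. LamD (u n))"
  proof (rule metric_CauchyI)
    fix \<epsilon> :: real assume "\<epsilon> > 0"
    have "(\<lambda>n. K * norm (u n) ^ 2) \<longlonglongrightarrow> K * 0 ^ 2" by (intro tendsto_intros u0)
    then have "\<forall>\<^sub>F n in sequentially. K * norm (u n) ^ 2 < \<epsilon>"
      using \<open>\<epsilon> > 0\<close> by (intro order_tendstoD(2)[of _ "K * 0 ^ 2"]) auto
    then obtain N where N: "K * norm (u N) ^ 2 < \<epsilon>" by (auto simp: eventually_sequentially)
    show "\<exists>M. \<forall>m\<ge>M. \<forall>n\<ge>M. dist (LamD (u m)) (LamD (u n)) < \<epsilon>"
    proof (intro exI allI impI)
      fix m n assume "m \<ge> N" "n \<ge> N"
      then have "norm (u m) \<le> norm (u N)" "norm (u n) \<le> norm (u N)"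
        unfolding u(3) by (auto intro!: divide_left_mono)
      with K(2)[of "u m" "u n" "norm (u N)"] u N show "dist (LamD (u m)) (LamD (u n)) < \<epsilon>"
        by (simp add: dist_norm)
    qed
  qed
  then obtain c where c: "(\<lambda>n. LamD (u n)) \<longlonglongrightarrow> c" using Cauchy_convergent_iff convergent_def by blast
  have "norm (LamD s - c) \<le> K * norm s ^ 2" if s: "s \<in> sector" "s \<noteq> 0" "norm s \<le> 1" for s
  proof (rule tendsto_upperbound)
    show "(\<lambda>n. norm (LamD s - LamD (u n))) \<longlonglongrightarrow> norm (LamD s - c)" by (intro tendsto_intros c)
    have "\<forall>\<^sub>F n in sequentially. norm (u n) < norm s"
      using order_tendstoD(2)[OF u0] s by simp
    then show "\<forall>\<^sub>F n in sequentially. norm (LamD s - LamD (u n)) \<le> K * norm s ^ 2"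
      by eventually_elim (use K(2) u s in auto)
  qed simp
  then show ?thesis using that K(1) by blast
qed

section \<open>The constant term, by comparison with the product for sinh\<close>

lemma Lam_of_real:
  assumes "x > 0"
  shows "Lam (of_real x) = of_real (\<Sum>n. real (divsum 1 n) / real n * exp (- x) ^ n)"
proof -
  have "exp (- complex_of_real x) = of_real (exp (- x))" by (metis exp_of_real of_real_minus)
  then show ?thesis
    using suminf_of_real[OF summable_divsum_over[of "exp (- x)"], where 'a = complex] assms
    by (simp add: Lam_def)
qed

text \<open>The sine product at the imaginary point i t, followed by the logarithm.\<close>

lemma ln_sinh_sums:
  assumes "t > 0"
  shows "(\<lambda>n. ln (1 + t\<^sup>2 / (real (Suc n))\<^sup>2)) sums ln (sinh (pi * t) / (pi * t))"
proof -
  have "(\<lambda>n. of_real pi * (\<i> * of_real t) * (\<Prod>k=1..n. 1 - (\<i> * of_real t)\<^sup>2 / of_nat k ^ 2))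
      \<longlonglongrightarrow> sin (of_real pi * (\<i> * of_real t))"
    by (rule sin_product_formula_complex)
  then have "(\<lambda>n. - \<i> * (of_real pi * (\<i> * of_real t) * (\<Prod>k=1..n. 1 - (\<i> * of_real t)\<^sup>2 / of_nat k ^ 2)))
      \<longlonglongrightarrow> - \<i> * sin (of_real pi * (\<i> * of_real t))"
    by (intro tendsto_mult tendsto_const)
  moreover have "- \<i> * (of_real pi * (\<i> * of_real t) * (\<Prod>k=1..n. 1 - (\<i> * of_real t)\<^sup>2 / of_nat k ^ 2))
      = of_real (pi * t * (\<Prod>k=1..n. 1 + t\<^sup>2 / (real k)\<^sup>2))" for n
  proof -
    have "- \<i> * (of_real pi * (\<i> * of_real t) * P) = of_real (pi * t) * P" for P
      by (simp add: algebra_simps)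
    then show ?thesis by (simp only:) (simp add: power_mult_distrib)
  qed
  moreover have "- \<i> * sin (of_real pi * (\<i> * of_real t)) = of_real (sinh (pi * t))"
  proof -
    have A: "sin (\<i> * of_real (pi * t)) = \<i> * sinh (of_real (pi * t))" by (simp add: sinh_conv_sin)
    have B: "sinh (complex_of_real y) = of_real (sinh y)" for y
      unfolding sinh_field_def of_real_minus[symmetric] exp_of_real by simp
    have "of_real pi * (\<i> * of_real t) = \<i> * complex_of_real (pi * t)" by simp
    then show ?thesis by (simp only: A B) simp
  qed
  ultimately have "(\<lambda>n. complex_of_real (pi * t * (\<Prod>k=1..n. 1 + t\<^sup>2 / (real k)\<^sup>2))) \<longlonglongrightarrow> of_real (sinh (pi * t))"
    by simp
  then have "(\<lambda>n. pi * t * (\<Prod>k=1..n. 1 + t\<^sup>2 / (real k)\<^sup>2)) \<longlonglongrightarrow> sinh (pi * t)"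
    by (simp only: tendsto_of_real_iff)
  then have "(\<lambda>n. pi * t * (\<Prod>k=1..n. 1 + t\<^sup>2 / (real k)\<^sup>2) / (pi * t)) \<longlonglongrightarrow> sinh (pi * t) / (pi * t)"
    by (rule tendsto_divide) (use assms in auto)
  then have "(\<lambda>n. \<Prod>k=1..n. 1 + t\<^sup>2 / (real k)\<^sup>2) \<longlonglongrightarrow> sinh (pi * t) / (pi * t)"
    using assms by simp
  then have "(\<lambda>n. ln (\<Prod>k=1..n. 1 + t\<^sup>2 / (real k)\<^sup>2)) \<longlonglongrightarrow> ln (sinh (pi * t) / (pi * t))"
    by (rule tendsto_ln) (use assms in auto)
  moreover have "ln (\<Prod>k=1..n. 1 + t\<^sup>2 / (real k)\<^sup>2) = (\<Sum>k<n. ln (1 + t\<^sup>2 / (real (Suc k))\<^sup>2))" for n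
  proof -
    have "ln (\<Prod>k=1..n. 1 + t\<^sup>2 / (real k)\<^sup>2) = (\<Sum>k=1..n. ln (1 + t\<^sup>2 / (real k)\<^sup>2))"
      by (rule ln_prod) (auto simp: add_nonneg_eq_0_iff)
    also have "\<dots> = (\<Sum>k<n. ln (1 + t\<^sup>2 / (real (Suc k))\<^sup>2))"
      by (rule sum.reindex_bij_witness[of _ Suc "\<lambda>k. k - 1"]) auto
    finally show ?thesis .
  qed
  ultimately show ?thesis by (simp add: sums_def)
qed

text \<open>The two logarithmic singularities at 0 cancel. The sum over the first term is \<^const>\<open>Lam\<close>; that over
  the second one is known in closed form from the product for \<open>sinh\<close>, and both have the same constant term.\<close>

definition clog :: "real \<Rightarrow> real" where
  "clog w = - ln (1 - exp (- w)) - ln (1 + 1 / w\<^sup>2) / 2"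

text \<open>The derivative of -ln (1 - e^(-w)) is -1/(e^w - 1) = -\<open>bfun w\<close> - 1/w, and
  the second part of \<open>clog\<close> cancels the 1/w. In this form the decay of
  \<open>bder 1\<close> carries over to the second derivative.\<close>

definition clog' :: "real \<Rightarrow> real" where
  "clog' w = - Re (bder 0 (of_real w)) - w / (1 + w\<^sup>2)"

definition clog'' :: "real \<Rightarrow> real" where
  "clog'' w = Re (bder 1 (of_real w)) - (1 - w\<^sup>2) / (1 + w\<^sup>2)\<^sup>2"

lemma of_real_in_sector: "w \<ge> 0 \<Longrightarrow> of_real w \<in> sector"
  by (simp add: sector_def)

lemma DERIV_clog:
  assumes "w > 0"
  shows "(clog has_real_derivative clog' w) (at w)"
proof -
  have 1: "bder 0 (of_real w) = of_real (1 / (exp w - 1) - 1 / w)"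
    using assms by (simp add: bder_def bfun_def exp_of_real)
  have 2: "1 - exp (- w) > 0" "exp w - 1 > 0" "1 + 1 / w\<^sup>2 > 0" using assms by (auto simp: add_pos_nonneg)
  have "((\<lambda>w. - ln (1 - exp (- w))) has_real_derivative - (exp (- w) / (1 - exp (- w)))) (at w)"
    using 2 by (auto intro!: derivative_eq_intros simp: inverse_eq_divide)
  moreover have "exp (- w) / (1 - exp (- w)) = 1 / (exp w - 1)"
    using 2 by (simp add: exp_minus field_simps)
  moreover have "((\<lambda>w. 1 + 1 / w\<^sup>2) has_real_derivative - 2 / w ^ 3) (at w)"
    using assms by (auto intro!: derivative_eq_intros simp: field_simps eval_nat_numeral)
  from DERIV_chain2[of ln "1 / (1 + 1 / w\<^sup>2)" "\<lambda>w. 1 + 1 / w\<^sup>2" w, OF DERIV_ln_divide[OF 2(3)] this]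
  have "((\<lambda>w. ln (1 + 1 / w\<^sup>2)) has_real_derivative 1 / (1 + 1 / w\<^sup>2) * (- 2 / w ^ 3)) (at w)" .
  moreover have "1 / (1 + 1 / w\<^sup>2) * (- 2 / w ^ 3) = 2 * (w / (1 + w\<^sup>2) - 1 / w)"
    using assms by (simp add: divide_simps add_nonneg_eq_0_iff) (simp add: eval_nat_numeral algebra_simps)
  ultimately have "((\<lambda>w. - ln (1 - exp (- w)) - ln (1 + 1 / w\<^sup>2) / 2) has_real_derivative
      - (1 / (exp w - 1)) - 2 * (w / (1 + w\<^sup>2) - 1 / w) / 2) (at w)"
    by (intro DERIV_diff DERIV_cdivide) simp_all
  then show ?thesis unfolding clog_def[abs_def] clog'_def 1
  proof (rule DERIV_cong)
    have half: "2 * X / 2 = X" for X :: real by simp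
    show "- (1 / (exp w - 1)) - 2 * (w / (1 + w\<^sup>2) - 1 / w) / 2
        = - Re (complex_of_real (1 / (exp w - 1) - 1 / w)) - w / (1 + w\<^sup>2)"
      unfolding half Re_complex_of_real by simp
  qed
qed

lemma DERIV_clog':
  assumes "w > 0"
  shows "(clog' has_real_derivative clog'' w) (at w)"
proof -
  have "of_real w \<in> bdom" using assms by (simp add: bdom_def)
  from has_vector_derivative_real_field[OF has_field_derivative_bder[OF this, of 0]]
  have "((\<lambda>x. bder 0 (of_real x)) has_vector_derivative - bder 1 (of_real w)) (at w)" by simp
  from bounded_linear.has_vector_derivative[OF bounded_linear_Re this]
  have "((\<lambda>x. Re (bder 0 (of_real x))) has_real_derivative - Re (bder 1 (of_real w))) (at w)"
    by (simp add: has_real_derivative_iff_has_vector_derivative)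
  moreover have nz: "1 + w\<^sup>2 \<noteq> 0" using assms by (simp add: add_nonneg_eq_0_iff)
  have "((\<lambda>w. w / (1 + w\<^sup>2)) has_real_derivative (1 - w\<^sup>2) / (1 + w\<^sup>2)\<^sup>2) (at w)"
    using nz by (auto intro!: derivative_eq_intros simp: power2_eq_square algebra_simps)
  ultimately have "((\<lambda>x. - Re (bder 0 (of_real x)) - x / (1 + x\<^sup>2)) has_real_derivative
      - (- Re (bder 1 (of_real w))) - (1 - w\<^sup>2) / (1 + w\<^sup>2)\<^sup>2) (at w)"
    by (rule DERIV_diff[OF DERIV_minus])
  then show ?thesis unfolding clog'_def[abs_def] clog''_def by simp
qed

lemma clog''_le:
  obtains C where "C > 0" "\<And>w. w \<ge> 0 \<Longrightarrow> \<bar>clog'' w\<bar> \<le> C / (1 + w\<^sup>2)"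
proof -
  obtain C where C: "C > 0" "\<And>w. w \<in> sector \<Longrightarrow> norm (bder 1 w) \<le> C / (1 + norm w ^ 2)"
    using norm_bder_le[of 1] by auto
  have "\<bar>clog'' w\<bar> \<le> (C + 1) / (1 + w\<^sup>2)" if "w \<ge> 0" for w
  proof -
    have pos: "1 + w\<^sup>2 > 0" by (simp add: add_pos_nonneg)
    have "\<bar>Re (bder 1 (of_real w))\<bar> \<le> C / (1 + w\<^sup>2)"
      using order_trans[OF abs_Re_le_cmod C(2)[OF of_real_in_sector[OF that]]] by simp
    moreover have "\<bar>(1 - w\<^sup>2) / (1 + w\<^sup>2)\<^sup>2\<bar> \<le> 1 / (1 + w\<^sup>2)"
    proof -
      have "\<bar>1 - w\<^sup>2\<bar> \<le> 1 + w\<^sup>2" using zero_le_power2[of w] by linarith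
      then have "\<bar>1 - w\<^sup>2\<bar> / (1 + w\<^sup>2)\<^sup>2 \<le> (1 + w\<^sup>2) / (1 + w\<^sup>2)\<^sup>2"
        by (intro divide_right_mono) auto
      also have "\<dots> = 1 / (1 + w\<^sup>2)" using pos by (simp add: power2_eq_square)
      finally show ?thesis by simp
    qed
    ultimately show ?thesis unfolding clog''_def add_divide_distrib
      by (intro order_trans[OF abs_triangle_ineq4] add_mono)
  qed
  then show ?thesis using that[of "C + 1"] C(1) by simp
qed

text \<open>In the Taylor expansions about the midpoint the first-order terms of the two ends
  cancel.\<close>

lemma clog_midpoint:
  assumes ab: "0 < a" "h > 0" and B: "\<And>w. a \<le> w \<Longrightarrow> w \<le> a + 2 * h \<Longrightarrow> \<bar>clog'' w\<bar> \<le> B"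
  shows "\<bar>clog (a + h) - clog a / 2 - clog (a + 2 * h) / 2\<bar> \<le> B * h\<^sup>2"
proof -
  define f where "f = (\<lambda>i::nat. if i = 0 then clog else if i = 1 then clog' else clog'')"
  have taylor: "\<bar>clog z - clog (a + h) - clog' (a + h) * (z - (a + h))\<bar> \<le> B * h\<^sup>2"
    if z: "z \<in> {a..a + 2 * h}" "\<bar>z - (a + h)\<bar> = h" for z
  proof -
    have "norm (f 0 z - (\<Sum>i\<le>1. f i (a + h) * (z - (a + h)) ^ i / fact i))
          \<le> B * norm (z - (a + h)) ^ Suc 1 / fact 1"
    proof (rule field_Taylor[where S = "{a..a + 2 * h}"])
      fix i x assume "x \<in> {a..a + 2 * h}" "i \<le> (1::nat)"
      then have "x > 0" "i = 0 \<or> i = 1" using ab by auto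
      then show "(f i has_field_derivative f (Suc i) x) (at x within {a..a + 2 * h})"
        using DERIV_clog DERIV_clog' by (auto simp: f_def intro: has_field_derivative_at_within)
    qed (use z ab B in \<open>auto simp: f_def\<close>)
    then show ?thesis using z(2) by (simp add: f_def power2_eq_square)
  qed
  have 1: "\<bar>clog a - clog (a + h) - clog' (a + h) * (a - (a + h))\<bar> \<le> B * h\<^sup>2"
    by (rule taylor) (use ab in auto)
  have 2: "\<bar>clog (a + 2 * h) - clog (a + h) - clog' (a + h) * (a + 2 * h - (a + h))\<bar> \<le> B * h\<^sup>2"
    by (rule taylor) (use ab in auto)
  have "clog' (a + h) * (a - (a + h)) + clog' (a + h) * (a + 2 * h - (a + h)) = 0" 
    by (simp add: algebra_simps)
  then show ?thesis using 1 2 by (simp only: abs_le_iff) linarith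
qed

text \<open>\<open>clog\<close> tends to 0 at 0 and its derivative is bounded on (0, 1]. This keeps
  the boundary term of a Riemann sum out of the comparison of step widths.\<close>

lemma clog_linear_bound:
  obtains K where "K > 0" "\<And>w. 0 < w \<Longrightarrow> w \<le> 1 \<Longrightarrow> \<bar>clog w\<bar> \<le> K * w"
proof -
  obtain C where C: "C > 0" "\<And>w. w \<ge> 0 \<Longrightarrow> \<bar>clog'' w\<bar> \<le> C / (1 + w\<^sup>2)" using clog''_le by blast
  have C': "\<bar>clog'' w\<bar> \<le> C" if "w \<ge> 0" for w
    using C(2)[OF that] C(1) divide_left_mono[of 1 "1 + w\<^sup>2" C] by (simp add: add_pos_nonneg)
  define K where "K = \<bar>clog' 1\<bar> + C"
  have K: "\<bar>clog' w\<bar> \<le> K" if w: "0 < w" "w \<le> 1" for w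
  proof -
    have "norm (clog' w - clog' 1) \<le> C * norm (w - 1)"
      by (rule field_differentiable_bound[where S = "{w..1}" and f' = clog''])
         (use w C' in \<open>auto intro!: has_field_derivative_at_within[OF DERIV_clog']\<close>)
    also have "\<dots> \<le> C * 1" using w C(1) by (intro mult_left_mono) auto
    finally show ?thesis unfolding K_def real_norm_def by linarith
  qed
  have lim: "(clog \<longlongrightarrow> 0) (at_right 0)"
    unfolding clog_def[abs_def] by real_asymp
  have "\<bar>clog w\<bar> \<le> K * w" if w: "0 < w" "w \<le> 1" for w
  proof (rule tendsto_upperbound)
    show "((\<lambda>v. \<bar>clog w - clog v\<bar>) \<longlongrightarrow> \<bar>clog w\<bar>) (at_right 0)"
      using tendsto_rabs[OF tendsto_diff[OF tendsto_const lim, of "clog w"]] by simp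
    have "\<forall>\<^sub>F v in at_right 0. v \<in> {0<..<w}" using w by (intro eventually_at_right_real)
    then show "\<forall>\<^sub>F v in at_right 0. \<bar>clog w - clog v\<bar> \<le> K * w"
    proof eventually_elim
      case (elim v)
      have "norm (clog w - clog v) \<le> K * norm (w - v)"
        by (rule field_differentiable_bound[where S = "{v..w}" and f' = clog'])
           (use w elim K in \<open>auto intro!: has_field_derivative_at_within[OF DERIV_clog]\<close>)
      also have "\<dots> \<le> K * w" using elim K[of 1] by (intro mult_left_mono) auto
      finally show ?case by simp
    qed
  qed simp
  moreover have "K > 0" unfolding K_def using C(1) by simp
  ultimately show ?thesis using that by blast
qed

definition Tlog :: "real \<Rightarrow> real" where
  "Tlog x = Re (Lam (of_real x)) - ln (sinh (pi / x) / (pi / x)) / 2"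

lemma Tlog_sums:
  assumes "x > 0"
  shows "(\<lambda>e. clog (real (Suc e) * x)) sums Tlog x"
proof -
  have "(\<lambda>n. ln (1 + (1 / x)\<^sup>2 / (real (Suc n))\<^sup>2)) sums ln (sinh (pi * (1 / x)) / (pi * (1 / x)))"
    by (rule ln_sinh_sums) (use assms in simp)
  then have "(\<lambda>n. ln (1 + (1 / x)\<^sup>2 / (real (Suc n))\<^sup>2) / 2) sums (ln (sinh (pi / x) / (pi / x)) / 2)"
    by (intro sums_divide) simp
  from sums_diff[OF Lam_sums_ln[OF assms] this] show ?thesis
    by (simp add: clog_def Tlog_def power_divide power_mult_distrib mult.commute del: of_nat_Suc)
qed

text \<open>x \<open>Tlog x\<close> is a Riemann sum of \<open>clog\<close> with step x, and halving
  the step changes it only by O(x^2). Division by x gives a relation from which the unknown integral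
  has dropped out.\<close>

lemma Tlog_halving:
  obtains K where "K > 0" "\<And>x. 0 < x \<Longrightarrow> x \<le> 1 \<Longrightarrow> \<bar>Tlog (x / 2) / 2 - Tlog x\<bar> \<le> K * x"
proof -
  obtain C where C: "C > 0" "\<And>w. w \<ge> 0 \<Longrightarrow> \<bar>clog'' w\<bar> \<le> C / (1 + w\<^sup>2)" using clog''_le by blast
  obtain L where L: "L > 0" "\<And>w. 0 < w \<Longrightarrow> w \<le> 1 \<Longrightarrow> \<bar>clog w\<bar> \<le> L * w" using clog_linear_bound by blast
  have "\<bar>Tlog (x / 2) / 2 - Tlog x\<bar> \<le> (3 * C + L) * x" if x: "0 < x" "x \<le> 1" for x
  proof -
    define h where "h = x / 2"
    have h: "h > 0" "x = 2 * h" using x by (auto simp: h_def)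
    have T: "(\<lambda>e. clog (real (Suc e) * x)) sums Tlog x" by (rule Tlog_sums[OF x(1)])
    have "(\<lambda>e. clog (real (Suc e) * h)) sums Tlog h" by (rule Tlog_sums[OF h(1)])
    \<comment> \<open>The finer points are taken in pairs, a midpoint and an old point; subtracting
      the old sum leaves the midpoints.\<close>
    from sums_group[OF this, of 2]
    have "(\<lambda>n. clog (real n * x + h) + clog (real (Suc n) * x)) sums Tlog h"
      by (simp add: h algebra_simps eval_nat_numeral)
    from sums_diff[OF this T] have "(\<lambda>n. clog (real n * x + h)) sums (Tlog h - Tlog x)" by simp
    then have M: "(\<lambda>n. clog (real (Suc n) * x + h)) sums (Tlog h - Tlog x - clog h)"
      by (subst sums_Suc_iff) simp
    have T': "(\<lambda>e. clog (real (Suc (Suc e)) * x)) sums (Tlog x - clog x)"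
      using T by (subst sums_Suc_iff) simp
    \<comment> \<open>The deviation of each midpoint value from the mean of its neighbours. The
      first interval is left out, because \<open>clog_midpoint\<close> needs a positive left end;
      there the linear bound at 0 is used.\<close>
    define G where "G = (\<lambda>n. clog (real (Suc n) * x + h) - clog (real (Suc n) * x) / 2
        - clog (real (Suc (Suc n)) * x) / 2)"
    have G: "G sums (Tlog h - Tlog x - clog h - Tlog x / 2 - (Tlog x - clog x) / 2)"
      unfolding G_def by (rule sums_diff[OF sums_diff[OF M sums_divide[OF T]] sums_divide[OF T']])
    have Gle: "norm (G n) \<le> C * h\<^sup>2 * (1 / (1 + (real n * x)\<^sup>2))" for n
    proof -
      have eq: "real (Suc (Suc n)) * x = real (Suc n) * x + 2 * h" by (simp add: h algebra_simps)
      have "\<bar>G n\<bar> \<le> C / (1 + (real n * x)\<^sup>2) * h\<^sup>2"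
        unfolding G_def eq
      proof (rule clog_midpoint)
        fix w assume w: "real (Suc n) * x \<le> w"
        have "real n * x \<le> real (Suc n) * x" "0 \<le> real n * x" using x by (auto intro: mult_right_mono)
        then have "(real n * x)\<^sup>2 \<le> w\<^sup>2" using w by (intro power_mono) linarith+
        then have "C / (1 + w\<^sup>2) \<le> C / (1 + (real n * x)\<^sup>2)"
          using C(1) by (intro divide_left_mono) (auto simp: add_pos_nonneg)
        moreover have "w \<ge> 0" using w \<open>0 \<le> real n * x\<close> \<open>real n * x \<le> real (Suc n) * x\<close> by linarith
        ultimately show "\<bar>clog'' w\<bar> \<le> C / (1 + (real n * x)\<^sup>2)" using C(2)[of w] by linarith
      qed (use x h in auto)
      then show ?thesis by (simp add: mult_ac)
    qed
    have sm: "summable (\<lambda>n. C * h\<^sup>2 * (1 / (1 + (real n * x)\<^sup>2)))"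
      by (rule summable_mult) (rule sum_inverse_quadratic[OF x(1)])
    have sG: "summable (\<lambda>n. norm (G n))"
      by (rule summable_comparison_test'[OF sm, where N = 0]) (use Gle in auto)
    have "\<bar>suminf G\<bar> \<le> (\<Sum>n. norm (G n))" using summable_norm[OF sG] by simp
    also have "\<dots> \<le> (\<Sum>n. C * h\<^sup>2 * (1 / (1 + (real n * x)\<^sup>2)))" by (rule suminf_le[OF Gle sG sm])
    also have "\<dots> = C * h\<^sup>2 * (\<Sum>n. 1 / (1 + (real n * x)\<^sup>2))"
      by (rule suminf_mult) (rule sum_inverse_quadratic[OF x(1)])
    also have "\<dots> \<le> C * h\<^sup>2 * (1 + 2 / x)"
      using C(1) by (intro mult_left_mono sum_inverse_quadratic[OF x(1)]) auto
    also have "\<dots> \<le> C * h\<^sup>2 * (3 / x)" using x C(1) by (intro mult_left_mono) (auto simp: field_simps)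
    also have "\<dots> = 3 / 4 * C * x" using x by (simp add: h_def power2_eq_square)
    finally have "\<bar>suminf G\<bar> \<le> 3 / 4 * C * x" .
    moreover have "suminf G = Tlog h - 2 * Tlog x - clog h + clog x / 2"
      unfolding sums_unique[OF G, symmetric] by (simp add: field_simps)
    ultimately have "\<bar>Tlog h - 2 * Tlog x - clog h + clog x / 2\<bar> \<le> 3 / 4 * C * x" by simp
    moreover have "\<bar>clog h\<bar> \<le> L * h" "\<bar>clog x\<bar> \<le> L * x" using L(2) x h by auto
    moreover have "C * x \<ge> 0" "L * x \<ge> 0" using C(1) L(1) x by auto
    ultimately have "\<bar>Tlog h - 2 * Tlog x\<bar> \<le> C * x + L * x" unfolding h_def by linarith
    then show ?thesis using \<open>C * x \<ge> 0\<close> \<open>L * x \<ge> 0\<close> unfolding h_def[symmetric] distrib_right by linarith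
  qed
  then show ?thesis using that[of "3 * C + L"] C(1) L(1) by simp
qed

text \<open>If c is the limit of \<open>LamD\<close>, then \<open>Tlog x\<close> is c + k(x) + o(1)
  for an explicit k, and T(x/2)/2 - T(x) -> 0 becomes -c/2 - ln (2 pi)/4 = 0.\<close>

lemma LamD_asymp':
  obtains K where "K > 0" "\<And>s. s \<in> sector \<Longrightarrow> s \<noteq> 0 \<Longrightarrow> norm s \<le> 1 \<Longrightarrow>
    norm (LamD s - of_real (- ln (2 * pi) / 2)) \<le> K * norm s ^ 2"
proof -
  obtain c K where K: "K > 0" "\<And>s. s \<in> sector \<Longrightarrow> s \<noteq> 0 \<Longrightarrow> norm s \<le> 1 \<Longrightarrow> norm (LamD s - c) \<le> K * norm s ^ 2"
    by (rule LamD_asymp) (rule that)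
  obtain L where L: "L > 0" "\<And>x. 0 < x \<Longrightarrow> x \<le> 1 \<Longrightarrow> \<bar>Tlog (x / 2) / 2 - Tlog x\<bar> \<le> L * x"
    by (rule Tlog_halving) (rule that)
  define D where "D = (\<lambda>x. LamD (of_real x))"
  have ev: "\<forall>\<^sub>F x::real in at_right 0. x \<in> {0<..<1}" by (rule eventually_at_right_real) simp
  have D: "(D \<longlongrightarrow> c) (at_right 0)"
  proof (rule LIM_zero_cancel, rule Lim_null_comparison)
    show "\<forall>\<^sub>F x in at_right 0. norm (D x - c) \<le> K * x ^ 2"
      using ev
    proof eventually_elim
      case (elim x)
      then show ?case using K(2)[of "of_real x"] of_real_in_sector[of x] by (simp add: D_def)
    qed
    show "((\<lambda>x. K * x ^ 2) \<longlongrightarrow> 0) (at_right 0)" by real_asymp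
  qed
  have D': "((\<lambda>x. D (x / 2)) \<longlongrightarrow> c) (at_right 0)"
    by (rule filterlim_compose[OF D]) real_asymp
  have Ln: "Ln (of_real x) = of_real (ln x)" if "x > 0" for x using that by (simp add: Ln_of_real)
  have "Im c = 0"
  proof (rule tendsto_unique[OF _ tendsto_Im[OF D]])
    have "\<forall>\<^sub>F x in at_right 0. 0 = Im (D x)"
      using ev by eventually_elim (simp add: D_def LamD_def Lam_of_real Ln flip: of_real_power)
    then show "((\<lambda>x. Im (D x)) \<longlongrightarrow> 0) (at_right 0)" by (rule Lim_transform_eventually[OF tendsto_const])
  qed simp
  moreover have "Re c = - ln (2 * pi) / 2"
  proof -
    define k where "k = (\<lambda>x. pi\<^sup>2 / 6 / x - x / 24 - ln (sinh (pi / x)) / 2 + ln pi / 2)"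
    have Tk: "Tlog x = Re (D x) + k x" if "x > 0" for x
    proof -
      have "ln (sinh (pi / x) / (pi / x)) = ln (sinh (pi / x)) - (ln pi - ln x)"
      proof -
        have pos: "sinh (pi / x) > 0" "pi / x > 0" "pi > 0" using that by auto
        show ?thesis unfolding ln_divide_pos[OF pos(1,2)] ln_divide_pos[OF pos(3) that] ..
      qed
      moreover have "Re (D x) = Re (Lam (of_real x)) - pi\<^sup>2 / 6 / x - ln x / 2 + x / 24"
      proof -
        have "of_real (pi\<^sup>2 / 6) / complex_of_real x = of_real (pi\<^sup>2 / 6 / x)" by simp
        then show ?thesis unfolding D_def LamD_def Ln[OF that] by (simp only:) simp
      qed
      ultimately show ?thesis unfolding Tlog_def k_def by linarith
    qed
    have "((\<lambda>x. k (x / 2) / 2 - k x) \<longlongrightarrow>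
        (ln pi / 2 - ln (1 / 2) / 2) / 2 - (ln pi / 2 - ln (1 / 2) / 2)) (at_right 0)"
      unfolding k_def by real_asymp
    also have "(ln pi / 2 - ln (1 / 2) / 2) / 2 - (ln pi / 2 - ln (1 / 2) / 2) = - ln (2 * pi) / 4"
      by (simp add: ln_mult ln_div)
    finally have "((\<lambda>x. k (x / 2) / 2 - k x) \<longlongrightarrow> - ln (2 * pi) / 4) (at_right 0)" .
    then have "((\<lambda>x. Re (D (x / 2)) / 2 - Re (D x) + (k (x / 2) / 2 - k x)) \<longlongrightarrow> Re c / 2 - Re c + - ln (2 * pi) / 4) (at_right 0)"
      by (intro tendsto_intros D D') auto
    moreover have "((\<lambda>x. Re (D (x / 2)) / 2 - Re (D x) + (k (x / 2) / 2 - k x)) \<longlongrightarrow> 0) (at_right 0)"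
    proof (rule Lim_null_comparison)
      show "\<forall>\<^sub>F x in at_right 0. norm (Re (D (x / 2)) / 2 - Re (D x) + (k (x / 2) / 2 - k x)) \<le> L * x"
        using ev
      proof eventually_elim
        case (elim x)
        then have "Re (D (x / 2)) / 2 - Re (D x) + (k (x / 2) / 2 - k x) = Tlog (x / 2) / 2 - Tlog x"
          using Tk[of x] Tk[of "x / 2"] by (simp add: add_divide_distrib)
        then show ?case using L(2)[of x] elim by simp
      qed
      show "((\<lambda>x. L * x) \<longlongrightarrow> 0) (at_right 0)" by real_asymp
    qed
    ultimately have "Re c / 2 - Re c + - ln (2 * pi) / 4 = 0" by (rule tendsto_unique[rotated]) simp
    then show ?thesis by simp
  qed
  ultimately have "c = of_real (- ln (2 * pi) / 2)" by (simp add: complex_eq_iff)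
  then show ?thesis using that K by blast
qed

section \<open>Bessel functions of half-integral order\<close>

text \<open>The coefficients of I_nu in powers of y/2. Since 1/Gamma is entire, the relations
  between them hold for every real order.\<close>

definition bcoef :: "real \<Rightarrow> nat \<Rightarrow> real" where
  "bcoef \<nu> j = rGamma (real j + \<nu> + 1) / fact j"

lemma bcoef_Suc: "bcoef \<nu> j = (real j + \<nu> + 1) * real (Suc j) * bcoef \<nu> (Suc j)"
proof -
  have "real (Suc j) + \<nu> + 1 = real j + \<nu> + 1 + 1" by simp
  then show ?thesis
    unfolding bcoef_def rGamma_plus1[of "real j + \<nu> + 1", symmetric]
    by (simp only: fact_Suc) (simp del: of_nat_Suc)
qed

lemma bcoef_shift: "bcoef (\<nu> + 1) j = real (Suc j) * bcoef \<nu> (Suc j)"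
proof -
  have "real (Suc j) + \<nu> + 1 = real j + (\<nu> + 1) + 1" by simp
  then show ?thesis unfolding bcoef_def by (simp only: fact_Suc) (simp del: of_nat_Suc)
qed

lemma summable_bcoef: "summable (\<lambda>j. bcoef \<nu> j * z ^ j)"
proof (rule summable_ratio_test[where c = "1 / 2" and N = "nat \<lceil>\<bar>\<nu>\<bar> + 2 * \<bar>z\<bar>\<rceil>"])
  fix j assume "nat \<lceil>\<bar>\<nu>\<bar> + 2 * \<bar>z\<bar>\<rceil> \<le> j"
  then have j: "\<bar>\<nu>\<bar> + 2 * \<bar>z\<bar> \<le> real j" by linarith
  then have "1 \<le> real j + \<nu> + 1" by linarith
  have "2 * \<bar>z\<bar> \<le> 1 * real (Suc j)" using j by simp
  also have "\<dots> \<le> (real j + \<nu> + 1) * real (Suc j)" using \<open>1 \<le> real j + \<nu> + 1\<close> by (intro mult_right_mono) auto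
  also have "\<dots> = \<bar>(real j + \<nu> + 1) * real (Suc j)\<bar>"
    using \<open>1 \<le> real j + \<nu> + 1\<close> by (simp add: abs_mult)
  finally have "2 * \<bar>z\<bar> * (\<bar>bcoef \<nu> (Suc j)\<bar> * \<bar>z\<bar> ^ j)
      \<le> \<bar>(real j + \<nu> + 1) * real (Suc j)\<bar> * (\<bar>bcoef \<nu> (Suc j)\<bar> * \<bar>z\<bar> ^ j)"
    by (intro mult_right_mono) auto
  then show "norm (bcoef \<nu> (Suc j) * z ^ Suc j) \<le> 1 / 2 * norm (bcoef \<nu> j * z ^ j)"
    unfolding bcoef_Suc[of \<nu> j] by (simp add: abs_mult power_abs mult_ac)
qed simp

lemma bessel_I_eq:
  assumes "y > 0"
  shows "bessel_I \<nu> y = (y / 2) powr \<nu> * (\<Sum>j. bcoef \<nu> j * ((y / 2)\<^sup>2) ^ j)"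
proof -
  have "(y / 2) powr (2 * real j + \<nu>) = (y / 2) powr \<nu> * ((y / 2)\<^sup>2) ^ j" for j
  proof -
    have "(y / 2) powr (2 * real j) = (y / 2) ^ (2 * j)"
      using assms powr_realpow[of "y / 2" "2 * j"] by simp
    then show ?thesis using power_mult[of "y / 2" 2 j] by (simp add: powr_add)
  qed
  then have "bessel_I \<nu> y = (\<Sum>j. (y / 2) powr \<nu> * (bcoef \<nu> j * ((y / 2)\<^sup>2) ^ j))"
    unfolding bessel_I_def bcoef_def by (simp only: mult_ac)
  also have "\<dots> = (y / 2) powr \<nu> * (\<Sum>j. bcoef \<nu> j * ((y / 2)\<^sup>2) ^ j)"
    by (rule suminf_mult[OF summable_bcoef])
  finally show ?thesis .
qed

text \<open>Coefficientwise, \<open>bcoef (\<nu> - 1) j = (real j + \<nu>) * bcoef \<nu> j\<close>;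
  the part with \<open>real j\<close> is the series of order \<open>\<nu> + 1\<close> after a shift
  of the index.\<close>

lemma bessel_I_rec:
  assumes "y > 0"
  shows "bessel_I (\<nu> - 1) y - bessel_I (\<nu> + 1) y = 2 * \<nu> / y * bessel_I \<nu> y"
proof -
  define z where "z = (y / 2)\<^sup>2"
  define S where "S = (\<lambda>\<nu>. \<Sum>j. bcoef \<nu> j * z ^ j)"
  have sums: "(\<lambda>j. bcoef \<nu> j * z ^ j) sums S \<nu>" for \<nu>
    unfolding S_def by (rule summable_sums[OF summable_bcoef])
  have "(\<lambda>j. z * (bcoef (\<nu> + 1) j * z ^ j)) sums (z * S (\<nu> + 1))"
    by (rule sums_mult[OF sums])
  also have "(\<lambda>j. z * (bcoef (\<nu> + 1) j * z ^ j)) = (\<lambda>j. real (Suc j) * bcoef \<nu> (Suc j) * z ^ Suc j)"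
    by (simp only: bcoef_shift power_Suc mult_ac)
  finally have "(\<lambda>j. real j * bcoef \<nu> j * z ^ j) sums (z * S (\<nu> + 1))" by (subst (asm) sums_Suc_iff) simp
  from sums_diff[OF sums[of "\<nu> - 1"] this]
  have "(\<lambda>j. \<nu> * (bcoef \<nu> j * z ^ j)) sums (S (\<nu> - 1) - z * S (\<nu> + 1))"
  proof (rule sums_cong[THEN iffD1, rotated])
    fix j
    have "bcoef (\<nu> - 1) j = (real j + \<nu>) * bcoef \<nu> j"
      using rGamma_plus1[of "real j + \<nu>"] by (simp add: bcoef_def)
    then show "bcoef (\<nu> - 1) j * z ^ j - real j * bcoef \<nu> j * z ^ j = \<nu> * (bcoef \<nu> j * z ^ j)"
      by (simp add: algebra_simps)
  qed
  from sums_unique2[OF this sums_mult[OF sums]]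
  have S: "S (\<nu> - 1) - z * S (\<nu> + 1) = \<nu> * S \<nu>" .
  define p where "p = (y / 2) powr (\<nu> - 1)"
  have p: "(y / 2) powr \<nu> = p * (y / 2)" "(y / 2) powr (\<nu> + 1) = p * z"
    using assms unfolding p_def z_def
    by (simp_all add: powr_diff powr_add power2_eq_square)
  have B: "bessel_I \<mu> y = (y / 2) powr \<mu> * S \<mu>" for \<mu>
    by (simp add: bessel_I_eq[OF assms] S_def z_def)
  have "bessel_I (\<nu> - 1) y - bessel_I (\<nu> + 1) y = p * (S (\<nu> - 1) - z * S (\<nu> + 1))"
    unfolding B p p_def[symmetric] by (simp add: algebra_simps)
  also have "\<dots> = 2 * \<nu> / y * bessel_I \<nu> y"
    unfolding B p S using assms by simp
  finally show ?thesis .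
qed

text \<open>The duplication formula of the Gamma function, by induction from Gamma(1/2) = sqrt
  pi.\<close>

lemma bcoef_half: "bcoef (1 / 2) j = 2 ^ (2 * j + 1) / (fact (2 * j + 1) * sqrt pi)"
  "bcoef (- 1 / 2) j = 2 ^ (2 * j) / (fact (2 * j) * sqrt pi)"
proof -
  have half: "rGamma (1 / 2 :: real) = 1 / sqrt pi"
    by (simp add: rGamma_inverse_Gamma Gamma_one_half_real inverse_eq_divide)
  have base: "bcoef (- 1 / 2) 0 = 1 / sqrt pi" by (simp add: bcoef_def half)
  have base': "bcoef (1 / 2) 0 = 2 / sqrt pi"
    using rGamma_plus1[of "1 / 2 :: real"] half by (simp add: bcoef_def add.commute)
  show "bcoef (1 / 2) j = 2 ^ (2 * j + 1) / (fact (2 * j + 1) * sqrt pi)"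
  proof (induction j)
    case (Suc j)
    have "real j + 1 / 2 + 1 > 0" by simp
    then have "bcoef (1 / 2) (Suc j) = bcoef (1 / 2) j / ((real j + 1 / 2 + 1) * real (Suc j))"
      unfolding bcoef_Suc[of "1 / 2" j] by (simp del: of_nat_Suc)
    moreover have "fact (2 * Suc j + 1) = 4 * ((real j + 1 / 2 + 1) * real (Suc j)) * fact (2 * j + 1)"
      by (simp add: field_simps)
    moreover have "(2 :: real) ^ (2 * Suc j + 1) = 4 * 2 ^ (2 * j + 1)" by simp
    ultimately show ?case unfolding Suc by (simp only:) (simp del: of_nat_Suc)
  qed (simp add: base')
  show "bcoef (- 1 / 2) j = 2 ^ (2 * j) / (fact (2 * j) * sqrt pi)"
  proof (induction j)
    case (Suc j)
    have "real j + - 1 / 2 + 1 > 0" by simp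
    then have "bcoef (- 1 / 2) (Suc j) = bcoef (- 1 / 2) j / ((real j + - 1 / 2 + 1) * real (Suc j))"
      unfolding bcoef_Suc[of "- 1 / 2" j] by (simp del: of_nat_Suc)
    moreover have "fact (2 * Suc j) = 4 * ((real j + - 1 / 2 + 1) * real (Suc j)) * fact (2 * j)"
      by (simp add: field_simps)
    moreover have "(2 :: real) ^ (2 * Suc j) = 4 * 2 ^ (2 * j)" by simp
    ultimately show ?case unfolding Suc by (simp only:) (simp del: of_nat_Suc)
  qed (use base in simp)
qed

lemma bessel_I_half:
  assumes "y > 0"
  shows "bessel_I (1 / 2) y = sqrt (2 / (pi * y)) * sinh y"
    and "bessel_I (- 1 / 2) y = sqrt (2 / (pi * y)) * cosh y"
proof -
  have pw: "(y / 2) powr (1 / 2) = sqrt (y / 2)" "(y / 2) powr (- 1 / 2) = 1 / sqrt (y / 2)"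
    using assms powr_half_sqrt[of "y / 2"] by (simp_all add: powr_minus inverse_eq_divide)
  have half_pow: "((y / 2)\<^sup>2) ^ n = y ^ (2 * n) / 2 ^ (2 * n)" for n
    by (simp add: power_divide power_mult)
  have "(\<lambda>n. (\<lambda>n. if even n then 0 else y ^ n /\<^sub>R fact n) (2 * n + 1)) sums sinh y"
    by (rule sums_mono_reindex[THEN iffD2, OF _ _ sinh_converges])
       (auto simp: strict_mono_def elim!: oddE)
  then have "(\<lambda>n. y ^ (2 * n + 1) / fact (2 * n + 1)) sums sinh y"
    by (simp add: divide_inverse mult.commute)
  then have "(\<lambda>n. 2 / y / sqrt pi * (y ^ (2 * n + 1) / fact (2 * n + 1))) sums (2 / y / sqrt pi * sinh y)"
    by (rule sums_mult)
  moreover have "2 / y / sqrt pi * (y ^ (2 * n + 1) / fact (2 * n + 1)) = bcoef (1 / 2) n * ((y / 2)\<^sup>2) ^ n" for n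
    unfolding bcoef_half half_pow power_add power_one_right using assms by (simp add: divide_simps)
  ultimately have "(\<lambda>n. bcoef (1 / 2) n * ((y / 2)\<^sup>2) ^ n) sums (2 / y / sqrt pi * sinh y)"
    by (simp only:)
  then have "bessel_I (1 / 2) y = sqrt (y / 2) * (2 / y / sqrt pi * sinh y)"
    using bessel_I_eq[OF assms, of "1 / 2"] pw by (simp add: sums_iff)
  also have "\<dots> = sqrt (2 / (pi * y)) * sinh y"
    using assms by (simp add: real_sqrt_divide real_sqrt_mult field_simps)
  finally show "bessel_I (1 / 2) y = sqrt (2 / (pi * y)) * sinh y" .
  have "(\<lambda>n. (\<lambda>n. if even n then y ^ n /\<^sub>R fact n else 0) (2 * n)) sums cosh y"
    by (rule sums_mono_reindex[THEN iffD2, OF _ _ cosh_converges])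
       (auto simp: strict_mono_def elim!: evenE)
  then have "(\<lambda>n. y ^ (2 * n) / fact (2 * n)) sums cosh y"
    by (simp add: divide_inverse mult.commute)
  then have "(\<lambda>n. 1 / sqrt pi * (y ^ (2 * n) / fact (2 * n))) sums (1 / sqrt pi * cosh y)"
    by (rule sums_mult)
  moreover have "1 / sqrt pi * (y ^ (2 * n) / fact (2 * n)) = bcoef (- 1 / 2) n * ((y / 2)\<^sup>2) ^ n" for n
    unfolding bcoef_half half_pow power_add power_one_right using assms by (simp add: divide_simps)
  ultimately have "(\<lambda>n. bcoef (- 1 / 2) n * ((y / 2)\<^sup>2) ^ n) sums (1 / sqrt pi * cosh y)"
    by (simp only:)
  then have "bessel_I (- 1 / 2) y = 1 / sqrt (y / 2) * (1 / sqrt pi * cosh y)"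
    using bessel_I_eq[OF assms, of "- 1 / 2"] pw by (simp add: sums_iff)
  also have "\<dots> = sqrt (2 / (pi * y)) * cosh y"
    using assms by (simp add: real_sqrt_divide real_sqrt_mult field_simps)
  finally show "bessel_I (- 1 / 2) y = sqrt (2 / (pi * y)) * cosh y" .
qed

section \<open>The integral over the major arc\<close>

text \<open>The vertical line through t = 1, the saddle point of t + 1/t.\<close>

definition bline :: "real \<Rightarrow> complex" where
  "bline u = 1 + \<i> * of_real u"

definition bker :: "real \<Rightarrow> complex \<Rightarrow> complex" where
  "bker y t = exp (of_real (y / 2) * (t + 1 / t))"

text \<open>Schlaefli's integral for 2 pi times the Bessel function of order -a - 1, with the
  contour cut off at 1 - i and 1 + i.\<close>

definition Jint :: "real \<Rightarrow> real \<Rightarrow> complex" where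
  "Jint a y = integral {-1..1} (\<lambda>u. bline u powr of_real a * bker y (bline u))"

lemma bline_simps [simp]: "Re (bline u) = 1" "Im (bline u) = u" "bline u \<noteq> 0"
  by (auto simp: bline_def complex_eq_iff)

lemma has_field_derivative_bker:
  assumes "t \<noteq> 0"
  shows "(bker y has_field_derivative of_real (y / 2) * (1 - 1 / t\<^sup>2) * bker y t) (at t)"
  unfolding bker_def[abs_def] using assms
  by (auto intro!: derivative_eq_intros simp: power2_eq_square)

lemma continuous_Jint: "continuous_on {-1..1} (\<lambda>u. bline u powr of_real a * bker y (bline u))"
  unfolding bker_def bline_def
  by (intro continuous_intros) (auto simp: complex_eq_iff complex_nonpos_Reals_iff)

lemma Jint_has_integral:
  "((\<lambda>u. bline u powr of_real a * bker y (bline u)) has_integral Jint a y) {-1..1}"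
  unfolding Jint_def using continuous_Jint
  by (intro integrable_integral integrable_continuous_interval)

lemma has_integral_bline:
  assumes "\<And>t. Re t > 0 \<Longrightarrow> (G has_field_derivative g t) (at t)"
  shows "((\<lambda>u. g (bline u)) has_integral - \<i> * (G (bline 1) - G (bline (- 1)))) {-1..1}"
proof -
  have "((\<lambda>u. \<i> * g (bline u)) has_integral (G (bline 1) - G (bline (- 1)))) {-1..1}"
  proof (rule fundamental_theorem_of_calculus)
    fix u :: real assume "u \<in> {-1..1}"
    have "(bline has_vector_derivative \<i>) (at u within {-1..1})"
      unfolding bline_def[abs_def] by (auto intro!: derivative_eq_intros)
    moreover have "(G has_field_derivative g (bline u)) (at (bline u) within bline ` {-1..1})"
      by (rule has_field_derivative_at_within[OF assms]) simp
    ultimately have "((G \<circ> bline) has_vector_derivative \<i> * g (bline u)) (at u within {-1..1})"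
      by (rule field_vector_diff_chain_within)
    then show "((\<lambda>u. G (bline u)) has_vector_derivative \<i> * g (bline u)) (at u within {-1..1})"
      by (simp add: o_def)
  qed simp
  from has_integral_mult_right[OF this, of "- \<i>"] show ?thesis by simp
qed

text \<open>At t = 1 + i and t = 1 - i, Re (t + 1/t) is 3/2 against 2 at the saddle, so the ends
  contribute e^(3y/4) against e^y.\<close>

lemma norm_bker_ends:
  assumes "u = 1 \<or> u = - 1"
  shows "norm (bker y (bline u)) = exp (3 / 4 * y)"
proof -
  have "1 / bline u = (1 - \<i> * of_real u) / 2"
    using assms by (auto simp: bline_def complex_eq_iff Re_divide Im_divide power2_eq_square)
  then show ?thesis unfolding bker_def by (simp only: norm_exp_eq_Re) (simp add: bline_def)
qed

lemma norm_bline_ends: "u = 1 \<or> u = - 1 \<Longrightarrow> norm (bline u) = sqrt 2"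
  by (auto simp: bline_def cmod_def)

lemma norm_powr_of_real: "t \<noteq> 0 \<Longrightarrow> norm (t powr of_real a) = norm t powr a" for t :: complex
  by (simp add: powr_def norm_exp_eq_Re)

lemma powr_add_one:
  fixes t :: complex
  assumes "t \<noteq> 0"
  shows "t powr of_real (a + 1) = t powr of_real a * t" "t powr of_real (a - 1) = t powr of_real a / t"
  using assms by (simp_all add: powr_add powr_diff)

text \<open>The integral of the derivative of t^(a+1) e^((y/2) (t + 1/t)); the right-hand side
  bounds its values at the two ends.\<close>

lemma Jint_rec:
  "norm (of_real (a + 1) * Jint a y + of_real (y / 2) * (Jint (a + 1) y - Jint (a - 1) y))
   \<le> 2 * sqrt 2 powr (a + 1) * exp (3 / 4 * y)"
proof -
  define G where "G = (\<lambda>t. t powr of_real (a + 1) * bker y t)"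
  define g where "g = (\<lambda>t. of_real (a + 1) * (t powr of_real a * bker y t)
      + of_real (y / 2) * (t powr of_real (a + 1) * bker y t - t powr of_real (a - 1) * bker y t))"
  have der: "(G has_field_derivative g t) (at t)" if "Re t > 0" for t
  proof -
    have t: "t \<noteq> 0" "t \<notin> \<real>\<^sub>\<le>\<^sub>0" using that by (auto simp: complex_nonpos_Reals_iff)
    have "((\<lambda>t. t powr of_real (a + 1)) has_field_derivative of_real (a + 1) * t powr (of_real (a + 1) - 1)) (at t)"
      by (rule has_field_derivative_powr[OF t(2)])
    then have 1: "((\<lambda>t. t powr of_real (a + 1)) has_field_derivative of_real (a + 1) * t powr of_real a) (at t)"
      by simp
    show ?thesis unfolding G_def
      by (rule DERIV_cong[OF DERIV_mult[OF 1 has_field_derivative_bker[OF t(1)]]])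
         (unfold g_def powr_add_one[OF t(1)], use t in \<open>simp add: field_simps power2_eq_square\<close>)
  qed
  have "((\<lambda>u. g (bline u)) has_integral - \<i> * (G (bline 1) - G (bline (- 1)))) {-1..1}"
    by (rule has_integral_bline) (rule der)
  moreover have "((\<lambda>u. g (bline u)) has_integral
      (of_real (a + 1) * Jint a y + of_real (y / 2) * (Jint (a + 1) y - Jint (a - 1) y))) {-1..1}"
    unfolding g_def by (intro has_integral_add has_integral_mult_right has_integral_diff Jint_has_integral)
  ultimately have eq: "of_real (a + 1) * Jint a y + of_real (y / 2) * (Jint (a + 1) y - Jint (a - 1) y)
      = - \<i> * (G (bline 1) - G (bline (- 1)))"
    using has_integral_unique by blast
  have "norm (G (bline u)) = sqrt 2 powr (a + 1) * exp (3 / 4 * y)" if "u = 1 \<or> u = - 1" for u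
    using that unfolding G_def norm_mult norm_powr_of_real[OF bline_simps(3)]
    by (simp add: norm_bker_ends norm_bline_ends)
  then have "norm (G (bline 1) - G (bline (- 1))) \<le> 2 * sqrt 2 powr (a + 1) * exp (3 / 4 * y)"
    by (intro order_trans[OF norm_triangle_ineq4]) simp
  then show ?thesis unfolding eq by (simp add: norm_mult)
qed

section \<open>Gaussian integrals and the two base cases of half-integral order\<close>

lemma gauss_has_integral:
  assumes "c > 0"
  shows "((\<lambda>x::real. exp (- (c * x\<^sup>2))) has_integral sqrt (pi / c)) UNIV"
proof -
  define \<sigma> where "\<sigma> = 1 / sqrt (2 * c)"
  have \<sigma>: "\<sigma> > 0" "\<sigma>\<^sup>2 = 1 / (2 * c)" using assms by (auto simp: \<sigma>_def power_divide)
  have "(normal_density 0 \<sigma> has_integral 1) UNIV"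
    using has_integral_integral_lborel[of "normal_density 0 \<sigma>"] \<sigma>(1) by simp
  from has_integral_mult_right[OF this, of "sqrt (pi / c)"]
  have "((\<lambda>x. sqrt (pi / c) * normal_density 0 \<sigma> x) has_integral sqrt (pi / c)) UNIV" by simp
  moreover have "sqrt (pi / c) * normal_density 0 \<sigma> x = exp (- (c * x\<^sup>2))" for x
    using assms by (simp add: normal_density_def \<sigma>(2) real_sqrt_divide mult.commute)
  ultimately show ?thesis by simp
qed

text \<open>Outside [-b, b] half of the exponent y x^2/2 is at least y/8, as b^2 >= 1/2; the other
  half is again a Gaussian.\<close>

lemma gauss_interval:
  assumes "y > 0" "b > 0" "b\<^sup>2 \<ge> 1 / 2"
  shows "\<bar>integral {-b..b} (\<lambda>x. exp (- (y / 2 * x\<^sup>2))) - sqrt (2 * pi / y)\<bar> \<le> exp (- y / 8) * sqrt (4 * pi / y)"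
proof -
  define g where "g = (\<lambda>x::real. exp (- (y / 2 * x\<^sup>2)))"
  have U: "(g has_integral sqrt (2 * pi / y)) UNIV"
    using gauss_has_integral[of "y / 2"] assms by (simp add: g_def mult.commute)
  have V: "((\<lambda>x. exp (- y / 8) * exp (- (y / 4 * x\<^sup>2))) has_integral exp (- y / 8) * sqrt (4 * pi / y)) UNIV"
  proof -
    have "y / 4 > 0" "pi / (y / 4) = 4 * pi / y" using assms by auto
    then show ?thesis
      using has_integral_mult_right[OF gauss_has_integral[of "y / 4"], of "exp (- y / 8)"] by (simp only:)
  qed
  have "(g has_integral integral {-b..b} g) {-b..b}"
    unfolding g_def by (intro integrable_integral integrable_continuous_interval continuous_intros)
  then have "((\<lambda>x. if x \<in> {-b..b} then g x else 0) has_integral integral {-b..b} g) UNIV"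
    by (simp only: has_integral_restrict_UNIV)
  from has_integral_diff[OF U this]
  have D: "((\<lambda>x. g x - (if x \<in> {-b..b} then g x else 0)) has_integral
      (sqrt (2 * pi / y) - integral {-b..b} g)) UNIV" .
  have "0 \<le> sqrt (2 * pi / y) - integral {-b..b} g"
    by (rule has_integral_nonneg[OF D]) (auto simp: g_def)
  moreover have "sqrt (2 * pi / y) - integral {-b..b} g \<le> exp (- y / 8) * sqrt (4 * pi / y)"
  proof (rule has_integral_le[OF D V])
    fix x
    show "g x - (if x \<in> {-b..b} then g x else 0) \<le> exp (- y / 8) * exp (- (y / 4 * x\<^sup>2))"
    proof (cases "x \<in> {-b..b}")
      case False
      then have "b \<le> \<bar>x\<bar>" by auto
      then have "b\<^sup>2 \<le> \<bar>x\<bar>\<^sup>2" using assms by (intro power_mono) auto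
      then have "y / 4 * (1 / 2) \<le> y / 4 * x\<^sup>2" using assms by (intro mult_left_mono) auto
      then have "g x \<le> exp (- y / 8) * exp (- (y / 4 * x\<^sup>2))"
        by (simp add: g_def exp_add[symmetric])
      with False show ?thesis by simp
    qed simp
  qed
  ultimately show ?thesis unfolding g_def by linarith
qed

lemma gauss_primitive_exists:
  obtains E :: "complex \<Rightarrow> complex" where "\<And>z. (E has_field_derivative exp (of_real (y / 2) * z\<^sup>2)) (at z)"
proof -
  have hol: "(\<lambda>z::complex. exp (of_real (y / 2) * z\<^sup>2)) holomorphic_on UNIV"
    by (intro holomorphic_intros)
  show thesis
  proof (rule holomorphic_convex_primitive'[OF convex_UNIV open_UNIV hol])
    fix g :: "complex \<Rightarrow> complex"
    assume "\<And>z. z \<in> UNIV \<Longrightarrow> (g has_field_derivative exp (of_real (y / 2) * z\<^sup>2)) (at z within UNIV)"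
    then show thesis using that[of g] by simp
  qed
qed

text \<open>With a primitive in place of contour integrals, a deformation of the path is a splitting
  of a difference of values of \<open>E\<close>.\<close>

locale gauss_primitive =
  fixes y :: real and E :: "complex \<Rightarrow> complex"
  assumes y: "y \<ge> 1"
    and E: "\<And>z. (E has_field_derivative exp (of_real (y / 2) * z\<^sup>2)) (at z)"
begin

lemma diff_le:
  assumes "\<And>z. z \<in> closed_segment a b \<Longrightarrow> (Re z)\<^sup>2 - (Im z)\<^sup>2 \<le> m"
  shows "norm (E b - E a) \<le> exp (y / 2 * m) * norm (b - a)"
proof (rule field_differentiable_bound[where S = "closed_segment a b"])
  fix z assume z: "z \<in> closed_segment a b"
  show "(E has_field_derivative exp (of_real (y / 2) * z\<^sup>2)) (at z within closed_segment a b)"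
    by (rule has_field_derivative_at_within[OF E])
  have "norm (exp (of_real (y / 2) * z\<^sup>2)) = exp (y / 2 * ((Re z)\<^sup>2 - (Im z)\<^sup>2))"
    by (simp add: norm_exp_eq_Re power2_eq_square)
  also have "\<dots> \<le> exp (y / 2 * m)"
    using mult_left_mono[OF assms[OF z], of "y / 2"] y by simp
  finally show "norm (exp (of_real (y / 2) * z\<^sup>2)) \<le> exp (y / 2 * m)" .
qed auto

lemma imaginary_axis:
  assumes "b > 0"
  shows "E (\<i> * of_real b) - E (- (\<i> * of_real b)) = \<i> * of_real (integral {-b..b} (\<lambda>x. exp (- (y / 2 * x\<^sup>2))))"
proof -
  have A: "((\<lambda>x. \<i> * of_real (exp (- (y / 2 * x\<^sup>2)))) has_integral (E (\<i> * of_real b) - E (\<i> * of_real (- b)))) {-b..b}"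
  proof (rule fundamental_theorem_of_calculus)
    fix x :: real assume "x \<in> {-b..b}"
    have "((\<lambda>x. \<i> * complex_of_real x) has_vector_derivative \<i>) (at x within {-b..b})"
      by (auto intro!: derivative_eq_intros)
    from field_vector_diff_chain_within[OF this has_field_derivative_at_within[OF E]]
    have "((E \<circ> (\<lambda>x. \<i> * complex_of_real x)) has_vector_derivative
        \<i> * exp (of_real (y / 2) * (\<i> * of_real x)\<^sup>2)) (at x within {-b..b})" .
    moreover have "of_real (y / 2) * (\<i> * of_real x)\<^sup>2 = complex_of_real (- (y / 2 * x\<^sup>2))"
      by (simp add: power_mult_distrib)
    ultimately show "((\<lambda>x. E (\<i> * complex_of_real x)) has_vector_derivative
        \<i> * of_real (exp (- (y / 2 * x\<^sup>2)))) (at x within {-b..b})"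
      by (simp only: exp_of_real o_def)
  qed (use assms in simp)
  have "((\<lambda>x. exp (- (y / 2 * x\<^sup>2))) has_integral integral {-b..b} (\<lambda>x. exp (- (y / 2 * x\<^sup>2)))) {-b..b}"
    by (intro integrable_integral integrable_continuous_interval continuous_intros)
  then have B: "((\<lambda>x. \<i> * of_real (exp (- (y / 2 * x\<^sup>2)))) has_integral
      \<i> * of_real (integral {-b..b} (\<lambda>x. exp (- (y / 2 * x\<^sup>2))))) {-b..b}"
    by (rule has_integral_mult_right[OF has_integral_of_real])
  show ?thesis using has_integral_unique[OF A B] by simp
qed

lemma cnj_segment:
  assumes "z \<in> closed_segment (cnj w) w"
  shows "Re z = Re w"
proof -
  from assms obtain u where "z = (1 - u) *\<^sub>R cnj w + u *\<^sub>R w" unfolding closed_segment_def by blast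
  then have "Re z = (1 - u) * Re w + u * Re w" by simp
  then show ?thesis by (simp add: left_diff_distrib)
qed

text \<open>For w = sqrt t + 1/sqrt t at t = 1 + i, where w^2 = t + 1/t + 2. On the vertical segment
  the integrand is at most e^(y |w|^2/2), and |w|^2 = sqrt (25/2) < 18/5; the factor e^(-y) in
  \<open>Jint_half\<close> leaves e^(4y/5).\<close>

lemma diff_cnj_small:
  assumes "w\<^sup>2 = Complex (7 / 2) (1 / 2)"
  shows "norm (E w - E (cnj w)) \<le> 4 * exp (9 / 5 * y)"
proof -
  have "norm w ^ 2 = norm (Complex (7 / 2) (1 / 2))" by (simp only: assms[symmetric] norm_power)
  also have "\<dots> = sqrt (25 / 2)" by (simp add: cmod_def power2_eq_square)
  also have "\<dots> \<le> 18 / 5" by (rule real_le_lsqrt) (auto simp: power2_eq_square)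
  finally have n: "norm w ^ 2 \<le> 18 / 5" .
  have "norm w \<le> 2" by (rule power2_le_imp_le) (use n in auto)
  have "norm (E w - E (cnj w)) \<le> exp (y / 2 * (18 / 5)) * norm (w - cnj w)"
  proof (rule diff_le)
    fix z assume "z \<in> closed_segment (cnj w) w"
    then have eq: "Re z = Re w" by (rule cnj_segment)
    have "(Re w)\<^sup>2 \<le> norm w ^ 2" by (simp add: cmod_power2)
    then show "(Re z)\<^sup>2 - (Im z)\<^sup>2 \<le> 18 / 5" unfolding eq using n zero_le_power2[of "Im z"] by linarith
  qed
  also have "norm (w - cnj w) \<le> 4"
    using norm_triangle_ineq4[of w "cnj w"] \<open>norm w \<le> 2\<close> by simp
  finally show ?thesis by (simp add: mult.commute)
qed

text \<open>For v = sqrt t - 1/sqrt t at t = 1 + i. The path from cnj v to v is moved to the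
  imaginary axis, where the integrand is a real Gaussian; on the horizontal connections Re z^2 <= Re
  v^2 = -1/2.\<close>

lemma diff_cnj_main:
  assumes v: "v\<^sup>2 = Complex (- 1 / 2) (1 / 2)" "Im v > 0"
  shows "norm (E v - E (cnj v) - \<i> * of_real (sqrt (2 * pi / y))) \<le> 6 * exp (- y / 8)"
proof -
  define x b where "x = Re v" and "b = Im v"
  have sq: "x\<^sup>2 - b\<^sup>2 = - 1 / 2"
    using v(1) by (auto simp: complex_eq_iff power2_eq_square x_def b_def)
  have "norm v ^ 2 = norm (Complex (- 1 / 2) (1 / 2))" by (simp only: v(1)[symmetric] norm_power)
  also have "\<dots> = sqrt (1 / 2)" by (simp add: cmod_def power2_eq_square)
  also have "\<dots> \<le> 1" by simp
  finally have "norm v \<le> 1" by (simp add: power2_le_iff_abs_le abs_square_le_1)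
  then have x1: "\<bar>x\<bar> \<le> 1" using abs_Re_le_cmod[of v] by (simp add: x_def)
  have horiz: "norm (E (Complex x c) - E (\<i> * of_real c)) \<le> exp (- y / 4)" if "c\<^sup>2 = b\<^sup>2" for c
  proof -
    have "norm (E (Complex x c) - E (\<i> * of_real c)) \<le> exp (y / 2 * (- 1 / 2)) * norm (Complex x c - \<i> * of_real c)"
    proof (rule diff_le)
      fix z assume "z \<in> closed_segment (\<i> * of_real c) (Complex x c)"
      then obtain u where u: "0 \<le> u" "u \<le> 1" "z = (1 - u) *\<^sub>R (\<i> * of_real c) + u *\<^sub>R Complex x c"
        unfolding closed_segment_def by blast
      have "Re z = u * x" "Im z = c" unfolding u(3) by (simp_all add: left_diff_distrib)
      moreover have "(u * x)\<^sup>2 \<le> 1\<^sup>2 * x\<^sup>2"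
        unfolding power_mult_distrib using u by (intro mult_right_mono power_mono) auto
      ultimately show "(Re z)\<^sup>2 - (Im z)\<^sup>2 \<le> - 1 / 2" using sq that by simp
    qed
    also have "Complex x c - \<i> * of_real c = of_real x" by (simp add: complex_eq_iff)
    also have "exp (y / 2 * (- 1 / 2)) * norm (complex_of_real x) \<le> exp (y / 2 * (- 1 / 2)) * 1"
      using x1 by (intro mult_left_mono) auto
    finally show ?thesis by simp
  qed
  have b: "b > 0" "b\<^sup>2 \<ge> 1 / 2" using v(2) sq zero_le_power2[of x] unfolding b_def by linarith+
  define I where "I = integral {-b..b} (\<lambda>x. exp (- (y / 2 * x\<^sup>2)))"
  have I: "E (\<i> * of_real b) - E (- (\<i> * of_real b)) = \<i> * of_real I"
    unfolding I_def by (rule imaginary_axis[OF b(1)])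
  have "norm (\<i> * of_real I - \<i> * of_real (sqrt (2 * pi / y))) = \<bar>I - sqrt (2 * pi / y)\<bar>"
    by (simp only: right_diff_distrib[symmetric] of_real_diff[symmetric] norm_mult norm_of_real) simp
  also have "\<dots> \<le> exp (- y / 8) * sqrt (4 * pi / y)"
    unfolding I_def by (rule gauss_interval[OF _ b]) (use y in simp)
  also have "sqrt (4 * pi / y) \<le> 4"
  proof (rule real_le_lsqrt)
    have "4 * pi / y \<le> 4 * pi / 1" using y by (intro divide_left_mono) auto
    then show "4 * pi / y \<le> 4\<^sup>2" using pi_less_4 by simp
  qed simp
  finally have 3: "norm (\<i> * of_real I - \<i> * of_real (sqrt (2 * pi / y))) \<le> 4 * exp (- y / 8)"
    by (simp add: mult.commute)
  have 1: "norm (E v - E (\<i> * of_real b)) \<le> exp (- y / 4)"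
    using horiz[of b] by (simp add: x_def b_def)
  have 2: "norm (E (cnj v) - E (- (\<i> * of_real b))) \<le> exp (- y / 4)"
  proof -
    have "cnj v = Complex x (- b)" by (simp add: x_def b_def complex_eq_iff)
    then show ?thesis using horiz[of "- b"] by simp
  qed
  have 4: "exp (- y / 4) \<le> exp (- y / 8)" using y by simp
  have "E v - E (cnj v) - \<i> * of_real (sqrt (2 * pi / y))
      = (E v - E (\<i> * of_real b)) - (E (cnj v) - E (- (\<i> * of_real b)))
        + (\<i> * of_real I - \<i> * of_real (sqrt (2 * pi / y)))"
    using I by (simp add: algebra_simps)
  also have "norm \<dots> \<le> (exp (- y / 4) + exp (- y / 4)) + 4 * exp (- y / 8)"
    by (intro norm_triangle_le add_mono order_trans[OF norm_triangle_ineq4] 1 2 3)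
  finally show ?thesis using 4 by linarith
qed

end

lemma csqrt_bline:
  assumes "Re t > 0"
  shows "csqrt t \<noteq> 0" "t powr of_real (- 1 / 2) = 1 / csqrt t" "t powr of_real (- 3 / 2) = 1 / (csqrt t * t)"
    "(csqrt has_field_derivative 1 / (2 * csqrt t)) (at t)"
proof -
  have t: "t \<noteq> 0" "t \<notin> \<real>\<^sub>\<le>\<^sub>0" using assms by (auto simp: complex_nonpos_Reals_iff)
  show nz: "csqrt t \<noteq> 0" using t by simp
  have half: "csqrt t = t powr of_real (1 / 2)" using t by (simp add: csqrt_conv_powr)
  show "t powr of_real (- 1 / 2) = 1 / csqrt t"
    unfolding half using powr_minus[of t "of_real (1 / 2)"] by (simp add: inverse_eq_divide)
  moreover have "t powr of_real (- 3 / 2) = t powr of_real (- 1 / 2 - 1)" by simp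
  then have "t powr of_real (- 3 / 2) = t powr of_real (- 1 / 2) / t" by (simp only: powr_add_one[OF t(1)])
  ultimately show "t powr of_real (- 3 / 2) = 1 / (csqrt t * t)" by simp
  show "(csqrt has_field_derivative 1 / (2 * csqrt t)) (at t)"
    using has_field_derivative_csqrt[OF t(2)] by (simp add: inverse_eq_divide)
qed

lemma csqrt_cnj_bline: "csqrt (bline (- 1)) = cnj (csqrt (bline 1))"
proof -
  have "bline (- 1) = cnj (bline 1)" by (simp add: bline_def complex_eq_iff)
  moreover have "bline 1 \<notin> \<real>\<^sub>\<le>\<^sub>0" by (simp add: complex_nonpos_Reals_iff)
  ultimately show ?thesis using cnj_csqrt by simp
qed

context gauss_primitive
begin

text \<open>The substitution v = sqrt t - \<epsilon>/sqrt t: there v^2 = t + 1/t - 2 \<epsilon> and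
  2 dv = (t^(-1/2) + \<epsilon> t^(-3/2)) dt, so these two combinations are integrals of e^(y
  v^2/2).\<close>

lemma Jint_half:
  assumes "\<epsilon> = 1 \<or> \<epsilon> = - 1"
  defines "G \<equiv> \<lambda>t. E (csqrt t - of_real \<epsilon> / csqrt t)"
  shows "Jint (- 1 / 2) y + of_real \<epsilon> * Jint (- 3 / 2) y
      = - \<i> * (2 * exp (of_real (\<epsilon> * y))) * (G (bline 1) - G (bline (- 1)))"
proof -
  define g where "g = (\<lambda>t. t powr of_real (- 1 / 2) * bker y t + of_real \<epsilon> * (t powr of_real (- 3 / 2) * bker y t))"
  have "((\<lambda>t. 2 * exp (of_real (\<epsilon> * y)) * G t) has_field_derivative g t) (at t)" if t: "Re t > 0" for t
  proof -
    note r = csqrt_bline[OF t]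
    have tnz: "t \<noteq> 0" using t by auto
    have "((\<lambda>t. csqrt t - of_real \<epsilon> / csqrt t) has_field_derivative
        1 / (2 * csqrt t) - (0 * csqrt t - of_real \<epsilon> * (1 / (2 * csqrt t))) / (csqrt t * csqrt t)) (at t)"
      by (rule DERIV_diff[OF r(4) DERIV_divide[OF DERIV_const r(4) r(1)]])
    from DERIV_chain2[OF E this]
    have "(G has_field_derivative exp (of_real (y / 2) * (csqrt t - of_real \<epsilon> / csqrt t)\<^sup>2) *
        (1 / (2 * csqrt t) - (0 * csqrt t - of_real \<epsilon> * (1 / (2 * csqrt t))) / (csqrt t * csqrt t))) (at t)"
      unfolding G_def .
    from DERIV_cmult[OF this, of "2 * exp (of_real (\<epsilon> * y))"] show ?thesis
    proof (rule DERIV_cong)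
      have rr: "csqrt t * csqrt t = t" using power2_csqrt[of t] by (simp add: power2_eq_square)
      have "(csqrt t - of_real \<epsilon> / csqrt t)\<^sup>2 = t + 1 / t - of_real (2 * \<epsilon>)"
      proof -
        have "(csqrt t - of_real \<epsilon> / csqrt t)\<^sup>2 = csqrt t * csqrt t + of_real \<epsilon> * of_real \<epsilon> / (csqrt t * csqrt t) - 2 * of_real \<epsilon>"
          using r(1) by (simp add: power2_eq_square field_simps)
        then show ?thesis unfolding rr using assms(1) by auto
      qed
      then have "of_real (\<epsilon> * y) + of_real (y / 2) * (csqrt t - of_real \<epsilon> / csqrt t)\<^sup>2 = of_real (y / 2) * (t + 1 / t)"
        by (simp only:) (simp add: algebra_simps)
      then have K: "exp (of_real (\<epsilon> * y)) * exp (of_real (y / 2) * (csqrt t - of_real \<epsilon> / csqrt t)\<^sup>2) = bker y t"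
        by (simp only: exp_add[symmetric] bker_def)
      have P: "2 * (1 / (2 * csqrt t) - (0 * csqrt t - of_real \<epsilon> * (1 / (2 * csqrt t))) / (csqrt t * csqrt t))
          = t powr of_real (- 1 / 2) + of_real \<epsilon> * t powr of_real (- 3 / 2)"
        unfolding r(2,3) rr using r(1) tnz by (simp add: field_simps)
      show "2 * exp (of_real (\<epsilon> * y)) * (exp (of_real (y / 2) * (csqrt t - of_real \<epsilon> / csqrt t)\<^sup>2) *
        (1 / (2 * csqrt t) - (0 * csqrt t - of_real \<epsilon> * (1 / (2 * csqrt t))) / (csqrt t * csqrt t))) = g t"
        (is "2 * ?a * (?b * ?c) = _")
      proof -
        have "2 * ?a * (?b * ?c) = (?a * ?b) * (2 * ?c)" by (simp only: mult_ac)
        then show ?thesis unfolding K P g_def by (simp add: algebra_simps)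
      qed
    qed
  qed
  from has_integral_bline[OF this]
  have "((\<lambda>u. g (bline u)) has_integral - \<i> * (2 * exp (of_real (\<epsilon> * y)) * G (bline 1)
      - 2 * exp (of_real (\<epsilon> * y)) * G (bline (- 1)))) {-1..1}" .
  moreover have "((\<lambda>u. g (bline u)) has_integral (Jint (- 1 / 2) y + of_real \<epsilon> * Jint (- 3 / 2) y)) {-1..1}"
    unfolding g_def by (intro has_integral_add has_integral_mult_right Jint_has_integral)
  ultimately have "Jint (- 1 / 2) y + of_real \<epsilon> * Jint (- 3 / 2) y
      = - \<i> * (2 * exp (of_real (\<epsilon> * y)) * G (bline 1) - 2 * exp (of_real (\<epsilon> * y)) * G (bline (- 1)))"
    using has_integral_unique by blast
  then show ?thesis by (simp only: right_diff_distrib mult.assoc)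
qed

text \<open>For the sum, sinh y + cosh y = e^y matches the Gaussian integral of the substitution
  with sign 1. For the difference, sinh y - cosh y = -e^(-y), and both sides are negligible.\<close>

lemma Jint_half_asymp:
  "norm (Jint (- 1 / 2) y + Jint (- 3 / 2) y - of_real (2 * pi * (bessel_I (1 / 2) y + bessel_I (- 1 / 2) y)))
     \<le> 12 * exp (9 / 10 * y)"
  "norm (Jint (- 1 / 2) y - Jint (- 3 / 2) y - of_real (2 * pi * (bessel_I (1 / 2) y - bessel_I (- 1 / 2) y)))
     \<le> 14 * exp (9 / 10 * y)"
proof -
  have y0: "y > 0" using y by simp
  define t where "t = bline 1"
  have t: "Re t > 0" "t \<noteq> 0" by (simp_all add: t_def)
  define r where "r = csqrt t"
  have r: "r \<noteq> 0" "r * r = t" using t power2_csqrt[of t] by (auto simp: r_def power2_eq_square)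
  have rc: "csqrt (bline (- 1)) = cnj r" by (simp add: r_def t_def csqrt_cnj_bline)
  have inv: "1 / t = Complex (1 / 2) (- 1 / 2)"
    by (simp add: t_def bline_def complex_eq_iff Re_divide Im_divide power2_eq_square)
  have sq: "(r - of_real \<epsilon> / r)\<^sup>2 = t + of_real \<epsilon> * of_real \<epsilon> * (1 / t) - of_real (2 * \<epsilon>)" for \<epsilon>
    unfolding r(2)[symmetric] using r(1) by (simp add: power2_eq_square field_simps)
  have beta: "2 * pi * sqrt (2 / (pi * y)) = 2 * sqrt (2 * pi / y)"
  proof -
    have "2 * pi / y = pi\<^sup>2 * (2 / (pi * y))" using y by (simp add: field_simps power2_eq_square)
    then have "sqrt (2 * pi / y) = pi * sqrt (2 / (pi * y))"
      by (simp only: real_sqrt_mult) simp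
    then show ?thesis by simp
  qed
  show "norm (Jint (- 1 / 2) y + Jint (- 3 / 2) y - of_real (2 * pi * (bessel_I (1 / 2) y + bessel_I (- 1 / 2) y)))
     \<le> 12 * exp (9 / 10 * y)"
  proof -
    define v where "v = r - 1 / r"
    have v2: "v\<^sup>2 = Complex (- 1 / 2) (1 / 2)"
      using sq[of 1] inv by (simp add: v_def t_def bline_def complex_eq_iff)
    have "Im r > 0"
    proof -
      have "2 * (Re r * Im r) = Im t" unfolding r(2)[symmetric] by simp
      then have "Re r * Im r > 0" by (simp add: t_def)
      moreover have "Re r \<ge> 0" unfolding r_def by (rule Re_csqrt)
      ultimately show ?thesis by (auto simp: zero_less_mult_iff)
    qed
    then have "Im v > 0"
      unfolding v_def by (simp add: Im_divide add_pos_nonneg)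
    from diff_cnj_main[OF v2 this]
    have le: "norm (E v - E (cnj v) - \<i> * of_real (sqrt (2 * pi / y))) \<le> 6 * exp (- y / 8)" .
    have J: "Jint (- 1 / 2) y + Jint (- 3 / 2) y = - \<i> * (2 * exp (of_real y)) * (E v - E (cnj v))"
      using Jint_half[of 1] by (simp add: rc r_def[symmetric] t_def[symmetric] v_def)
    have "2 * pi * (bessel_I (1 / 2) y + bessel_I (- 1 / 2) y) = 2 * pi * sqrt (2 / (pi * y)) * exp y"
      unfolding bessel_I_half[OF y0] by (simp add: sinh_field_def cosh_field_def field_simps)
    also have "\<dots> = 2 * exp y * sqrt (2 * pi / y)" unfolding beta by simp
    finally have "Jint (- 1 / 2) y + Jint (- 3 / 2) y - of_real (2 * pi * (bessel_I (1 / 2) y + bessel_I (- 1 / 2) y))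
        = - \<i> * (2 * exp (of_real y)) * (E v - E (cnj v) - \<i> * of_real (sqrt (2 * pi / y)))"
      unfolding J by (simp add: exp_of_real algebra_simps)
    also have "norm \<dots> = 2 * exp y * norm (E v - E (cnj v) - \<i> * of_real (sqrt (2 * pi / y)))"
      by (simp add: norm_mult)
    also have "\<dots> \<le> 2 * exp y * (6 * exp (- y / 8))" by (intro mult_left_mono le) simp
    also have "\<dots> = 12 * exp (7 / 8 * y)" by (simp add: exp_add[symmetric])
    \<comment> \<open>The common exponent 9/10 exceeds all that occur: 7/8 here, 4/5 in the other
      combination and 3/4 in the recurrence.\<close>
    also have "\<dots> \<le> 12 * exp (9 / 10 * y)" using y by simp
    finally show ?thesis .
  qed
  show "norm (Jint (- 1 / 2) y - Jint (- 3 / 2) y - of_real (2 * pi * (bessel_I (1 / 2) y - bessel_I (- 1 / 2) y)))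
     \<le> 14 * exp (9 / 10 * y)"
  proof -
    define w where "w = r + 1 / r"
    have w2: "w\<^sup>2 = Complex (7 / 2) (1 / 2)"
      using sq[of "- 1"] inv by (simp add: w_def t_def bline_def complex_eq_iff)
    have J: "Jint (- 1 / 2) y - Jint (- 3 / 2) y = - \<i> * (2 * exp (- of_real y)) * (E w - E (cnj w))"
      using Jint_half[of "- 1"] by (simp add: rc r_def[symmetric] t_def[symmetric] w_def)
    have "norm (Jint (- 1 / 2) y - Jint (- 3 / 2) y) = 2 * exp (- y) * norm (E w - E (cnj w))"
      unfolding J by (simp add: norm_mult)
    also have "\<dots> \<le> 2 * exp (- y) * (4 * exp (9 / 5 * y))"
      by (intro mult_left_mono diff_cnj_small w2) simp
    also have "\<dots> = 8 * exp (4 / 5 * y)" by (simp add: exp_add[symmetric])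
    also have "\<dots> \<le> 8 * exp (9 / 10 * y)" using y by simp
    finally have 1: "norm (Jint (- 1 / 2) y - Jint (- 3 / 2) y) \<le> 8 * exp (9 / 10 * y)" .
    have "2 * pi * (bessel_I (1 / 2) y - bessel_I (- 1 / 2) y) = - (2 * pi * sqrt (2 / (pi * y)) * exp (- y))"
      unfolding bessel_I_half[OF y0] by (simp add: sinh_field_def cosh_field_def field_simps)
    also have "\<bar>\<dots>\<bar> = 2 * sqrt (2 * pi / y) * exp (- y)" unfolding beta using y by (simp add: abs_mult)
    also have "\<dots> \<le> 2 * 3 * 1"
    proof (intro mult_mono)
      have "2 * pi / y \<le> 2 * pi / 1" using y by (intro divide_left_mono) auto
      then show "sqrt (2 * pi / y) \<le> 3" using pi_less_4 by (intro real_le_lsqrt) auto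
    qed (use y in auto)
    also have "\<dots> \<le> 6 * exp (9 / 10 * y)" using y by simp
    finally have 2: "\<bar>2 * pi * (bessel_I (1 / 2) y - bessel_I (- 1 / 2) y)\<bar> \<le> 6 * exp (9 / 10 * y)" .
    then have "norm (complex_of_real (2 * pi * (bessel_I (1 / 2) y - bessel_I (- 1 / 2) y))) \<le> 6 * exp (9 / 10 * y)"
      by (simp only: norm_of_real)
    with 1 show ?thesis by (intro order_trans[OF norm_triangle_ineq4]) linarith
  qed
qed

end

text \<open>The order is a + 1, not the -a - 1 of Schlaefli's integral. The two Bessel functions
  differ by a multiple of the K-function of order a + 1, which decays like e^(-y).\<close>

definition Jint_good :: "real \<Rightarrow> bool" where
  "Jint_good a \<longleftrightarrow> (\<exists>C. \<forall>y\<ge>1. norm (Jint a y - of_real (2 * pi * bessel_I (a + 1) y)) \<le> C * exp (9 / 10 * y))"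

lemma Jint_good_half: "Jint_good (- 1 / 2)" "Jint_good (- 3 / 2)"
proof -
  have bounds: "norm (Jint (- 1 / 2) y - of_real (2 * pi * bessel_I (1 / 2) y)) \<le> 13 * exp (9 / 10 * y)
    \<and> norm (Jint (- 3 / 2) y - of_real (2 * pi * bessel_I (- 1 / 2) y)) \<le> 13 * exp (9 / 10 * y)"
    if y: "y \<ge> 1" for y
  proof -
    obtain E :: "complex \<Rightarrow> complex"
      where "\<And>z. (E has_field_derivative exp (of_real (y / 2) * z\<^sup>2)) (at z)"
      by (rule gauss_primitive_exists[of y]) (rule that)
    then interpret gauss_primitive y E using y by unfold_locales auto
    define a b where "a = Jint (- 1 / 2) y - of_real (2 * pi * bessel_I (1 / 2) y)"
      and "b = Jint (- 3 / 2) y - of_real (2 * pi * bessel_I (- 1 / 2) y)"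
    have 1: "norm (a + b) \<le> 12 * exp (9 / 10 * y)"
      using Jint_half_asymp(1) by (simp add: a_def b_def algebra_simps)
    have 2: "norm (a - b) \<le> 14 * exp (9 / 10 * y)"
      using Jint_half_asymp(2) by (simp add: a_def b_def algebra_simps)
    have "norm (2 * a) \<le> norm (a + b) + norm (a - b)" using norm_triangle_ineq[of "a + b" "a - b"] by simp
    moreover have "norm (2 * b) \<le> norm (a + b) + norm (a - b)" using norm_triangle_ineq4[of "a + b" "a - b"] by simp
    ultimately show ?thesis using 1 2 unfolding a_def[symmetric] b_def[symmetric] norm_mult by simp
  qed
  then show "Jint_good (- 1 / 2)" "Jint_good (- 3 / 2)"
    unfolding Jint_good_def by (auto intro!: exI[of _ 13])
qed

text \<open>The integrals and 2 pi times the Bessel functions obey the same three-term recurrence up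
  to O(e^(3y/4)), so two neighbouring errors control the next, in either direction.\<close>

lemma Jint_good_step:
  assumes "Jint_good a" and "Jint_good b" and "b = a + 1 \<and> c = a - 1 \<or> b = a - 1 \<and> c = a + 1"
  shows "Jint_good c"
proof -
  obtain A where A: "\<And>y. y \<ge> 1 \<Longrightarrow> norm (Jint a y - of_real (2 * pi * bessel_I (a + 1) y)) \<le> A * exp (9 / 10 * y)"
    using assms(1) by (auto simp: Jint_good_def)
  obtain B where B: "\<And>y. y \<ge> 1 \<Longrightarrow> norm (Jint b y - of_real (2 * pi * bessel_I (b + 1) y)) \<le> B * exp (9 / 10 * y)"
    using assms(2) by (auto simp: Jint_good_def)
  define R where "R = 2 * sqrt 2 powr (a + 1)"
  have R: "R \<ge> 0" by (simp add: R_def)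
  have "norm (Jint c y - of_real (2 * pi * bessel_I (c + 1) y)) \<le> (B + 2 * \<bar>a + 1\<bar> * A + 2 * R) * exp (9 / 10 * y)"
    if y: "y \<ge> 1" for y
  proof -
    define e where "e = (\<lambda>a. Jint a y - of_real (2 * pi * bessel_I (a + 1) y))"
    define r where "r = of_real (a + 1) * Jint a y + of_real (y / 2) * (Jint (a + 1) y - Jint (a - 1) y)"
    have "bessel_I (a + 1 - 1) y - bessel_I (a + 1 + 1) y = 2 * (a + 1) / y * bessel_I (a + 1) y"
      by (rule bessel_I_rec) (use y in simp)
    then have I: "bessel_I (a - 1 + 1) y - bessel_I (a + 1 + 1) y = 2 * (a + 1) / y * bessel_I (a + 1) y" by simp
    have "(a + 1) * bessel_I (a + 1) y + y / 2 * (bessel_I (a + 1 + 1) y - bessel_I (a - 1 + 1) y)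
        = (a + 1) * bessel_I (a + 1) y - y / 2 * (bessel_I (a - 1 + 1) y - bessel_I (a + 1 + 1) y)"
      by (simp only: right_diff_distrib)
    also have "\<dots> = 0" unfolding I using y by simp
    finally have I0: "(a + 1) * bessel_I (a + 1) y + y / 2 * (bessel_I (a + 1 + 1) y - bessel_I (a - 1 + 1) y) = 0" .
    have "r - (of_real (a + 1) * e a + of_real (y / 2) * (e (a + 1) - e (a - 1)))
        = of_real (2 * pi * ((a + 1) * bessel_I (a + 1) y + y / 2 * (bessel_I (a + 1 + 1) y - bessel_I (a - 1 + 1) y)))"
      by (simp add: r_def e_def algebra_simps)
    then have r: "r = of_real (a + 1) * e a + of_real (y / 2) * (e (a + 1) - e (a - 1))"
      unfolding I0 by simp
    have rle: "norm r \<le> R * exp (9 / 10 * y)"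
    proof -
      have "norm r \<le> R * exp (3 / 4 * y)" unfolding r_def R_def by (rule Jint_rec)
      also have "\<dots> \<le> R * exp (9 / 10 * y)" using R y by (intro mult_left_mono) auto
      finally show ?thesis .
    qed
    have ce: "norm (e c) \<le> norm (e b) + 2 * \<bar>a + 1\<bar> * norm (e a) + 2 * norm r"
    proof -
      have "complex_of_real (2 / y) * (of_real (y / 2) * X) = X" for X using y by simp
      from this[of "e (a + 1) - e (a - 1)"]
      have "of_real (2 / y) * (r - of_real (a + 1) * e a) = e (a + 1) - e (a - 1)"
        unfolding r by (simp only: add_diff_cancel_left')
      then have "norm (e c - e b) = norm (of_real (2 / y) * (r - of_real (a + 1) * e a))"
        using assms(3) by (auto simp: norm_minus_commute)
      also have "\<dots> = 2 / y * norm (r - of_real (a + 1) * e a)"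
        unfolding norm_mult norm_of_real using y by simp
      also have "\<dots> \<le> 2 * norm (r - of_real (a + 1) * e a)"
        using y by (intro mult_right_mono) (auto simp: divide_le_eq)
      also have "\<dots> \<le> 2 * (norm r + \<bar>a + 1\<bar> * norm (e a))"
        by (intro mult_left_mono order_trans[OF norm_triangle_ineq4]) (simp_all add: norm_mult del: of_real_add)
      finally have "norm (e c - e b) \<le> 2 * (norm r + \<bar>a + 1\<bar> * norm (e a))" .
      moreover have "norm (e c) \<le> norm (e b) + norm (e c - e b)" using norm_triangle_sub by blast
      ultimately show ?thesis by (simp add: algebra_simps)
    qed
    have "2 * \<bar>a + 1\<bar> * norm (e a) \<le> 2 * \<bar>a + 1\<bar> * (A * exp (9 / 10 * y))"
      using A[OF y] unfolding e_def by (intro mult_left_mono) auto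
    with ce rle B[OF y] have "norm (e c) \<le> B * exp (9 / 10 * y) + 2 * \<bar>a + 1\<bar> * (A * exp (9 / 10 * y)) + 2 * (R * exp (9 / 10 * y))"
      unfolding e_def by linarith
    then show ?thesis unfolding e_def by (simp add: algebra_simps)
  qed
  then show ?thesis unfolding Jint_good_def by blast
qed

lemma Jint_good: "Jint_good (1 / 2 - real m)"
proof -
  \<comment> \<open>The one step upwards from the base cases; the value 1/2 - 2k for k = 0 lies
    here.\<close>
  have 1: "Jint_good (1 / 2)"
    by (rule Jint_good_step[OF Jint_good_half]) simp
  have "Jint_good (1 / 2 - real m) \<and> Jint_good (- 1 / 2 - real m)"
  proof (induction m)
    case (Suc m)
    have "Jint_good (- 1 / 2 - real (Suc m))"
      by (rule Jint_good_step[of "- 1 / 2 - real m" "1 / 2 - real m"]) (use Suc in auto)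
    moreover have "1 / 2 - real (Suc m) = - 1 / 2 - real m" by simp
    ultimately show ?case using Suc by simp
  qed (use 1 Jint_good_half in simp)
  then show ?thesis ..
qed

section \<open>The constants in the expansion\<close>

lemma fps_conv_radius_ge_1:
  fixes F :: "complex fps"
  assumes "\<And>x::real. 0 < x \<Longrightarrow> x < 1 \<Longrightarrow> summable (\<lambda>n. norm (F $ n) * x ^ n)"
  shows "fps_conv_radius F \<ge> 1"
  unfolding fps_conv_radius_def
proof (rule conv_radius_geI_ex')
  fix r :: real assume r: "0 < r" "ereal r < 1"
  then have "summable (\<lambda>n. norm (F $ n) * r ^ n)" by (intro assms) auto
  then show "summable (\<lambda>n. F $ n * of_real r ^ n)"
    using r by (intro summable_norm_cancel[of "\<lambda>n. _ n * _ n"]) (simp add: norm_mult norm_power)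
qed

lemma eval_fps_sums:
  fixes F :: "complex fps"
  assumes "fps_conv_radius F \<ge> 1" "norm z < 1"
  shows "(\<lambda>n. F $ n * z ^ n) sums eval_fps F z"
proof -
  have "ereal (norm z) < fps_conv_radius F" using assms by (meson ereal_less(3) less_le_trans)
  then show ?thesis unfolding eval_fps_def by (intro summable_sums summable_fps)
qed

section \<open>The quotient sin (pi z)/(pi z) as a series in z^2, and its logarithm\<close>

definition sinq_coef :: "nat \<Rightarrow> real" where
  "sinq_coef j = (-1) ^ j * pi ^ (2 * j) / fact (2 * j + 1)"

definition sinq_fps :: "complex fps" where
  "sinq_fps = Abs_fps (\<lambda>j. of_real (sinq_coef j))"

text \<open>By the sine product, minus the logarithm of the quotient: the sum over m >= 1 of -ln (1
  - Y/m^2) with Y = z^2. Division by 0 makes the constant coefficient 0, as it must be.\<close>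

definition zeta_fps :: "complex fps" where
  "zeta_fps = Abs_fps (\<lambda>l. of_real (zeta (2 * l) / real l))"

lemma sinq_sums:
  fixes z :: complex
  assumes "z \<noteq> 0"
  shows "(\<lambda>j. of_real (sinq_coef j) * (z\<^sup>2) ^ j) sums (sin (of_real pi * z) / (of_real pi * z))"
proof -
  define w where "w = of_real pi * z"
  have w: "w \<noteq> 0" using assms by (simp add: w_def)
  have "(\<lambda>j. (\<lambda>n. sin_coeff n *\<^sub>R w ^ n) (2 * j + 1)) sums sin w"
    by (rule sums_mono_reindex[THEN iffD2, OF _ _ sin_converges])
       (auto simp: strict_mono_def sin_coeff_def elim!: oddE)
  from sums_divide[OF this, of w]
  have "(\<lambda>j. sin_coeff (2 * j + 1) *\<^sub>R w ^ (2 * j + 1) / w) sums (sin w / w)" by simp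
  moreover have "sin_coeff (2 * j + 1) *\<^sub>R w ^ (2 * j + 1) / w = of_real (sinq_coef j) * (z\<^sup>2) ^ j" for j
    using w by (simp add: sin_coeff_def sinq_coef_def scaleR_conv_of_real w_def power_mult_distrib
        power_mult[symmetric] mult.commute[of j])
  ultimately show ?thesis unfolding w_def by simp
qed

text \<open>At z = i sqrt x the alternating signs cancel against those of (z^2)^j, so the series
  converging there is the series of absolute values.\<close>

lemma sinq_conv_radius: "fps_conv_radius sinq_fps \<ge> 1"
proof (rule fps_conv_radius_ge_1)
  fix x :: real assume x: "0 < x" "x < 1"
  define z where "z = \<i> * complex_of_real (sqrt x)"
  have "z \<noteq> 0" "z\<^sup>2 = of_real (- x)" using x by (auto simp: z_def power_mult_distrib simp flip: of_real_power)
  from sinq_sums[OF this(1)] have "summable (\<lambda>j. of_real (sinq_coef j) * complex_of_real (- x) ^ j)"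
    unfolding \<open>z\<^sup>2 = _\<close> by (rule sums_summable)
  then have "summable (\<lambda>j. complex_of_real (sinq_coef j * (- x) ^ j))" by simp
  then have "summable (\<lambda>j. sinq_coef j * (- x) ^ j)" by (simp only: summable_of_real_iff)
  moreover have "sinq_coef j * (- x) ^ j = norm (sinq_fps $ j) * x ^ j" for j
  proof -
    have "norm (sinq_fps $ j) = \<bar>sinq_coef j\<bar>" by (simp add: sinq_fps_def)
    also have "\<dots> = pi ^ (2 * j) / fact (2 * j + 1)"
      unfolding sinq_coef_def abs_divide abs_mult power_abs by simp
    finally have n: "norm (sinq_fps $ j) = pi ^ (2 * j) / fact (2 * j + 1)" .
    have m: "(- x) ^ j = (-1) ^ j * x ^ j" using power_mult_distrib[of "-1" x j] by simp
    have "(-1 :: real) ^ j * (-1) ^ j = 1" by (simp flip: power_mult_distrib)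
    moreover have "sinq_coef j * (- x) ^ j = ((-1) ^ j * (-1) ^ j) * (pi ^ (2 * j) / fact (2 * j + 1) * x ^ j)"
      unfolding sinq_coef_def m by (simp only: mult_ac times_divide_eq_left times_divide_eq_right)
    ultimately show ?thesis unfolding n by (simp only: mult_1_left)
  qed
  ultimately show "summable (\<lambda>n. norm (sinq_fps $ n) * x ^ n)" by simp
qed

lemma sinq_product:
  assumes "norm Y < 1"
  shows "(\<lambda>n. \<Prod>m<n. 1 - Y / of_nat (Suc m) ^ 2) \<longlonglongrightarrow> eval_fps sinq_fps Y"
proof (cases "Y = 0")
  case True
  then show ?thesis by (simp add: eval_fps_at_0 sinq_fps_def sinq_coef_def)
next
  case False
  define z where "z = csqrt Y"
  have z: "z \<noteq> 0" "z\<^sup>2 = Y" using False by (auto simp: z_def)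
  have "(\<lambda>n. of_real pi * z * (\<Prod>k=1..n. 1 - z\<^sup>2 / of_nat k ^ 2) / (of_real pi * z))
      \<longlonglongrightarrow> sin (of_real pi * z) / (of_real pi * z)"
    by (intro tendsto_divide sin_product_formula_complex tendsto_const) (use z in auto)
  then have "(\<lambda>n. \<Prod>k=1..n. 1 - z\<^sup>2 / of_nat k ^ 2) \<longlonglongrightarrow> sin (of_real pi * z) / (of_real pi * z)"
    using z by simp
  moreover have "(\<Prod>k=1..n. 1 - z\<^sup>2 / of_nat k ^ 2) = (\<Prod>m<n. 1 - Y / of_nat (Suc m) ^ 2)" for n
    unfolding z(2) by (rule prod.reindex_bij_witness[of _ Suc "\<lambda>k. k - 1"]) auto
  moreover have "sin (of_real pi * z) / (of_real pi * z) = eval_fps sinq_fps Y"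
    using sums_unique2[OF sinq_sums[OF z(1)] ] eval_fps_sums[OF sinq_conv_radius assms]
    by (simp add: z(2) sinq_fps_def)
  ultimately show ?thesis by simp
qed

text \<open>Domination of every tail by the one for exponent 2 is what allows the limit of the
  partial products to be taken uniformly in the exponent.\<close>

lemma zeta_tail:
  assumes "m \<ge> 2"
  shows "0 \<le> zeta m - (\<Sum>e<n. 1 / real (Suc e) ^ m)"
    and "zeta m - (\<Sum>e<n. 1 / real (Suc e) ^ m) \<le> zeta 2 - (\<Sum>e<n. 1 / real (Suc e) ^ 2)"
proof -
  have tail: "zeta m - (\<Sum>e<n. 1 / real (Suc e) ^ m) = (\<Sum>e. 1 / real (Suc (e + n)) ^ m)"
    "summable (\<lambda>e. 1 / real (Suc (e + n)) ^ m)" if "m \<ge> 2" for m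
    using suminf_minus_initial_segment[OF summable_zeta[OF that], of n]
      summable_ignore_initial_segment[OF summable_zeta[OF that], of n]
    by (simp_all add: zeta_def)
  show "0 \<le> zeta m - (\<Sum>e<n. 1 / real (Suc e) ^ m)"
    unfolding tail(1)[OF assms] by (intro suminf_nonneg tail(2)[OF assms]) simp
  show "zeta m - (\<Sum>e<n. 1 / real (Suc e) ^ m) \<le> zeta 2 - (\<Sum>e<n. 1 / real (Suc e) ^ 2)"
    unfolding tail(1)[OF assms] tail(1)[OF order_refl]
    by (intro suminf_le tail(2) assms order_refl divide_left_mono power_increasing) auto
qed

lemma zeta_bounds: "m \<ge> 2 \<Longrightarrow> 0 \<le> zeta m \<and> zeta m \<le> zeta 2"
  using zeta_tail[of m 0] by simp

lemma zeta_conv_radius: "fps_conv_radius zeta_fps \<ge> 1"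
proof (rule fps_conv_radius_ge_1)
  fix x :: real assume x: "0 < x" "x < 1"
  show "summable (\<lambda>n. norm (zeta_fps $ n) * x ^ n)"
  proof (rule summable_comparison_test'[where g = "\<lambda>n. zeta 2 * x ^ n" and N = 0])
    show "summable (\<lambda>n. zeta 2 * x ^ n)" using x by (intro summable_mult summable_geometric) auto
    fix n
    have "norm (zeta_fps $ n) \<le> zeta 2"
    proof (cases "n = 0")
      case False
      then have z: "0 \<le> zeta (2 * n)" "zeta (2 * n) \<le> zeta 2" using zeta_bounds[of "2 * n"] by auto
      have "zeta (2 * n) / real n \<le> zeta (2 * n) / 1"
        using z(1) False by (intro divide_left_mono) auto
      with z show ?thesis by (simp add: zeta_fps_def norm_divide)
    qed (use zeta_bounds[of 2] in \<open>simp add: zeta_fps_def\<close>)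
    then show "norm (norm (zeta_fps $ n) * x ^ n) \<le> zeta 2 * x ^ n"
      using x by (simp add: mult_right_mono)
  qed
qed

text \<open>The logarithm of a finite sine product has the coefficients -H/l, where H is a partial
  sum of zeta(2l). Their distance from the full values is bounded uniformly in l, so the number of
  factors may tend to infinity.\<close>

lemma sinq_eq_exp:
  assumes Y: "norm Y < 1"
  shows "eval_fps sinq_fps Y = exp (- eval_fps zeta_fps Y)"
proof (rule LIMSEQ_unique[OF sinq_product[OF Y]])
  define H where "H = (\<lambda>n l. \<Sum>e<n. 1 / real (Suc e) ^ (2 * l))"
  define W where "W = (\<lambda>n. \<Sum>m<n. Ln (1 - Y / of_nat (Suc m) ^ 2))"
  have le1: "norm (Y / of_nat (Suc m) ^ 2) < 1" for m
  proof -
    have "norm (Y / of_nat (Suc m) ^ 2) \<le> norm Y / 1"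
      unfolding norm_divide norm_power norm_of_nat by (intro divide_left_mono) auto
    with Y show ?thesis by simp
  qed
  have W: "(\<lambda>l. - (of_real (H n l / real l) * Y ^ l)) sums W n" for n
  proof -
    have "(\<lambda>l. - ((- (- (Y / of_nat (Suc m) ^ 2))) ^ l) / of_nat l) sums ln (1 + - (Y / of_nat (Suc m) ^ 2))" for m
      by (rule Ln_series') (use le1[of m] in simp)
    then have "(\<lambda>l. \<Sum>m<n. - ((Y / of_nat (Suc m) ^ 2) ^ l) / of_nat l) sums W n"
      unfolding W_def by (intro sums_sum) (simp del: of_nat_Suc)
    moreover have "(\<Sum>m<n. - ((Y / of_nat (Suc m) ^ 2) ^ l) / of_nat l) = - (of_real (H n l / real l) * Y ^ l)" for l
    proof -
      have "- ((Y / of_nat (Suc m) ^ 2) ^ l) / of_nat l = - (of_real (1 / real (Suc m) ^ (2 * l)) / of_nat l * Y ^ l)" for m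
        by (simp add: power_divide power_mult del: of_nat_Suc)
      then show ?thesis
        by (simp only: H_def sum_negf sum_divide_distrib sum_distrib_right of_real_sum of_real_divide of_real_of_nat_eq)
    qed
    ultimately show ?thesis by simp
  qed
  have Z: "(\<lambda>l. - (of_real (zeta (2 * l) / real l) * Y ^ l)) sums - eval_fps zeta_fps Y"
    using sums_minus[OF eval_fps_sums[OF zeta_conv_radius Y]] by (simp add: zeta_fps_def)
  have geo: "(\<lambda>l. norm Y ^ l) sums (1 / (1 - norm Y))" using Y by (intro geometric_sums) auto
  define T where "T = (\<lambda>n. zeta 2 - (\<Sum>e<n. 1 / real (Suc e) ^ 2))"
  have T0: "T \<longlonglongrightarrow> 0"
  proof -
    have "(\<lambda>n. \<Sum>e<n. 1 / real (Suc e) ^ 2) \<longlonglongrightarrow> zeta 2"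
      unfolding zeta_def by (rule summable_LIMSEQ[OF summable_zeta]) simp
    from tendsto_diff[OF tendsto_const this, of "zeta 2"] show ?thesis by (simp add: T_def)
  qed
  have Tnn: "T n \<ge> 0" for n using zeta_tail(1)[of 2 n] by (simp add: T_def)
  have "norm (W n - - eval_fps zeta_fps Y) \<le> T n * (1 / (1 - norm Y))" for n
  proof -
    define d where "d = (\<lambda>l. of_real ((zeta (2 * l) - H n l) / real l) * Y ^ l)"
    have d: "d sums (W n - - eval_fps zeta_fps Y)"
      using sums_diff[OF W[of n] Z] unfolding d_def
      by (simp add: algebra_simps diff_divide_distrib)
    have dle: "norm (d l) \<le> T n * norm Y ^ l" for l
    proof (cases "l = 0")
      case False
      then have z: "0 \<le> zeta (2 * l) - H n l" "zeta (2 * l) - H n l \<le> T n"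
        using zeta_tail[of "2 * l" n] by (auto simp: H_def T_def)
      have "(zeta (2 * l) - H n l) / real l \<le> (zeta (2 * l) - H n l) / 1"
        using z(1) False by (intro divide_left_mono) auto
      with z have "norm (complex_of_real ((zeta (2 * l) - H n l) / real l)) \<le> T n"
        unfolding norm_of_real by simp
      then show ?thesis unfolding d_def norm_mult norm_power by (intro mult_right_mono) auto
    qed (use Tnn in \<open>simp add: d_def\<close>)
    have s: "summable (\<lambda>l. T n * norm Y ^ l)" using geo by (intro summable_mult sums_summable)
    have sd: "summable (\<lambda>l. norm (d l))"
      by (rule summable_comparison_test'[OF s, where N = 0]) (use dle in auto)
    have "norm (W n - - eval_fps zeta_fps Y) \<le> (\<Sum>l. norm (d l))"
      using summable_norm[OF sd] d by (simp add: sums_iff)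
    also have "\<dots> \<le> (\<Sum>l. T n * norm Y ^ l)" by (rule suminf_le[OF dle sd s])
    also have "\<dots> = T n * (1 / (1 - norm Y))" using sums_mult[OF geo, of "T n"] by (simp add: sums_iff)
    finally show ?thesis .
  qed
  then have "\<forall>\<^sub>F n in sequentially. norm (W n - - eval_fps zeta_fps Y) \<le> T n * (1 / (1 - norm Y))"
    by (intro always_eventually allI)
  then have "(\<lambda>n. W n - - eval_fps zeta_fps Y) \<longlonglongrightarrow> 0"
    by (rule Lim_null_comparison[OF _ tendsto_mult_left_zero[OF T0]])
  then have "W \<longlonglongrightarrow> - eval_fps zeta_fps Y" by (rule LIM_zero_cancel)
  then have "(\<lambda>n. exp (W n)) \<longlonglongrightarrow> exp (- eval_fps zeta_fps Y)" by (intro tendsto_exp)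
  moreover have "exp (W n) = (\<Prod>m<n. 1 - Y / of_nat (Suc m) ^ 2)" for n
  proof -
    have "1 - Y / of_nat (Suc m) ^ 2 \<noteq> 0" for m using le1[of m] by auto
    then show ?thesis unfolding W_def by (simp add: exp_sum del: of_nat_Suc)
  qed
  ultimately show "(\<lambda>n. \<Prod>m<n. 1 - Y / of_nat (Suc m) ^ 2) \<longlonglongrightarrow> exp (- eval_fps zeta_fps Y)" by simp
qed

text \<open>The analytic identity on the unit disc, differentiated and transferred to formal series;
  its coefficients form the recurrence \<open>sinq_coef_rec\<close>.\<close>

lemma sinq_fps_deriv: "fps_deriv sinq_fps = - (fps_deriv zeta_fps * sinq_fps)"
proof (rule eval_fps_eqD)
  have r: "fps_conv_radius sinq_fps \<ge> 1" "fps_conv_radius zeta_fps \<ge> 1"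
    by (rule sinq_conv_radius zeta_conv_radius)+
  have rd: "fps_conv_radius (fps_deriv sinq_fps) \<ge> 1" "fps_conv_radius (fps_deriv zeta_fps) \<ge> 1"
    using r fps_conv_radius_deriv order_trans by blast+
  have rm: "fps_conv_radius (fps_deriv zeta_fps * sinq_fps) \<ge> 1"
    by (rule order_trans[OF _ fps_conv_radius_mult]) (use r rd in simp)
  show "fps_conv_radius (fps_deriv sinq_fps) > 0" using rd(1) by (rule less_le_trans[rotated]) simp
  show "fps_conv_radius (- (fps_deriv zeta_fps * sinq_fps)) > 0"
    unfolding fps_conv_radius_uminus using rm by (rule less_le_trans[rotated]) simp
  have "eval_fps (fps_deriv sinq_fps) Y = eval_fps (- (fps_deriv zeta_fps * sinq_fps)) Y"
    if Y: "Y \<in> ball 0 1" for Y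
  proof -
    have n: "norm Y < 1" using Y by simp
    have lt: "ereal (norm Y) < R" if "R \<ge> 1" for R
      using n that by (meson ereal_less(3) less_le_trans)
    have "(eval_fps sinq_fps has_field_derivative eval_fps (fps_deriv sinq_fps) Y) (at Y)"
      by (rule has_field_derivative_eval_fps[OF lt[OF r(1)]])
    moreover have "((\<lambda>Y. exp (- eval_fps zeta_fps Y)) has_field_derivative
        exp (- eval_fps zeta_fps Y) * - eval_fps (fps_deriv zeta_fps) Y) (at Y)"
      by (rule DERIV_chain2[OF DERIV_exp DERIV_minus[OF has_field_derivative_eval_fps[OF lt[OF r(2)]]]])
    then have "(eval_fps sinq_fps has_field_derivative
        exp (- eval_fps zeta_fps Y) * - eval_fps (fps_deriv zeta_fps) Y) (at Y)"
      by (rule has_field_derivative_transform_within_open[OF _ open_ball Y]) (simp add: sinq_eq_exp)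
    ultimately have "eval_fps (fps_deriv sinq_fps) Y = exp (- eval_fps zeta_fps Y) * - eval_fps (fps_deriv zeta_fps) Y"
      by (rule DERIV_unique)
    also have "\<dots> = eval_fps (- (fps_deriv zeta_fps * sinq_fps)) Y"
      using lt[OF r(1)] lt[OF rd(2)] lt[OF rm] n
      by (simp add: eval_fps_minus eval_fps_mult sinq_eq_exp)
    finally show ?thesis .
  qed
  moreover have "\<forall>\<^sub>F Y in nhds 0. Y \<in> ball (0::complex) 1" by (intro eventually_nhds_in_open) auto
  ultimately show "\<forall>\<^sub>F Y in nhds 0. eval_fps (fps_deriv sinq_fps) Y = eval_fps (- (fps_deriv zeta_fps * sinq_fps)) Y"
    by (auto elim: eventually_mono)
qed

lemma sinq_coef_rec:
  "2 * real (Suc n) * sinq_coef (Suc n) = - (\<Sum>l\<le>n. 2 * zeta (2 * l + 2) * sinq_coef (n - l))"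
proof -
  have "fps_deriv sinq_fps $ n = (- (fps_deriv zeta_fps * sinq_fps)) $ n" by (simp only: sinq_fps_deriv)
  then have "complex_of_real (real (Suc n) * sinq_coef (Suc n)) = of_real (- (\<Sum>l=0..n. zeta (2 * l + 2) * sinq_coef (n - l)))"
    by (simp add: fps_mult_nth sinq_fps_def zeta_fps_def del: of_nat_Suc)
  then have "real (Suc n) * sinq_coef (Suc n) = - (\<Sum>l\<le>n. zeta (2 * l + 2) * sinq_coef (n - l))"
    unfolding of_real_eq_iff atMost_atLeast0 .
  then show ?thesis by (simp add: sum_distrib_left[symmetric] mult.assoc del: of_nat_Suc)
qed

text \<open>The recursion of \<open>quasi\<close> with each s^(2l+2)
  \<open>Phi (2 * l + 1) s\<close> replaced by its leading coefficient.\<close>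

fun alpha :: "nat \<Rightarrow> real" where
  "alpha 0 = 1"
| "alpha (Suc k) = (\<Sum>l\<le>k. real ((2 * k + 1) choose (2 * l + 1)) * (2 * (fact (2 * l + 1) * zeta (2 * l + 2))) * alpha (k - l))"

text \<open>The coefficient of s in the same recursion. Only s^2 \<open>Phi 1 s\<close> has a linear
  term, with coefficient -1/2; its weight 2 (2k + 1) makes it -(2k + 1)
  \<open>alpha k\<close>.\<close>

fun beta :: "nat \<Rightarrow> real" where
  "beta 0 = 0"
| "beta (Suc k) = (\<Sum>l\<le>k. real ((2 * k + 1) choose (2 * l + 1)) * (2 * (fact (2 * l + 1) * zeta (2 * l + 2))) * beta (k - l))
     - real (2 * k + 1) * alpha k"

lemma binomial_odd:
  assumes "l \<le> k"
  shows "real ((2 * k + 1) choose (2 * l + 1)) * fact (2 * l + 1) / fact (2 * k + 1) = 1 / fact (2 * (k - l))"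
proof -
  have "2 * k + 1 - (2 * l + 1) = 2 * (k - l)" using assms by simp
  then show ?thesis using binomial_fact[of "2 * l + 1" "2 * k + 1", where 'a = real] assms by simp
qed

text \<open>Division by factorials turns the binomial sum into a convolution, that is, into a linear
  differential equation for the generating function.\<close>

lemma alpha_rec: "2 * real (Suc k) * (alpha (Suc k) / fact (2 * Suc k))
  = (\<Sum>l\<le>k. 2 * zeta (2 * l + 2) * (alpha (k - l) / fact (2 * (k - l))))"
proof -
  have "2 * real (Suc k) * (alpha (Suc k) / fact (2 * Suc k)) = alpha (Suc k) / fact (2 * k + 1)"
  proof -
    have "fact (2 * Suc k) = 2 * real (Suc k) * fact (2 * k + 1)" by (simp add: field_simps)
    then show ?thesis by (simp only:) (simp del: alpha.simps of_nat_Suc)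
  qed
  also have "\<dots> = (\<Sum>l\<le>k. (real ((2 * k + 1) choose (2 * l + 1)) * fact (2 * l + 1) / fact (2 * k + 1))
      * (2 * zeta (2 * l + 2) * alpha (k - l)))"
    unfolding alpha.simps sum_divide_distrib by (intro sum.cong refl) (simp only: mult_ac times_divide_eq_left times_divide_eq_right)
  also have "\<dots> = (\<Sum>l\<le>k. 2 * zeta (2 * l + 2) * (alpha (k - l) / fact (2 * (k - l))))"
    by (intro sum.cong refl, subst binomial_odd) auto
  finally show ?thesis .
qed

text \<open>For the generating functions a and b of the normalized coefficients this is b = -Y a/2.
  If 2 a' = L a, this b solves 2 b' = L b - a, the equation behind the recursion of
  \<open>beta\<close>; the induction carries this out on coefficients.\<close>

lemma beta_eq: "beta (Suc k) / fact (2 * Suc k) = - (alpha k / fact (2 * k)) / 2"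
proof (induction k rule: less_induct)
  case (less k)
  define a b where "a = (\<lambda>k. alpha k / fact (2 * k))" and "b = (\<lambda>k. beta k / fact (2 * k))"
  have IH: "b (Suc j) = - a j / 2" if "j < k" for j using less[OF that] by (simp only: a_def b_def)
  have b0: "b 0 = 0" by (simp add: b_def)
  have "2 * real (Suc k) * b (Suc k) = beta (Suc k) / fact (2 * k + 1)"
  proof -
    have "fact (2 * Suc k) = 2 * real (Suc k) * fact (2 * k + 1)" by (simp add: field_simps)
    then show ?thesis unfolding b_def by (simp only:) (simp del: beta.simps of_nat_Suc)
  qed
  also have "\<dots> = (\<Sum>l\<le>k. (real ((2 * k + 1) choose (2 * l + 1)) * fact (2 * l + 1) / fact (2 * k + 1))
      * (2 * zeta (2 * l + 2) * beta (k - l))) - real (2 * k + 1) * alpha k / fact (2 * k + 1)"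
    unfolding beta.simps diff_divide_distrib sum_divide_distrib
    by (intro arg_cong2[where f = "(-)"] sum.cong refl) (simp only: mult_ac times_divide_eq_left times_divide_eq_right)
  also have "(\<Sum>l\<le>k. (real ((2 * k + 1) choose (2 * l + 1)) * fact (2 * l + 1) / fact (2 * k + 1))
      * (2 * zeta (2 * l + 2) * beta (k - l))) = (\<Sum>l\<le>k. 2 * zeta (2 * l + 2) * b (k - l))"
    unfolding b_def by (intro sum.cong refl, subst binomial_odd) auto
  also have "\<dots> = - (\<Sum>l<k. 2 * zeta (2 * l + 2) * a (k - 1 - l)) / 2"
  proof -
    have "(\<Sum>l\<le>k. 2 * zeta (2 * l + 2) * b (k - l)) = (\<Sum>l<k. 2 * zeta (2 * l + 2) * b (k - l))"
      by (simp add: lessThan_Suc_atMost[symmetric] b0)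
    also have "\<dots> = (\<Sum>l<k. - (2 * zeta (2 * l + 2) * a (k - 1 - l)) / 2)"
    proof (intro sum.cong refl)
      fix l assume "l \<in> {..<k}"
      then have "b (k - l) = - a (k - 1 - l) / 2" using IH[of "k - 1 - l"] by (simp add: Suc_diff_Suc)
      then show "2 * zeta (2 * l + 2) * b (k - l) = - (2 * zeta (2 * l + 2) * a (k - 1 - l)) / 2" by simp
    qed
    also have "\<dots> = - (\<Sum>l<k. 2 * zeta (2 * l + 2) * a (k - 1 - l)) / 2"
      by (simp only: sum_negf sum_divide_distrib[symmetric])
    finally show ?thesis .
  qed
  also have "(\<Sum>l<k. 2 * zeta (2 * l + 2) * a (k - 1 - l)) = 2 * real k * a k"
  proof (cases k)
    case (Suc j)
    show ?thesis unfolding Suc lessThan_Suc_atMost using alpha_rec[of j] by (simp add: a_def)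
  qed simp
  also have "real (2 * k + 1) * alpha k / fact (2 * k + 1) = a k"
  proof -
    have "fact (2 * k + 1) = real (2 * k + 1) * fact (2 * k)" by simp
    then show ?thesis unfolding a_def by (simp only:) (simp del: of_nat_Suc of_nat_add of_nat_mult)
  qed
  finally have "2 * real (Suc k) * b (Suc k) = - (2 * real k * a k) / 2 - a k" .
  then have "2 * real (Suc k) * b (Suc k) = 2 * real (Suc k) * (- a k / 2)" by (simp add: algebra_simps)
  moreover have "2 * real (Suc k) \<noteq> 0" by simp
  ultimately have "b (Suc k) = - a k / 2" using mult_left_cancel by blast
  then show ?case by (simp only: a_def b_def)
qed

text \<open>With 2 a' = l a and 2 s' = -l s the product a s has derivative 0, and its constant term
  is 1.\<close>

lemma alpha_sinq: "Abs_fps (\<lambda>k. alpha k / fact (2 * k)) * Abs_fps sinq_coef = 1"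
proof -
  define a s l where "a = Abs_fps (\<lambda>k. alpha k / fact (2 * k))" and "s = Abs_fps sinq_coef"
    and "l = Abs_fps (\<lambda>l. 2 * zeta (2 * l + 2))"
  have a: "fps_const 2 * fps_deriv a = l * a"
  proof (rule fps_ext)
    fix n show "(fps_const 2 * fps_deriv a) $ n = (l * a) $ n"
      using alpha_rec[of n]
      by (simp only: fps_mult_left_const_nth fps_deriv_nth)
         (simp only: a_def l_def fps_nth_Abs_fps fps_mult_nth atMost_atLeast0 Suc_eq_plus1 mult.assoc)
  qed
  have s: "fps_const 2 * fps_deriv s = - (l * s)"
  proof (rule fps_ext)
    fix n show "(fps_const 2 * fps_deriv s) $ n = (- (l * s)) $ n"
      using sinq_coef_rec[of n]
      by (simp only: fps_mult_left_const_nth fps_deriv_nth)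
         (simp only: s_def l_def fps_nth_Abs_fps fps_mult_nth atMost_atLeast0 Suc_eq_plus1 mult.assoc fps_neg_nth)
  qed
  have "fps_const 2 * fps_deriv (a * s) = a * (fps_const 2 * fps_deriv s) + (fps_const 2 * fps_deriv a) * s"
    by (simp add: algebra_simps)
  also have "\<dots> = 0" unfolding a s by (simp add: algebra_simps)
  finally have "fps_const 2 * fps_deriv (a * s) = 0" .
  then have "fps_deriv (a * s) = 0" by simp
  then have "a * s = fps_const ((a * s) $ 0)" by (simp only: fps_deriv_eq_0_iff)
  then show ?thesis by (simp add: a_def s_def sinq_coef_def)
qed

text \<open>At the argument 1/2 the Bernoulli generating function is (t/2)/sinh(t/2), and t = 2 pi i
  z turns it into pi z/sin(pi z). On coefficients this substitution is the factor (-1)^k (2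
  pi)^(2k).\<close>

lemma bernoulli_sinq: "Abs_fps (\<lambda>k. (-1) ^ k * (2 * pi) ^ (2 * k) * (bernoulli_poly (2 * k) (1 / 2) / fact (2 * k)))
    * Abs_fps sinq_coef = 1"
proof (rule fps_ext)
  fix n
  define B :: "real fps" where "B = fps_X * fps_exp (1 / 2) / (fps_exp 1 - 1)"
  define Q :: "real fps" where "Q = fps_exp (1 / 2) - fps_exp (- 1 / 2)"
  have nz: "fps_exp 1 - 1 \<noteq> (0 :: real fps)"
  proof
    assume "fps_exp 1 - 1 = (0 :: real fps)"
    then have "(fps_exp 1 - 1) $ 1 = (0 :: real fps) $ 1" by (rule arg_cong)
    then show False by simp
  qed
  have sub: "subdegree (fps_exp 1 - 1 :: real fps) = 1" by (intro subdegreeI) auto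
  have "fps_exp 1 - 1 dvd fps_X * (fps_exp (1 / 2) :: real fps)"
  proof -
    have "subdegree (fps_X * (fps_exp (1 / 2) :: real fps)) = 1" by (intro subdegreeI) auto
    then show ?thesis using fps_dvd_iff[OF nz] sub by auto
  qed
  then have B: "B * (fps_exp 1 - 1) = fps_X * fps_exp (1 / 2)" unfolding B_def by (rule dvd_div_mult_self)
  have "B * Q * fps_exp (1 / 2) = B * (fps_exp 1 - 1)"
    unfolding Q_def by (simp add: algebra_simps fps_exp_add_mult[symmetric])
  also have "\<dots> = fps_X * fps_exp (1 / 2)" by (rule B)
  finally have BQ: "B * Q = fps_X" by simp
  \<comment> \<open>\<open>Q\<close> is odd, so the odd coefficients of \<open>B * Q\<close> involve
    only the even coefficients of \<open>B\<close>.\<close>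
  have Qn: "Q $ j = (if even j then 0 else 2 * (1 / 2) ^ j / fact j)" for j
    by (auto simp: Q_def power_minus')
  have "(B * Q) $ (2 * n + 1) = (\<Sum>j=0..2 * n + 1. Q $ j * B $ (2 * n + 1 - j))"
    by (subst mult.commute) (simp only: fps_mult_nth)
  also have "\<dots> = (\<Sum>j\<in>(\<lambda>j. 2 * j + 1) ` {0..n}. Q $ j * B $ (2 * n + 1 - j))"
  proof (rule sum.mono_neutral_right)
    show "\<forall>i\<in>{0..2 * n + 1} - (\<lambda>j. 2 * j + 1) ` {0..n}. Q $ i * B $ (2 * n + 1 - i) = 0"
    proof
      fix i assume i: "i \<in> {0..2 * n + 1} - (\<lambda>j. 2 * j + 1) ` {0..n}"
      have "even i"
      proof (rule ccontr)
        assume "odd i"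
        then obtain j where "i = 2 * j + 1" by (elim oddE)
        with i show False by auto
      qed
      then show "Q $ i * B $ (2 * n + 1 - i) = 0" by (simp add: Qn)
    qed
  qed auto
  also have "\<dots> = (\<Sum>j=0..n. (1 / 4) ^ j / fact (2 * j + 1) * B $ (2 * (n - j)))"
    by (subst sum.reindex) (auto simp: inj_on_def Qn power_mult power2_eq_square diff_mult_distrib2 intro!: sum.cong)
  finally have key: "(\<Sum>j=0..n. (1 / 4) ^ j / fact (2 * j + 1) * B $ (2 * (n - j))) = (if n = 0 then 1 else 0)"
    unfolding BQ by simp
  have bern: "bernoulli_poly m (1 / 2) / fact m = B $ m" for m
    by (simp add: bernoulli_poly_def B_def)
  have "(Abs_fps (\<lambda>k. (-1) ^ k * (2 * pi) ^ (2 * k) * (bernoulli_poly (2 * k) (1 / 2) / fact (2 * k))) * Abs_fps sinq_coef) $ n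
      = (\<Sum>j=0..n. sinq_coef j * ((-1) ^ (n - j) * (2 * pi) ^ (2 * (n - j)) * B $ (2 * (n - j))))"
    unfolding bern by (subst mult.commute) (simp add: fps_mult_nth)
  also have "\<dots> = (\<Sum>j=0..n. (-1) ^ n * (2 * pi) ^ (2 * n) * ((1 / 4) ^ j / fact (2 * j + 1) * B $ (2 * (n - j))))"
  proof (intro sum.cong refl)
    fix j assume j: "j \<in> {0..n}"
    have 1: "(-1 :: real) ^ n = (-1) ^ j * (-1) ^ (n - j)" using j by (simp flip: power_add)
    have "2 * n = 2 * j + 2 * (n - j)" using j by simp
    then have "(2 * pi) ^ (2 * n) = (2 * pi) ^ (2 * j) * (2 * pi) ^ (2 * (n - j))" by (simp only: power_add)
    also have "(2 * pi) ^ (2 * j) = 4 ^ j * pi ^ (2 * j)" by (simp add: power_mult power_mult_distrib)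
    finally have 2: "(2 * pi) ^ (2 * n) = 4 ^ j * pi ^ (2 * j) * (2 * pi) ^ (2 * (n - j))" .
    have 3: "(4 :: real) ^ j * (1 / 4) ^ j = 1" by (simp flip: power_mult_distrib)
    have "(-1) ^ n * (2 * pi) ^ (2 * n) * ((1 / 4) ^ j / fact (2 * j + 1) * B $ (2 * (n - j)))
        = (4 ^ j * (1 / 4) ^ j) * (sinq_coef j * ((-1) ^ (n - j) * (2 * pi) ^ (2 * (n - j)) * B $ (2 * (n - j))))"
      unfolding 1 2 sinq_coef_def by (simp only: mult_ac times_divide_eq_left times_divide_eq_right)
    then show "sinq_coef j * ((-1) ^ (n - j) * (2 * pi) ^ (2 * (n - j)) * B $ (2 * (n - j)))
        = (-1) ^ n * (2 * pi) ^ (2 * n) * ((1 / 4) ^ j / fact (2 * j + 1) * B $ (2 * (n - j)))"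
      unfolding 3 by simp
  qed
  also have "\<dots> = (-1) ^ n * (2 * pi) ^ (2 * n) * (if n = 0 then 1 else 0)"
    by (simp only: sum_distrib_left[symmetric] key)
  also have "\<dots> = 1 $ n" by simp
  finally show "(Abs_fps (\<lambda>k. (-1) ^ k * (2 * pi) ^ (2 * k) * (bernoulli_poly (2 * k) (1 / 2) / fact (2 * k))) * Abs_fps sinq_coef) $ n = 1 $ n" .
qed

text \<open>Both families are the coefficients of the inverse of one and the same series.\<close>

lemma alpha_eq: "alpha k = (2 * pi) ^ (2 * k) * crank_xi k / 2"
proof -
  have nz: "Abs_fps sinq_coef \<noteq> 0"
  proof
    assume "Abs_fps sinq_coef = 0"
    then have "Abs_fps sinq_coef $ 0 = 0 $ 0" by (rule arg_cong)
    then show False by (simp add: sinq_coef_def)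
  qed
  have "Abs_fps (\<lambda>k. alpha k / fact (2 * k)) = Abs_fps (\<lambda>k. (-1) ^ k * (2 * pi) ^ (2 * k)
      * (bernoulli_poly (2 * k) (1 / 2) / fact (2 * k)))"
    using trans[OF alpha_sinq bernoulli_sinq[symmetric]] unfolding mult_right_cancel[OF nz] .
  then have "Abs_fps (\<lambda>k. alpha k / fact (2 * k)) $ k
      = Abs_fps (\<lambda>k. (-1) ^ k * (2 * pi) ^ (2 * k) * (bernoulli_poly (2 * k) (1 / 2) / fact (2 * k))) $ k"
    by (rule arg_cong)
  then show ?thesis by (simp add: crank_xi_def mult_ac)
qed

lemma beta_eq': "beta k = (2 * pi) ^ (2 * (k - 1)) * crank_xi' k"
proof (cases k)
  case (Suc j)
  have "beta (Suc j) = - (fact (2 * Suc j) / fact (2 * j)) * alpha j / 2"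
    using beta_eq[of j] by (simp add: field_simps del: beta.simps fact_Suc)
  also have "fact (2 * Suc j) / fact (2 * j) = (2 * real (Suc j)) * (2 * real (Suc j) - 1)"
    by (simp add: field_simps)
  finally show ?thesis unfolding Suc crank_xi'_def alpha_eq by simp
qed (simp add: crank_xi'_def)

section \<open>Generating functions of the moments\<close>

definition moment_fps :: "nat \<Rightarrow> complex fps" where
  "moment_fps k = Abs_fps (\<lambda>n. of_int (crank_moment (2 * k) n))"

definition divsum_fps :: "nat \<Rightarrow> complex fps" where
  "divsum_fps r = Abs_fps (\<lambda>n. of_nat (divsum r n))"

definition divsum_over_fps :: "complex fps" where
  "divsum_over_fps = Abs_fps (\<lambda>n. of_nat (divsum 1 n) / of_nat n)"

lemma divsum_fps_radius: "fps_conv_radius (divsum_fps r) \<ge> 1"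
  by (rule fps_conv_radius_ge_1) (simp add: divsum_fps_def summable_divsum)

lemma divsum_over_fps_radius: "fps_conv_radius divsum_over_fps \<ge> 1"
  using summable_divsum_over
  by (intro fps_conv_radius_ge_1) (simp add: divsum_over_fps_def norm_divide)

lemma ereal_norm_less: "norm (z :: complex) < 1 \<Longrightarrow> R \<ge> 1 \<Longrightarrow> ereal (norm z) < R"
  by (meson ereal_less(3) less_le_trans)

lemma fps_X_deriv_divsum_over: "fps_X * fps_deriv divsum_over_fps = divsum_fps 1"
proof (rule fps_ext)
  fix n show "(fps_X * fps_deriv divsum_over_fps) $ n = divsum_fps 1 $ n"
    by (cases n) (simp_all add: divsum_over_fps_def divsum_fps_def del: of_nat_Suc)
qed

text \<open>The exponential is holomorphic in the disc, which settles the radius of its Taylor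
  series F. The equation F' = F times the derivative of the logarithm is the recurrence of the
  moments of order 0, and this determines them.\<close>

lemma moment_fps_0:
  "fps_conv_radius (moment_fps 0) \<ge> 1"
  "norm z < 1 \<Longrightarrow> eval_fps (moment_fps 0) z = exp (eval_fps divsum_over_fps z)"
proof -
  define f where "f = (\<lambda>z. exp (eval_fps divsum_over_fps z))"
  have lt: "ereal (norm z) < R" if "z \<in> ball 0 1" "R \<ge> 1" for z :: complex and R
    using that ereal_norm_less by simp
  have der: "(f has_field_derivative f z * eval_fps (fps_deriv divsum_over_fps) z) (at z)" if "z \<in> ball 0 1" for z
    unfolding f_def
    by (rule DERIV_chain2[OF DERIV_exp has_field_derivative_eval_fps[OF lt[OF that divsum_over_fps_radius]]])
  then have "f holomorphic_on ball 0 1" unfolding holomorphic_on_open[OF open_ball] by blast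
  then have hol: "f holomorphic_on eball 0 1" by (simp add: one_ereal_def)
  define F where "F = fps_expansion f 0"
  have rF: "fps_conv_radius F \<ge> 1" unfolding F_def by (rule conv_radius_fps_expansion[OF hol])
  have eF: "eval_fps F z = f z" if "z \<in> ball 0 1" for z
    unfolding F_def using eval_fps_expansion'[OF hol] that by (simp add: one_ereal_def)
  have rd: "fps_conv_radius (fps_deriv divsum_over_fps) \<ge> 1" "fps_conv_radius (fps_deriv F) \<ge> 1"
    using order_trans[OF divsum_over_fps_radius fps_conv_radius_deriv] order_trans[OF rF fps_conv_radius_deriv] by auto
  have rm: "fps_conv_radius (F * fps_deriv divsum_over_fps) \<ge> 1"
    by (rule order_trans[OF _ fps_conv_radius_mult]) (use rF rd in simp)
  have "fps_deriv F = F * fps_deriv divsum_over_fps"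
  proof (rule eval_fps_eqD)
    show "fps_conv_radius (fps_deriv F) > 0" using rd(2) by (rule less_le_trans[rotated]) simp
    show "fps_conv_radius (F * fps_deriv divsum_over_fps) > 0" using rm by (rule less_le_trans[rotated]) simp
    have "eval_fps (fps_deriv F) z = eval_fps (F * fps_deriv divsum_over_fps) z" if z: "z \<in> ball 0 1" for z
    proof -
      have "(eval_fps F has_field_derivative eval_fps (fps_deriv F) z) (at z)"
        by (rule has_field_derivative_eval_fps[OF lt[OF z rF]])
      moreover have "(eval_fps F has_field_derivative f z * eval_fps (fps_deriv divsum_over_fps) z) (at z)"
        by (rule has_field_derivative_transform_within_open[OF der[OF z] open_ball z]) (simp only: eF)
      ultimately have "eval_fps (fps_deriv F) z = f z * eval_fps (fps_deriv divsum_over_fps) z"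
        by (rule DERIV_unique)
      also have "\<dots> = eval_fps (F * fps_deriv divsum_over_fps) z"
        using lt[OF z rF] lt[OF z rd(1)] by (simp add: eval_fps_mult eF[OF z])
      finally show ?thesis .
    qed
    moreover have "\<forall>\<^sub>F z in nhds 0. z \<in> ball (0::complex) 1" by (intro eventually_nhds_in_open) auto
    ultimately show "\<forall>\<^sub>F z in nhds 0. eval_fps (fps_deriv F) z = eval_fps (F * fps_deriv divsum_over_fps) z"
      by (auto elim: eventually_mono)
  qed
  then have "fps_X * fps_deriv F = divsum_fps 1 * F"
    unfolding fps_X_deriv_divsum_over[symmetric] by (simp add: mult_ac)
  then have rec: "of_nat n * F $ n = (\<Sum>j=0..n. of_nat (divsum 1 j) * F $ (n - j))" for n
  proof -
    assume eq: "fps_X * fps_deriv F = divsum_fps 1 * F"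
    have "of_nat n * F $ n = (fps_X * fps_deriv F) $ n" by (cases n) auto
    then show ?thesis unfolding eq by (simp add: fps_mult_nth divsum_fps_def)
  qed
  have "F $ 0 = 1"
  proof -
    have "F $ 0 = f 0" using eF[of 0] by (simp add: eval_fps_at_0)
    then show ?thesis by (simp add: f_def eval_fps_at_0 divsum_over_fps_def)
  qed
  have "F $ n = of_int (crank_moment 0 n)" for n
  proof (induction n rule: less_induct)
    case (less n)
    show ?case
    proof (cases "n = 0")
      case True
      then show ?thesis using \<open>F $ 0 = 1\<close> by (simp add: crank_moment_0_0)
    next
      case False
      have "of_nat n * F $ n = (\<Sum>j=1..n. of_nat (divsum 1 j) * F $ (n - j))"
        unfolding rec[of n] by (intro sum.mono_neutral_right) (auto simp: Suc_le_eq)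
      also have "\<dots> = (\<Sum>j=1..n. of_int (int (divsum 1 j) * crank_moment 0 (n - j)))"
        by (intro sum.cong refl) (use less.IH False in auto)
      also have "\<dots> = of_int (int n * crank_moment 0 n)"
        by (simp only: crank_moment_0_rec of_int_sum)
      finally show ?thesis using False by simp
    qed
  qed
  then have "F = moment_fps 0" by (simp add: fps_eq_iff moment_fps_def)
  with rF eF show "fps_conv_radius (moment_fps 0) \<ge> 1"
    "norm z < 1 \<Longrightarrow> eval_fps (moment_fps 0) z = exp (eval_fps divsum_over_fps z)"
    by (auto simp: f_def)
qed

lemma moment_fps_Suc:
  "moment_fps (Suc k) = (\<Sum>l\<le>k. fps_const (of_nat ((2 * k + 1) choose (2 * l + 1)) * 2) *
     (divsum_fps (2 * l + 1) * moment_fps (k - l)))"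
proof (rule fps_ext)
  fix n
  have "moment_fps (Suc k) $ n = of_int (crank_moment (2 * k + 2) n)" by (simp add: moment_fps_def)
  also have "\<dots> = (\<Sum>j=1..n. \<Sum>l\<le>k. of_nat ((2 * k + 1) choose (2 * l + 1)) * 2 *
      (of_nat (divsum (2 * l + 1) j) * of_int (crank_moment (2 * (k - l)) (n - j))))"
    unfolding crank_moment_rec
    by (simp only: of_int_sum of_int_mult of_int_of_nat_eq of_int_numeral mult.assoc)
  also have "\<dots> = (\<Sum>l\<le>k. of_nat ((2 * k + 1) choose (2 * l + 1)) * 2 *
      (\<Sum>j=1..n. of_nat (divsum (2 * l + 1) j) * of_int (crank_moment (2 * (k - l)) (n - j))))"
    by (subst sum.swap) (simp only: sum_distrib_left)
  \<comment> \<open>The index j = 0 may be added because \<open>divsum r 0 = 0\<close>; the sum is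
    then a Cauchy product.\<close>
  also have "\<dots> = (\<Sum>l\<le>k. of_nat ((2 * k + 1) choose (2 * l + 1)) * 2 *
      (\<Sum>j=0..n. of_nat (divsum (2 * l + 1) j) * of_int (crank_moment (2 * (k - l)) (n - j))))"
  proof (rule sum.cong[OF refl])
    fix l
    have "(\<Sum>j=1..n. of_nat (divsum (2 * l + 1) j) * complex_of_int (crank_moment (2 * (k - l)) (n - j)))
        = (\<Sum>j=0..n. of_nat (divsum (2 * l + 1) j) * of_int (crank_moment (2 * (k - l)) (n - j)))"
      by (rule sum.mono_neutral_left) (auto simp: Suc_le_eq)
    then show "of_nat ((2 * k + 1) choose (2 * l + 1)) * 2 *
        (\<Sum>j=1..n. of_nat (divsum (2 * l + 1) j) * complex_of_int (crank_moment (2 * (k - l)) (n - j)))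
        = of_nat ((2 * k + 1) choose (2 * l + 1)) * 2 *
        (\<Sum>j=0..n. of_nat (divsum (2 * l + 1) j) * of_int (crank_moment (2 * (k - l)) (n - j)))"
      by (simp only:)
  qed
  also have "\<dots> = (\<Sum>l\<le>k. fps_const (of_nat ((2 * k + 1) choose (2 * l + 1)) * 2) *
     (divsum_fps (2 * l + 1) * moment_fps (k - l))) $ n"
    unfolding fps_sum_nth fps_mult_left_const_nth by (simp add: fps_mult_nth divsum_fps_def moment_fps_def)
  finally show "moment_fps (Suc k) $ n = (\<Sum>l\<le>k. fps_const (of_nat ((2 * k + 1) choose (2 * l + 1)) * 2) *
     (divsum_fps (2 * l + 1) * moment_fps (k - l))) $ n" .
qed

lemma fps_conv_radius_sum_ge:
  fixes F :: "'b \<Rightarrow> complex fps"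
  assumes "\<And>i. i \<in> I \<Longrightarrow> fps_conv_radius (F i) \<ge> 1"
  shows "fps_conv_radius (sum F I) \<ge> 1"
  using assms
proof (induction I rule: infinite_finite_induct)
  case (insert i I)
  then show ?case by (auto intro!: order_trans[OF _ fps_conv_radius_add])
qed auto

lemma eval_fps_sum:
  fixes F :: "'b \<Rightarrow> complex fps"
  assumes "\<And>i. i \<in> I \<Longrightarrow> fps_conv_radius (F i) \<ge> 1" "norm z < 1"
  shows "eval_fps (sum F I) z = (\<Sum>i\<in>I. eval_fps (F i) z)"
  using assms(1)
proof (induction I rule: infinite_finite_induct)
  case (insert i I)
  have "fps_conv_radius (F i) \<ge> 1" "fps_conv_radius (sum F I) \<ge> 1"
    using insert by (auto intro: fps_conv_radius_sum_ge)
  then have "eval_fps (F i + sum F I) z = eval_fps (F i) z + eval_fps (sum F I) z"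
    using assms(2) by (intro eval_fps_add ereal_norm_less)
  with insert show ?case by simp
qed auto

text \<open>The quotient of the generating function of the 2k-th moments by that of the partitions:
  a polynomial in Lambert series of odd index, hence a quasimodular form of mixed weight.\<close>

fun quasi :: "nat \<Rightarrow> complex \<Rightarrow> complex" where
  "quasi 0 s = 1"
| "quasi (Suc k) s = (\<Sum>l\<le>k. of_nat ((2 * k + 1) choose (2 * l + 1)) * (2 * Phi (2 * l + 1) s) * quasi (k - l) s)"

definition moment_gf :: "nat \<Rightarrow> complex \<Rightarrow> complex" where
  "moment_gf k s = eval_fps (moment_fps k) (exp (- s))"

lemma moment_fps_radius: "fps_conv_radius (moment_fps k) \<ge> 1"
proof (induction k rule: less_induct)
  case (less k)
  show ?case
  proof (cases k)
    case (Suc m)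
    show ?thesis unfolding Suc moment_fps_Suc
    proof (intro fps_conv_radius_sum_ge)
      fix l assume "l \<in> {..m}"
      then have "fps_conv_radius (moment_fps (m - l)) \<ge> 1" using less.IH[of "m - l"] Suc by simp
      then have "fps_conv_radius (divsum_fps (2 * l + 1) * moment_fps (m - l)) \<ge> 1"
        by (intro order_trans[OF _ fps_conv_radius_mult]) (use divsum_fps_radius in simp)
      then show "fps_conv_radius (fps_const (of_nat ((2 * m + 1) choose (2 * l + 1)) * 2) *
           (divsum_fps (2 * l + 1) * moment_fps (m - l))) \<ge> 1"
        by (intro order_trans[OF _ fps_conv_radius_mult]) simp
    qed
  qed (use moment_fps_0 in simp)
qed

lemma moment_gf_eq:
  assumes "Re s > 0"
  shows "moment_gf k s = exp (Lam s) * quasi k s"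
proof (induction k rule: less_induct)
  case (less k)
  define z where "z = exp (- s)"
  have z: "norm z < 1" using assms by (simp add: z_def)
  have Phi: "eval_fps (divsum_fps r) z = Phi r s" for r
    by (simp add: eval_fps_def Phi_def divsum_fps_def z_def)
  show ?case
  proof (cases k)
    case 0
    have "eval_fps divsum_over_fps z = Lam s"
      by (simp add: eval_fps_def Lam_def divsum_over_fps_def z_def)
    then show ?thesis using moment_fps_0(2)[OF z] by (simp add: 0 moment_gf_def z_def)
  next
    case (Suc m)
    have rad: "fps_conv_radius (divsum_fps (2 * l + 1) * moment_fps (m - l)) \<ge> 1" for l
      by (rule order_trans[OF _ fps_conv_radius_mult]) (use divsum_fps_radius moment_fps_radius in simp)
    have rad': "fps_conv_radius (fps_const c * (divsum_fps (2 * l + 1) * moment_fps (m - l))) \<ge> 1" for l c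
      by (rule order_trans[OF _ fps_conv_radius_mult]) (use rad in simp)
    have "moment_gf k s = (\<Sum>l\<le>m. eval_fps (fps_const (of_nat ((2 * m + 1) choose (2 * l + 1)) * 2) *
        (divsum_fps (2 * l + 1) * moment_fps (m - l))) z)"
      unfolding moment_gf_def Suc moment_fps_Suc z_def[symmetric] by (rule eval_fps_sum[OF rad' z])
    also have "\<dots> = (\<Sum>l\<le>m. of_nat ((2 * m + 1) choose (2 * l + 1)) * 2 * (Phi (2 * l + 1) s * moment_gf (m - l) s))"
    proof (intro sum.cong refl)
      fix l assume "l \<in> {..m}"
      show "eval_fps (fps_const (of_nat ((2 * m + 1) choose (2 * l + 1)) * 2) *
        (divsum_fps (2 * l + 1) * moment_fps (m - l))) z
        = of_nat ((2 * m + 1) choose (2 * l + 1)) * 2 * (Phi (2 * l + 1) s * moment_gf (m - l) s)"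
        by (subst eval_fps_mult, simp, rule ereal_norm_less[OF z rad], subst eval_fps_mult,
            rule ereal_norm_less[OF z divsum_fps_radius], rule ereal_norm_less[OF z moment_fps_radius])
           (simp only: eval_fps_const Phi moment_gf_def z_def[symmetric])
    qed
    also have "\<dots> = exp (Lam s) * quasi k s"
      unfolding Suc quasi.simps sum_distrib_left
      by (intro sum.cong refl) (use less.IH Suc in auto)
    finally show ?thesis .
  qed
qed

text \<open>Cauchy's coefficient formula on the segment $x(1 + iu)$, $|u| \<le> \<pi>/x$, which $s \<mapsto> e^{-s}$ maps once around
  the circle of radius $e^{-x}$.\<close>

lemma coefficient_integral:
  assumes x: "x > 0"
  shows "((\<lambda>u. moment_gf k (of_real x * bline u) * exp (of_nat n * (of_real x * bline u)))
           has_integral of_real (2 * pi / x) * of_int (crank_moment (2 * k) n)) {- (pi / x)..pi / x}"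
proof -
  define R where "R = pi / x"
  have R: "R > 0" "x * R = pi" using x by (auto simp: R_def)
  define c where "c = (\<lambda>m. complex_of_int (crank_moment (2 * k) m))"
  define f where "f = (\<lambda>m u. c m * exp ((of_nat n - of_nat m) * (of_real x * bline u)))"
  have Rex: "Re (of_real x * bline u) = x" for u by simp
  have sums: "(\<lambda>m. f m u) sums (moment_gf k (of_real x * bline u) * exp (of_nat n * (of_real x * bline u)))" for u
  proof -
    define s where "s = of_real x * bline u"
    have "norm (exp (- s)) < 1" using x by (simp add: s_def)
    from sums_mult2[OF eval_fps_sums[OF moment_fps_radius this], of k "exp (of_nat n * s)"]
    have "(\<lambda>m. c m * exp (- s) ^ m * exp (of_nat n * s)) sums (moment_gf k s * exp (of_nat n * s))"
      by (simp add: moment_gf_def moment_fps_def c_def)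
    moreover have "c m * exp (- s) ^ m * exp (of_nat n * s) = f m u" for m
    proof -
      have "exp (- s) ^ m * exp (of_nat n * s) = exp ((of_nat n - of_nat m) * s)"
        by (simp add: exp_of_nat_mult[symmetric] exp_add[symmetric] algebra_simps)
      then show ?thesis by (simp add: f_def s_def mult.assoc)
    qed
    ultimately show ?thesis unfolding s_def by simp
  qed
  \<comment> \<open>On the segment |e^(-s)| is constantly e^(-x) < 1, so the series may be
    integrated term by term.\<close>
  have "uniform_limit (cbox (- R) R) (\<lambda>N u. \<Sum>m<N. f m u) (\<lambda>u. \<Sum>m. f m u) sequentially"
  proof (rule Weierstrass_m_test)
    fix m u
    have "norm (exp ((of_nat n - of_nat m) * (complex_of_real x * bline u))) = exp ((real n - real m) * x)"
      by (simp add: norm_exp_eq_Re)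
    also have "\<dots> = exp (real n * x) * exp (- x) ^ m"
      by (simp add: exp_of_nat_mult[symmetric] exp_add[symmetric] algebra_simps)
    finally show "norm (f m u) \<le> exp (real n * x) * (norm (c m) * exp (- x) ^ m)"
      by (simp add: f_def norm_mult)
  next
    have "ereal (norm (complex_of_real (exp (- x)))) < fps_conv_radius (moment_fps k)"
      by (rule ereal_norm_less[OF _ moment_fps_radius]) (use x in simp)
    then have "summable (\<lambda>m. norm (moment_fps k $ m * complex_of_real (exp (- x)) ^ m))"
      unfolding fps_conv_radius_def by (rule abs_summable_in_conv_radius)
    then show "summable (\<lambda>m. exp (real n * x) * (norm (c m) * exp (- x) ^ m))"
      by (intro summable_mult) (simp add: moment_fps_def c_def norm_mult norm_power)
  qed
  moreover have "continuous_on (cbox (- R) R) (\<lambda>u. \<Sum>m<N. f m u)" for N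
    unfolding f_def bline_def by (intro continuous_intros)
  ultimately obtain I J where I: "\<And>N. ((\<lambda>u. \<Sum>m<N. f m u) has_integral I N) (cbox (- R) R)"
    and J: "((\<lambda>u. \<Sum>m. f m u) has_integral J) (cbox (- R) R)" and IJ: "I \<longlonglongrightarrow> J"
    by (rule uniform_limit_integral_cbox) auto
  \<comment> \<open>For m different from n the primitive takes equal values at the two ends, because
    x t changes by 2 pi i along the segment.\<close>
  have single: "(f m has_integral (if m = n then of_real (2 * R) * c n else 0)) {- R..R}" for m
  proof (cases "m = n")
    case True
    then show ?thesis using has_integral_const_real[of "c n" "- R" R] R
      by (simp add: f_def scaleR_conv_of_real)
  next
    case False
    define d where "d = complex_of_int (int n - int m)"
    have d: "d \<noteq> 0" "of_nat n - of_nat m = d" using False by (auto simp: d_def)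
    define G where "G = (\<lambda>s. c m * exp (d * (of_real x * s)) / (d * of_real x))"
    have der: "(G has_field_derivative c m * exp (d * (of_real x * s))) (at s)" for s
      unfolding G_def using d x by (auto intro!: derivative_eq_intros)
    have "((\<lambda>u. \<i> * (c m * exp (d * (of_real x * bline u)))) has_integral (G (bline R) - G (bline (- R)))) {- R..R}"
    proof (rule fundamental_theorem_of_calculus)
      fix u :: real
      have "(bline has_vector_derivative \<i>) (at u within {- R..R})"
        unfolding bline_def[abs_def] by (auto intro!: derivative_eq_intros)
      from field_vector_diff_chain_within[OF this has_field_derivative_at_within[OF der]]
      show "((\<lambda>u. G (bline u)) has_vector_derivative \<i> * (c m * exp (d * (of_real x * bline u)))) (at u within {- R..R})"
        by (simp add: o_def)
    qed (use R in simp)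
    moreover have "G (bline R) = G (bline (- R))"
    proof -
      have "d * (of_real x * bline R) = d * (of_real x * bline (- R)) + of_int (2 * (int n - int m)) * (of_real pi * \<i>)"
        unfolding R(2)[symmetric] by (simp add: bline_def d_def algebra_simps)
      then have "exp (d * (of_real x * bline R)) = exp (d * (of_real x * bline (- R)))"
        unfolding exp_eq by (auto intro!: exI[of _ "int n - int m"] simp: algebra_simps)
      then show ?thesis by (simp only: G_def)
    qed
    ultimately have "((\<lambda>u. \<i> * f m u) has_integral 0) {- R..R}" by (simp add: f_def d)
    from has_integral_mult_right[OF this, of "- \<i>"] show ?thesis using False by simp
  qed
  have "I N = of_real (2 * R) * c n" if "N > n" for N
  proof -
    have "((\<lambda>u. \<Sum>m<N. f m u) has_integral (\<Sum>m<N. if m = n then of_real (2 * R) * c n else 0)) {- R..R}"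
      by (intro has_integral_sum single) simp
    from has_integral_unique[OF I[of N, unfolded cbox_interval] this] show ?thesis using that by simp
  qed
  then have "\<forall>\<^sub>F N in sequentially. I N = of_real (2 * R) * c n"
    by (intro eventually_mono[OF eventually_gt_at_top[of n]])
  then have "I \<longlonglongrightarrow> of_real (2 * R) * c n" by (rule tendsto_eventually)
  then have "J = of_real (2 * R) * c n" using IJ LIMSEQ_unique by blast
  then show ?thesis using J sums by (simp add: sums_iff R_def c_def cbox_interval)
qed

section \<open>Behaviour of the generating functions on the two arcs\<close>

text \<open>\<open>exp2 f a b\<close> says $f(s) = a + bs + O(s^2)$ as $s \<rightarrow> 0$ inside the sector.\<close>

definition exp2 :: "(complex \<Rightarrow> complex) \<Rightarrow> complex \<Rightarrow> complex \<Rightarrow> bool" where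
  "exp2 f a b \<longleftrightarrow> (\<exists>K\<ge>0. \<forall>s\<in>sector. s \<noteq> 0 \<longrightarrow> norm s \<le> 1 \<longrightarrow> norm (f s - (a + b * s)) \<le> K * norm s ^ 2)"

lemma exp2I:
  assumes "\<And>s. s \<in> sector \<Longrightarrow> s \<noteq> 0 \<Longrightarrow> norm s \<le> 1 \<Longrightarrow> norm (f s - (a + b * s)) \<le> K * norm s ^ 2"
  shows "exp2 f a b"
  unfolding exp2_def
proof (intro exI[of _ "\<bar>K\<bar>"] conjI ballI impI)
  fix s assume s: "s \<in> sector" "s \<noteq> 0" "norm s \<le> 1"
  have "K * norm s ^ 2 \<le> \<bar>K\<bar> * norm s ^ 2" by (intro mult_right_mono) auto
  then show "norm (f s - (a + b * s)) \<le> \<bar>K\<bar> * norm s ^ 2" using assms[OF s] by linarith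
qed simp

lemma exp2E:
  assumes "exp2 f a b"
  obtains K where "K \<ge> 0" "\<And>s. s \<in> sector \<Longrightarrow> s \<noteq> 0 \<Longrightarrow> norm s \<le> 1 \<Longrightarrow> norm (f s - (a + b * s)) \<le> K * norm s ^ 2"
  using assms unfolding exp2_def by blast

lemma exp2_cong:
  assumes "exp2 f a b" "\<And>s. s \<in> sector \<Longrightarrow> s \<noteq> 0 \<Longrightarrow> f s = g s" "a = a'" "b = b'"
  shows "exp2 g a' b'"
  using assms unfolding exp2_def by auto

lemma exp2_const: "exp2 (\<lambda>_. c) c 0"
  by (rule exp2I[of _ _ _ 0]) simp

lemma exp2_add:
  assumes "exp2 f a b" "exp2 g c d"
  shows "exp2 (\<lambda>s. f s + g s) (a + c) (b + d)"
proof -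
  obtain K where K: "\<And>s. s \<in> sector \<Longrightarrow> s \<noteq> 0 \<Longrightarrow> norm s \<le> 1 \<Longrightarrow> norm (f s - (a + b * s)) \<le> K * norm s ^ 2"
    by (rule exp2E[OF assms(1)]) (rule that)
  obtain L where L: "\<And>s. s \<in> sector \<Longrightarrow> s \<noteq> 0 \<Longrightarrow> norm s \<le> 1 \<Longrightarrow> norm (g s - (c + d * s)) \<le> L * norm s ^ 2"
    by (rule exp2E[OF assms(2)]) (rule that)
  show ?thesis
  proof (rule exp2I[where K = "K + L"])
    fix s assume s: "s \<in> sector" "s \<noteq> 0" "norm s \<le> 1"
    have "f s + g s - (a + c + (b + d) * s) = (f s - (a + b * s)) + (g s - (c + d * s))"
      by (simp add: algebra_simps)
    also have "norm \<dots> \<le> K * norm s ^ 2 + L * norm s ^ 2"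
      by (intro norm_triangle_le add_mono K L s)
    finally show "norm (f s + g s - (a + c + (b + d) * s)) \<le> (K + L) * norm s ^ 2"
      by (simp add: algebra_simps)
  qed
qed

lemma exp2_mult:
  assumes "exp2 f a b" "exp2 g c d"
  shows "exp2 (\<lambda>s. f s * g s) (a * c) (a * d + b * c)"
proof -
  obtain K where K: "K \<ge> 0" "\<And>s. s \<in> sector \<Longrightarrow> s \<noteq> 0 \<Longrightarrow> norm s \<le> 1 \<Longrightarrow> norm (f s - (a + b * s)) \<le> K * norm s ^ 2"
    by (rule exp2E[OF assms(1)]) (rule that)
  obtain L where L: "L \<ge> 0" "\<And>s. s \<in> sector \<Longrightarrow> s \<noteq> 0 \<Longrightarrow> norm s \<le> 1 \<Longrightarrow> norm (g s - (c + d * s)) \<le> L * norm s ^ 2"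
    by (rule exp2E[OF assms(2)]) (rule that)
  define C where "C = K * (norm c + norm d + L) + (norm a + norm b) * L + norm b * norm d"
  show ?thesis
  proof (rule exp2I[where K = C])
    fix s assume s: "s \<in> sector" "s \<noteq> 0" "norm s \<le> 1"
    define x where "x = norm s"
    have x: "0 \<le> x" "x \<le> 1" "x\<^sup>2 \<le> 1" using s by (auto simp: x_def power_le_one)
    have f: "norm (f s - (a + b * s)) \<le> K * x\<^sup>2" using K(2)[OF s] by (simp add: x_def)
    have g: "norm (g s - (c + d * s)) \<le> L * x\<^sup>2" using L(2)[OF s] by (simp add: x_def)
    have "norm (a + b * s) \<le> norm a + norm b * x" unfolding x_def norm_mult[symmetric] by (rule norm_triangle_ineq)
    also have "\<dots> \<le> norm a + norm b" using x by (simp add: mult_left_le)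
    finally have ab: "norm (a + b * s) \<le> norm a + norm b" .
    have "norm (c + d * s) \<le> norm c + norm d * x" unfolding x_def norm_mult[symmetric] by (rule norm_triangle_ineq)
    also have "\<dots> \<le> norm c + norm d" using x by (simp add: mult_left_le)
    finally have cd: "norm (c + d * s) \<le> norm c + norm d" .
    have "norm (g s) \<le> norm (c + d * s) + norm (g s - (c + d * s))" by (rule norm_triangle_sub)
    also have "L * x\<^sup>2 \<le> L" using x L(1) by (simp add: mult_left_le)
    then have "norm (c + d * s) + norm (g s - (c + d * s)) \<le> norm c + norm d + L" using cd g by linarith
    finally have gb: "norm (g s) \<le> norm c + norm d + L" .
    have "f s * g s - (a * c + (a * d + b * c) * s)
        = (f s - (a + b * s)) * g s + (a + b * s) * (g s - (c + d * s)) + b * d * s\<^sup>2"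
      by (simp add: algebra_simps power2_eq_square)
    also have "norm \<dots> \<le> K * x\<^sup>2 * (norm c + norm d + L) + (norm a + norm b) * (L * x\<^sup>2) + norm b * norm d * x\<^sup>2"
    proof (intro norm_triangle_le add_mono)
      show "norm ((f s - (a + b * s)) * g s) \<le> K * x\<^sup>2 * (norm c + norm d + L)"
        unfolding norm_mult using K(1) by (intro mult_mono f gb) auto
      show "norm ((a + b * s) * (g s - (c + d * s))) \<le> (norm a + norm b) * (L * x\<^sup>2)"
        unfolding norm_mult by (intro mult_mono ab g) auto
      show "norm (b * d * s\<^sup>2) \<le> norm b * norm d * x\<^sup>2" by (simp add: norm_mult norm_power x_def)
    qed
    also have "\<dots> = C * norm s ^ 2" by (simp add: C_def x_def algebra_simps)
    finally show "norm (f s * g s - (a * c + (a * d + b * c) * s)) \<le> C * norm s ^ 2" .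
  qed
qed

lemma exp2_cmult: "exp2 f a b \<Longrightarrow> exp2 (\<lambda>s. c * f s) (c * a) (c * b)"
  using exp2_mult[OF exp2_const[of c]] by fastforce

lemma exp2_sum:
  assumes "\<And>i. i \<in> I \<Longrightarrow> exp2 (f i) (a i) (b i)"
  shows "exp2 (\<lambda>s. \<Sum>i\<in>I. f i s) (\<Sum>i\<in>I. a i) (\<Sum>i\<in>I. b i)"
  using assms
proof (induction I rule: infinite_finite_induct)
  case (insert i I)
  then show ?case by (simp add: exp2_add)
qed (simp_all add: exp2_const)

text \<open>For l = 0 the term -1/(2s) becomes linear after multiplication by s^2; for l >= 1 the
  error K/|s| becomes O(|s|^(2l+1)), which is beyond the order kept.\<close>

lemma exp2_Phi:
  "exp2 (\<lambda>s. s ^ (2 * l + 2) * Phi (2 * l + 1) s) (of_real (fact (2 * l + 1) * zeta (2 * l + 2)))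
     (if l = 0 then - 1 / 2 else 0)"
proof (cases "l = 0")
  case True
  obtain K where K: "K > 0" "\<And>s. s \<in> sector \<Longrightarrow> s \<noteq> 0 \<Longrightarrow> norm s \<le> 1 \<Longrightarrow>
    norm (Phi 1 s - (of_real (pi\<^sup>2 / 6) / s\<^sup>2 - 1 / (2 * s) + 1 / 24)) \<le> K * norm s"
    by (rule Phi_1_asymp) (rule that)
  have "exp2 (\<lambda>s. s\<^sup>2 * Phi 1 s) (of_real (pi\<^sup>2 / 6)) (- 1 / 2)"
  proof (rule exp2I[where K = "K + 1"])
    fix s assume s: "s \<in> sector" "s \<noteq> 0" "norm s \<le> 1"
    define c where "c = complex_of_real (pi\<^sup>2 / 6)"
    have "s\<^sup>2 * Phi 1 s - (c + - 1 / 2 * s)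
        = s\<^sup>2 * (Phi 1 s - (c / s\<^sup>2 - 1 / (2 * s) + 1 / 24)) + s\<^sup>2 * (1 / 24)"
      using s by (simp add: field_simps power2_eq_square)
    also have "norm \<dots> \<le> norm s ^ 2 * (K * norm s) + norm s ^ 2 * (1 / 24)"
      using K(2)[OF s] unfolding c_def
      by (intro norm_triangle_le add_mono) (simp_all only: norm_mult norm_power mult_left_mono zero_le_power2, simp)
    also have "\<dots> \<le> norm s ^ 2 * (K * 1) + norm s ^ 2 * 1"
      using s K(1) by (intro add_mono mult_left_mono) auto
    finally show "norm (s\<^sup>2 * Phi 1 s - (of_real (pi\<^sup>2 / 6) + - 1 / 2 * s)) \<le> (K + 1) * norm s ^ 2"
      unfolding c_def by (simp add: algebra_simps)
  qed
  then show ?thesis using True by (simp add: zeta_2 numeral_2_eq_2[symmetric])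
next
  case False
  obtain K where K: "K > 0" "\<And>s. s \<in> sector \<Longrightarrow> s \<noteq> 0 \<Longrightarrow> norm s \<le> 1 \<Longrightarrow>
    norm (Phi (2 * l + 1) s - fact (2 * l + 1) * of_real (zeta (2 * l + 1 + 1)) / s ^ (2 * l + 1 + 1)) \<le> K / norm s"
    by (rule Phi_asymp_weak[of "2 * l + 1"]) (simp, rule that)
  have "exp2 (\<lambda>s. s ^ (2 * l + 2) * Phi (2 * l + 1) s) (of_real (fact (2 * l + 1) * zeta (2 * l + 2))) 0"
  proof (rule exp2I[where K = K])
    fix s assume s: "s \<in> sector" "s \<noteq> 0" "norm s \<le> 1"
    define c where "c = complex_of_real (fact (2 * l + 1) * zeta (2 * l + 2))"
    have "norm (Phi (2 * l + 1) s - c / s ^ (2 * l + 2)) \<le> K / norm s"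
      using K(2)[OF s] by (simp add: c_def)
    moreover have "s ^ (2 * l + 2) * Phi (2 * l + 1) s - (c + 0 * s) = s ^ (2 * l + 2) * (Phi (2 * l + 1) s - c / s ^ (2 * l + 2))"
      using s by (simp add: field_simps)
    ultimately have "norm (s ^ (2 * l + 2) * Phi (2 * l + 1) s - (c + 0 * s)) \<le> norm s ^ (2 * l + 2) * (K / norm s)"
      by (simp only: norm_mult norm_power mult_left_mono zero_le_power norm_ge_zero)
    also have "\<dots> = K * norm s ^ (2 * l + 1)" using s by simp
    also have "\<dots> \<le> K * norm s ^ 2"
      using s K(1) False by (intro mult_left_mono power_decreasing) auto
    finally show "norm (s ^ (2 * l + 2) * Phi (2 * l + 1) s - (of_real (fact (2 * l + 1) * zeta (2 * l + 2)) + 0 * s)) \<le> K * norm s ^ 2"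
      unfolding c_def .
  qed
  then show ?thesis using False by simp
qed

text \<open>Expansions add and multiply like dual numbers, so the recursion of \<open>quasi\<close>
  splits into those of \<open>alpha\<close> and \<open>beta\<close>.\<close>

lemma exp2_quasi: "exp2 (\<lambda>s. s ^ (2 * k) * quasi k s) (of_real (alpha k)) (of_real (beta k))"
proof (induction k rule: less_induct)
  case (less k)
  show ?case
  proof (cases k)
    case 0
    then show ?thesis using exp2_const[of 1] by simp
  next
    case (Suc m)
    define B where "B = (\<lambda>l. complex_of_real (real ((2 * m + 1) choose (2 * l + 1)) * 2))"
    define C where "C = (\<lambda>l. complex_of_real (fact (2 * l + 1) * zeta (2 * l + 2)))"
    define D where "D = (\<lambda>l::nat. if l = 0 then - 1 / 2 else (0 :: complex))"
    have IH: "exp2 (\<lambda>s. s ^ (2 * (m - l)) * quasi (m - l) s) (of_real (alpha (m - l))) (of_real (beta (m - l)))" for l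
      using less.IH[of "m - l"] Suc by simp
    have "exp2 (\<lambda>s. \<Sum>l\<le>m. B l * ((s ^ (2 * l + 2) * Phi (2 * l + 1) s) * (s ^ (2 * (m - l)) * quasi (m - l) s)))
        (\<Sum>l\<le>m. B l * (C l * of_real (alpha (m - l))))
        (\<Sum>l\<le>m. B l * (C l * of_real (beta (m - l)) + D l * of_real (alpha (m - l))))"
      unfolding C_def D_def by (intro exp2_sum exp2_cmult exp2_mult exp2_Phi IH)
    then show ?thesis
    proof (rule exp2_cong)
      fix s :: complex
      have "B l * ((s ^ (2 * l + 2) * Phi (2 * l + 1) s) * (s ^ (2 * (m - l)) * quasi (m - l) s))
          = s ^ (2 * k) * (of_nat ((2 * m + 1) choose (2 * l + 1)) * (2 * Phi (2 * l + 1) s) * quasi (m - l) s)"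
        if "l \<le> m" for l
      proof -
        have "2 * k = (2 * l + 2) + 2 * (m - l)" using that Suc by simp
        then have "s ^ (2 * k) = s ^ (2 * l + 2) * s ^ (2 * (m - l))" by (simp only: power_add)
        then show ?thesis by (simp only: B_def of_real_mult of_real_of_nat_eq of_real_numeral mult_ac)
      qed
      then show "(\<Sum>l\<le>m. B l * ((s ^ (2 * l + 2) * Phi (2 * l + 1) s) * (s ^ (2 * (m - l)) * quasi (m - l) s)))
          = s ^ (2 * k) * quasi k s"
        unfolding Suc quasi.simps sum_distrib_left by (intro sum.cong refl) simp
    next
      show "(\<Sum>l\<le>m. B l * (C l * of_real (alpha (m - l)))) = of_real (alpha k)"
        unfolding Suc alpha.simps B_def C_def of_real_sum by (intro sum.cong refl) (simp only: of_real_mult mult_ac)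
      have "(\<Sum>l\<le>m. B l * (C l * of_real (beta (m - l)) + D l * of_real (alpha (m - l))))
          = (\<Sum>l\<le>m. B l * (C l * of_real (beta (m - l)))) + (\<Sum>l\<le>m. B l * (D l * of_real (alpha (m - l))))"
        by (simp only: distrib_left sum.distrib)
      also have "(\<Sum>l\<le>m. B l * (D l * of_real (alpha (m - l)))) = (\<Sum>l\<in>{0}. B l * (D l * of_real (alpha (m - l))))"
        by (rule sum.mono_neutral_right) (auto simp: D_def)
      also have "\<dots> = - of_real (real (2 * m + 1) * alpha m)"
        by (simp add: B_def D_def)
      also have "(\<Sum>l\<le>m. B l * (C l * of_real (beta (m - l)))) = of_real (\<Sum>l\<le>m. real ((2 * m + 1) choose (2 * l + 1))
          * (2 * (fact (2 * l + 1) * zeta (2 * l + 2))) * beta (m - l))"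
        unfolding B_def C_def of_real_sum by (intro sum.cong refl) (simp only: of_real_mult mult_ac)
      finally show "(\<Sum>l\<le>m. B l * (C l * of_real (beta (m - l)) + D l * of_real (alpha (m - l)))) = of_real (beta k)"
        unfolding Suc beta.simps of_real_diff by simp
    qed
  qed
qed

lemma exp2_exp_LamD: "exp2 (\<lambda>s. exp (LamD s)) (of_real ((2 * pi) powr (- 1 / 2))) 0"
proof -
  obtain K where K: "K > 0" "\<And>s. s \<in> sector \<Longrightarrow> s \<noteq> 0 \<Longrightarrow> norm s \<le> 1 \<Longrightarrow>
    norm (LamD s - of_real (- ln (2 * pi) / 2)) \<le> K * norm s ^ 2"
    by (rule LamD_asymp') (rule that)
  define c where "c = complex_of_real (- ln (2 * pi) / 2)"
  have ec: "exp c = of_real ((2 * pi) powr (- 1 / 2))"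
    by (simp add: c_def powr_def exp_of_real[symmetric])
  show ?thesis
  proof (rule exp2I[where K = "exp (Re c + K) * K"])
    fix s assume s: "s \<in> sector" "s \<noteq> 0" "norm s \<le> 1"
    have le: "norm (LamD s - c) \<le> K * norm s ^ 2" using K(2)[OF s] by (simp add: c_def)
    also have "\<dots> \<le> K * 1" using s K(1) by (intro mult_left_mono) (auto simp: power_le_one)
    finally have leK: "norm (LamD s - c) \<le> K" by simp
    have "norm (exp (LamD s) - exp c) \<le> exp (Re c + K) * norm (LamD s - c)"
    proof (rule field_differentiable_bound[where S = "cball c K"])
      fix z assume "z \<in> cball c K"
      then have "norm (z - c) \<le> K" by (simp add: dist_norm norm_minus_commute)
      then have "Re z \<le> Re c + K" using complex_Re_le_cmod[of "z - c"] by simp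
      then show "norm (exp z) \<le> exp (Re c + K)" by (simp add: norm_exp_eq_Re)
      show "(exp has_field_derivative exp z) (at z within cball c K)"
        by (rule has_field_derivative_at_within[OF DERIV_exp])
    qed (use leK K(1) in \<open>auto simp: dist_norm norm_minus_commute\<close>)
    also have "\<dots> \<le> exp (Re c + K) * (K * norm s ^ 2)" by (intro mult_left_mono le) simp
    finally show "norm (exp (LamD s) - (of_real ((2 * pi) powr (- 1 / 2)) + 0 * s)) \<le> exp (Re c + K) * K * norm s ^ 2"
      unfolding ec[symmetric] by (simp add: mult.assoc)
  qed
qed

text \<open>The factor s^(2k) clears the pole of \<open>quasi\<close>; what is left has a limit at 0
  within the sector and carries the two coefficients of the theorem.\<close>

definition lead :: "nat \<Rightarrow> complex \<Rightarrow> complex" where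
  "lead k s = exp (LamD s) * (s ^ (2 * k) * quasi k s)"

lemma exp2_lead:
  "exp2 (lead k) (of_real ((2 * pi) powr (- 1 / 2) * alpha k)) (of_real ((2 * pi) powr (- 1 / 2) * beta k))"
  using exp2_mult[OF exp2_exp_LamD exp2_quasi[of k]] by (simp add: lead_def[abs_def])

lemma moment_gf_lead:
  assumes "Re s > 0"
  shows "moment_gf k s = exp (of_real (pi\<^sup>2 / 6) / s - s / 24) * s powr of_real (1 / 2 - 2 * real k) * lead k s"
proof -
  have s: "s \<noteq> 0" using assms by auto
  have "s powr of_real (1 / 2 - 2 * real k) = s powr of_real (1 / 2) / s powr of_nat (2 * k)"
    by (simp add: powr_diff)
  also have "s powr of_nat (2 * k) = s ^ (2 * k)" using s by (subst powr_nat) simp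
  also have "s powr of_real (1 / 2) = exp (Ln s / 2)" using s by (simp add: powr_def)
  finally have p: "s powr of_real (1 / 2 - 2 * real k) * s ^ (2 * k) = exp (Ln s / 2)" using s by simp
  have "Lam s = (of_real (pi\<^sup>2 / 6) / s - s / 24) + Ln s / 2 + LamD s" by (simp add: LamD_def)
  then have "exp (Lam s) = exp (of_real (pi\<^sup>2 / 6) / s - s / 24) * exp (Ln s / 2) * exp (LamD s)"
    by (simp only: exp_add)
  then show ?thesis unfolding moment_gf_eq[OF assms] lead_def p[symmetric] by (simp only: mult_ac)
qed

text \<open>The coefficients are nonnegative, so |Phi r s| is at most the value at Re s, which lies
  in the sector. This gives a bound on the whole circle.\<close>

lemma norm_Phi_le:
  assumes "r \<ge> 1"
  obtains K where "K \<ge> 0" "\<And>s. 0 < Re s \<Longrightarrow> Re s \<le> 1 \<Longrightarrow> norm (Phi r s) \<le> K / Re s ^ (r + 1)"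
proof -
  obtain K where K: "K > 0" "\<And>s. s \<in> sector \<Longrightarrow> s \<noteq> 0 \<Longrightarrow> norm s \<le> 1 \<Longrightarrow>
    norm (Phi r s - fact r * of_real (zeta (r + 1)) / s ^ (r + 1)) \<le> K / norm s"
    by (rule Phi_asymp_weak[OF assms]) (rule that)
  define M where "M = fact r * \<bar>zeta (r + 1)\<bar> + K"
  have "norm (Phi r s) \<le> M / Re s ^ (r + 1)" if s: "0 < Re s" "Re s \<le> 1" for s
  proof -
    define x where "x = Re s"
    have x: "0 < x" "x \<le> 1" using s by (auto simp: x_def)
    have sm: "summable (\<lambda>n. real (divsum r n) * exp (- x) ^ n)" by (rule summable_divsum) (use x in auto)
    have nm: "norm (of_nat (divsum r n) * exp (- s) ^ n :: complex) = real (divsum r n) * exp (- x) ^ n" for n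
      by (simp add: norm_mult norm_power x_def)
    have "norm (Phi r s) \<le> (\<Sum>n. real (divsum r n) * exp (- x) ^ n)"
      unfolding Phi_def by (rule order_trans[OF summable_norm]) (simp_all only: nm sm order_refl)
    also have "complex_of_real \<dots> = Phi r (of_real x)"
    proof -
      have "exp (- complex_of_real x) = of_real (exp (- x))" by (metis exp_of_real of_real_minus)
      then show ?thesis unfolding Phi_def by (simp add: suminf_of_real[OF sm])
    qed
    then have "(\<Sum>n. real (divsum r n) * exp (- x) ^ n) = Re (Phi r (of_real x))" by (metis Re_complex_of_real)
    also have "\<dots> \<le> norm (Phi r (of_real x))" by (rule complex_Re_le_cmod)
    also have "\<dots> \<le> norm (fact r * of_real (zeta (r + 1)) / complex_of_real x ^ (r + 1))
        + norm (Phi r (of_real x) - fact r * of_real (zeta (r + 1)) / of_real x ^ (r + 1))"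
      by (rule norm_triangle_sub)
    also have "norm (fact r * of_real (zeta (r + 1)) / complex_of_real x ^ (r + 1)) = fact r * \<bar>zeta (r + 1)\<bar> / x ^ (r + 1)"
      using x by (simp add: norm_divide norm_mult norm_power)
    also have "norm (Phi r (of_real x) - fact r * of_real (zeta (r + 1)) / of_real x ^ (r + 1)) \<le> K / x"
      using K(2)[of "of_real x"] x of_real_in_sector[of x] by simp
    also have "K / x \<le> K / x ^ (r + 1)"
      using x K(1) power_decreasing[of 1 "r + 1" x] by (intro divide_left_mono) auto
    finally show ?thesis by (simp add: M_def x_def add_divide_distrib)
  qed
  moreover have "M \<ge> 0" unfolding M_def using K(1) by simp
  ultimately show ?thesis using that by blast
qed

lemma norm_quasi_le: "\<exists>K\<ge>0. \<forall>s. 0 < Re s \<longrightarrow> Re s \<le> 1 \<longrightarrow> norm (quasi k s) \<le> K / Re s ^ (2 * k)"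
proof (induction k rule: less_induct)
  case (less k)
  show ?case
  proof (cases k)
    case 0
    then show ?thesis by (auto intro!: exI[of _ 1])
  next
    case (Suc m)
    have "\<forall>l. \<exists>K\<ge>0. \<forall>s. 0 < Re s \<longrightarrow> Re s \<le> 1 \<longrightarrow> norm (quasi (m - l) s) \<le> K / Re s ^ (2 * (m - l))"
      using less.IH Suc by (metis diff_le_self le_imp_less_Suc)
    then obtain Q where Q: "\<And>l. Q l \<ge> 0"
      "\<And>l s. 0 < Re s \<Longrightarrow> Re s \<le> 1 \<Longrightarrow> norm (quasi (m - l) s) \<le> Q l / Re s ^ (2 * (m - l))"
      by metis
    have "\<forall>l. \<exists>K\<ge>0. \<forall>s. 0 < Re s \<longrightarrow> Re s \<le> 1 \<longrightarrow> norm (Phi (2 * l + 1) s) \<le> K / Re s ^ (2 * l + 1 + 1)"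
    proof
      fix l
      obtain K where "K \<ge> 0" "\<And>s. 0 < Re s \<Longrightarrow> Re s \<le> 1 \<Longrightarrow> norm (Phi (2 * l + 1) s) \<le> K / Re s ^ (2 * l + 1 + 1)"
        by (rule norm_Phi_le[of "2 * l + 1"]) (simp, rule that)
      then show "\<exists>K\<ge>0. \<forall>s. 0 < Re s \<longrightarrow> Re s \<le> 1 \<longrightarrow> norm (Phi (2 * l + 1) s) \<le> K / Re s ^ (2 * l + 1 + 1)"
        by blast
    qed
    then obtain P where P: "\<And>l. P l \<ge> 0"
      "\<And>l s. 0 < Re s \<Longrightarrow> Re s \<le> 1 \<Longrightarrow> norm (Phi (2 * l + 1) s) \<le> P l / Re s ^ (2 * l + 1 + 1)"
      by metis
    define c where "c = (\<lambda>l. real ((2 * m + 1) choose (2 * l + 1)) * 2)"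
    show ?thesis
    proof (intro exI[of _ "\<Sum>l\<le>m. c l * (P l * Q l)"] conjI allI impI)
      show "0 \<le> (\<Sum>l\<le>m. c l * (P l * Q l))"
        unfolding c_def by (intro sum_nonneg mult_nonneg_nonneg P(1) Q(1)) auto
      fix s assume s: "0 < Re s" "Re s \<le> 1"
      have "norm (quasi k s) \<le> (\<Sum>l\<le>m. norm (of_nat ((2 * m + 1) choose (2 * l + 1)) * (2 * Phi (2 * l + 1) s) * quasi (m - l) s))"
        unfolding Suc quasi.simps by (rule norm_sum)
      also have "\<dots> \<le> (\<Sum>l\<le>m. c l * (P l * Q l) / Re s ^ (2 * k))"
      proof (rule sum_mono)
        fix l assume "l \<in> {..m}"
        then have e: "2 * k = (2 * l + 1 + 1) + 2 * (m - l)" using Suc by simp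
        have "norm (of_nat ((2 * m + 1) choose (2 * l + 1)) * (2 * Phi (2 * l + 1) s) * quasi (m - l) s)
            = c l * (norm (Phi (2 * l + 1) s) * norm (quasi (m - l) s))"
          by (simp only: c_def norm_mult norm_of_nat norm_numeral mult_ac)
        also have "\<dots> \<le> c l * ((P l / Re s ^ (2 * l + 1 + 1)) * (Q l / Re s ^ (2 * (m - l))))"
          using s P(1) by (intro mult_left_mono mult_mono P(2) Q(2)) (auto simp: c_def)
        also have "\<dots> = c l * (P l * Q l) / Re s ^ (2 * k)"
          unfolding e power_add by simp
        finally show "norm (of_nat ((2 * m + 1) choose (2 * l + 1)) * (2 * Phi (2 * l + 1) s) * quasi (m - l) s)
            \<le> c l * (P l * Q l) / Re s ^ (2 * k)" .
      qed
      also have "\<dots> = (\<Sum>l\<le>m. c l * (P l * Q l)) / Re s ^ (2 * k)" by (simp only: sum_divide_distrib)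
      finally show "norm (quasi k s) \<le> (\<Sum>l\<le>m. c l * (P l * Q l)) / Re s ^ (2 * k)" .
    qed
  qed
qed

text \<open>1 - cos x = 2 sin(x/2)^2, and sin v >= v/2 on [0, 1] since cos v >= 1/2 there;
  monotonicity of cos on [0, pi] passes from x to the larger angle.\<close>

lemma one_minus_cos_ge:
  assumes "0 \<le> x" "x \<le> 1" "x \<le> \<bar>\<theta>\<bar>" "\<bar>\<theta>\<bar> \<le> pi"
  shows "x\<^sup>2 / 8 \<le> 1 - cos \<theta>"
proof -
  have half: "1 - cos v = 2 * (sin (v / 2))\<^sup>2" for v :: real
    using cos_double_sin[of "v / 2"] by simp
  have cos_ge: "1 / 2 \<le> cos v" if "0 \<le> v" "v \<le> 1" for v :: real
  proof -
    have "(sin (v / 2))\<^sup>2 \<le> (v / 2)\<^sup>2"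
      using that sin_ge_zero[of "v / 2"] sin_x_le_x[of "v / 2"] pi_gt3 by (intro power_mono) auto
    also have "\<dots> \<le> (1 / 2)\<^sup>2" using that by (intro power_mono) auto
    finally show ?thesis using half[of v] by (simp add: power2_eq_square)
  qed
  have "v / 2 \<le> sin v" if "0 \<le> v" "v \<le> 1" for v :: real
  proof -
    have "sin 0 - 0 / 2 \<le> sin v - v / 2"
    proof (rule DERIV_nonneg_imp_nondecreasing[OF that(1)])
      fix u assume "0 \<le> u" "u \<le> v"
      then show "\<exists>d. ((\<lambda>u. sin u - u / 2) has_real_derivative d) (at u) \<and> 0 \<le> d"
        using cos_ge[of u] that by (intro exI[of _ "cos u - 1 / 2"]) (auto intro!: derivative_eq_intros)
    qed
    then show ?thesis by simp
  qed
  from this[of "x / 2"] have "x / 4 \<le> sin (x / 2)" using assms by simp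
  then have "(x / 4)\<^sup>2 \<le> (sin (x / 2))\<^sup>2" using assms by (intro power_mono) auto
  then have "x\<^sup>2 / 8 \<le> 1 - cos x" using half[of x] by (simp add: power2_eq_square)
  moreover have "cos \<bar>\<theta>\<bar> \<le> cos x" using assms by (intro cos_monotone_0_pi_le) auto
  ultimately show ?thesis by simp
qed

text \<open>The coefficients sigma_1(n)/n are at least 1 for n >= 1, and p^n - Re (z^n) is
  nonnegative; so the loss is at least that of the geometric series, 1/(1 - p) - Re (1/(1 -
  z)).\<close>

lemma Lam_minor:
  assumes x: "0 < x" "x \<le> 1" and u: "1 \<le> \<bar>u\<bar>" "x * \<bar>u\<bar> \<le> pi"
  shows "Re (Lam (of_real x * bline u)) \<le> Re (Lam (of_real x)) - 1 / (40 * x)"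
proof -
  define s where "s = of_real x * bline u"
  define z where "z = exp (- s)"
  define p where "p = exp (- x)"
  have p: "0 < p" "p < 1" using x by (auto simp: p_def)
  have Res: "Re s = x" "Im s = x * u" by (simp_all add: s_def)
  have nz: "norm z = p" by (simp add: z_def p_def Res)
  have z1: "z \<noteq> 1" using nz p by auto
  define a where "a = (\<lambda>n. real (divsum 1 n) / real n)"
  have a1: "a n \<ge> 1" if "n \<ge> 1" for n
  proof -
    have "(\<Sum>d\<in>{n}. d ^ 1) \<le> divsum 1 n" unfolding divsum_def
      using that by (intro sum_mono2) auto
    then show ?thesis using that by (simp add: a_def)
  qed
  have "of_nat (divsum 1 n) / of_nat n = complex_of_real (a n)" for n by (simp add: a_def)
  moreover have "(\<lambda>n. of_nat (divsum 1 n) / of_nat n * z ^ n) sums Lam s"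
    unfolding Lam_def z_def using summable_Lam[of s] Res x by (intro summable_sums) simp
  ultimately have "(\<lambda>n. complex_of_real (a n) * z ^ n) sums Lam s" by (simp only:)
  from sums_Re[OF this] have S1: "(\<lambda>n. a n * Re (z ^ n)) sums Re (Lam s)"
    by (simp only: Re_complex_of_real Im_complex_of_real times_complex.sel mult_zero_left diff_zero)
  have S2: "(\<lambda>n. a n * p ^ n) sums Re (Lam (of_real x))"
    unfolding Lam_of_real[OF x(1)] Re_complex_of_real a_def p_def
    by (intro summable_sums summable_divsum_over) (use x in auto)
  have "(\<lambda>n. z ^ n) sums (1 / (1 - z))" by (rule geometric_sums) (use nz p in simp)
  from sums_Re[OF this] have G1: "(\<lambda>n. Re (z ^ n)) sums Re (1 / (1 - z))" .
  have G2: "(\<lambda>n. p ^ n) sums (1 / (1 - p))" by (rule geometric_sums) (use p in simp)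
  have "1 / (1 - p) - Re (1 / (1 - z)) \<le> Re (Lam (of_real x)) - Re (Lam s)"
  proof (rule sums_le[OF _ sums_diff[OF G2 G1] sums_diff[OF S2 S1]])
    fix n
    have d: "0 \<le> p ^ n - Re (z ^ n)" using complex_Re_le_cmod[of "z ^ n"] nz by (simp add: norm_power)
    show "p ^ n - Re (z ^ n) \<le> a n * p ^ n - a n * Re (z ^ n)"
    proof (cases "n = 0")
      case False
      then have "1 * (p ^ n - Re (z ^ n)) \<le> a n * (p ^ n - Re (z ^ n))" using a1[of n] d by (intro mult_right_mono) auto
      then show ?thesis by (simp add: right_diff_distrib)
    qed simp
  qed
  moreover have "1 / (40 * x) \<le> 1 / (1 - p) - Re (1 / (1 - z))"
  proof -
    \<comment> \<open>As q <= x, |1 - z|^2 >= q^2 + x^2/12 >= (13/12) q^2 >= (1.03 q)^2. Hence at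
      least 3/103 of 1/q is gained, and 3/103 > 1/40.\<close>
    define q where "q = 1 - p"
    have q: "0 < q" "q \<le> x" using p exp_ge_add_one_self[of "- x"] by (auto simp: q_def p_def)
    have "exp (1 :: real) \<le> 3" by (rule exp_le)
    then have "exp (- 1) \<ge> (1 / 3 :: real)" by (simp add: exp_minus field_simps)
    moreover have "exp (- 1) \<le> p" using x by (simp add: p_def)
    ultimately have p3: "1 / 3 \<le> p" by linarith
    have "norm (1 - z) ^ 2 = (1 - p * cos (x * u))\<^sup>2 + (p * sin (x * u))\<^sup>2"
      unfolding cmod_power2 by (simp add: z_def Re_exp Im_exp Res p_def)
    also have "\<dots> = q\<^sup>2 + 2 * p * (1 - cos (x * u))"
    proof -
      have "(1 - p * c)\<^sup>2 + (p * d)\<^sup>2 = 1 - 2 * p * c + p\<^sup>2 * (d\<^sup>2 + c\<^sup>2)" for c d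
        by (simp add: power2_eq_square algebra_simps)
      from this[of "cos (x * u)" "sin (x * u)"] show ?thesis unfolding sin_cos_squared_add by (simp add: q_def power2_eq_square algebra_simps)
    qed
    also have "\<dots> \<ge> q\<^sup>2 + 2 * (1 / 3) * (x\<^sup>2 / 8)"
    proof -
      have "x * 1 \<le> x * \<bar>u\<bar>" using x u by (intro mult_left_mono) auto
      then have "x\<^sup>2 / 8 \<le> 1 - cos (x * u)" using x u by (intro one_minus_cos_ge) (auto simp: abs_mult)
      then have "(2 * (1 / 3)) * (x\<^sup>2 / 8) \<le> (2 * p) * (1 - cos (x * u))"
        using p3 by (intro mult_mono) auto
      then show ?thesis by simp
    qed
    finally have "q\<^sup>2 + x\<^sup>2 / 12 \<le> norm (1 - z) ^ 2" by simp
    moreover have "q\<^sup>2 \<le> x\<^sup>2" using q by (intro power_mono) auto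
    moreover have "(103 / 100 * q)\<^sup>2 \<le> 13 / 12 * q\<^sup>2" by (simp add: power_mult_distrib power2_eq_square)
    ultimately have "(103 / 100 * q)\<^sup>2 \<le> norm (1 - z) ^ 2" by linarith
    then have "103 / 100 * q \<le> norm (1 - z)" by (rule power2_le_imp_le) simp
    then have "1 / norm (1 - z) \<le> 1 / (103 / 100 * q)" using q z1 by (intro divide_left_mono mult_pos_pos) auto
    also have "\<dots> = 100 / 103 * (1 / q)" by simp
    finally have "1 / norm (1 - z) \<le> 100 / 103 * (1 / q)" .
    moreover have "Re (1 / (1 - z)) \<le> 1 / norm (1 - z)"
      using complex_Re_le_cmod[of "1 / (1 - z)"] by (simp add: norm_divide)
    ultimately have "Re (1 / (1 - z)) \<le> 100 / 103 * (1 / q)" by (rule order_trans[rotated])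
    moreover have "1 / 40 * (1 / x) \<le> 3 / 103 * (1 / q)"
      using q by (intro mult_mono divide_left_mono) auto
    ultimately have "1 / 40 * (1 / x) + Re (1 / (1 - z)) \<le> 3 / 103 * (1 / q) + 100 / 103 * (1 / q)"
      by (intro add_mono)
    also have "\<dots> = 1 / q" by (simp flip: distrib_right)
    finally show ?thesis unfolding q_def by simp
  qed
  ultimately show ?thesis unfolding s_def by linarith
qed

section \<open>The asymptotic formula\<close>

lemma powr_times_of_real:
  fixes t :: complex
  assumes "x > 0" "t \<noteq> 0"
  shows "(of_real x * t) powr of_real a = of_real (x powr a) * t powr of_real a"
proof -
  have "Ln (of_real x * t) = of_real (ln x) + Ln t" using assms by (simp add: Ln_times_of_real Ln_of_real)
  then have "(of_real x * t) powr of_real a = exp (of_real (a * ln x) + of_real a * Ln t)"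
    using assms by (simp add: powr_def algebra_simps)
  also have "\<dots> = of_real (exp (a * ln x)) * exp (of_real a * Ln t)"
    by (simp only: exp_add exp_of_real)
  finally show ?thesis using assms by (simp add: powr_def)
qed

text \<open>The two relations place the circle through the saddle: the exponents pi^2/(6s) and (n -
  1/24) s get the same weight y/2 and combine to (y/2) (t + 1/t). The shift 1/24 stems from the
  factor e^(-s/24).\<close>

lemma integrand_eq:
  assumes x: "x > 0" and rel: "(real n - 1 / 24) * x = y / 2" "pi\<^sup>2 / 6 / x = y / 2"
  shows "moment_gf k (of_real x * bline u) * exp (of_nat n * (of_real x * bline u))
    = of_real (x powr (1 / 2 - 2 * real k)) * (bline u powr of_real (1 / 2 - 2 * real k) * bker y (bline u))
      * lead k (of_real x * bline u)"
proof -
  define t s where "t = bline u" and "s = of_real x * t"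
  have t: "t \<noteq> 0" "Re s > 0" using x by (simp_all add: t_def s_def)
  have "of_real (pi\<^sup>2 / 6) / s - s / 24 + of_nat n * s
      = of_real (pi\<^sup>2 / 6 / x) * (1 / t) + of_real ((real n - 1 / 24) * x) * t"
    using x t by (simp add: s_def field_simps)
  also have "\<dots> = of_real (y / 2) * (t + 1 / t)" unfolding rel by (simp add: algebra_simps)
  finally have E: "exp (of_real (pi\<^sup>2 / 6) / s - s / 24) * exp (of_nat n * s) = bker y t"
    by (simp only: exp_add[symmetric] bker_def)
  have "moment_gf k s * exp (of_nat n * s) = exp (of_real (pi\<^sup>2 / 6) / s - s / 24) * exp (of_nat n * s)
      * s powr of_real (1 / 2 - 2 * real k) * lead k s"
    unfolding moment_gf_lead[OF t(2)] by (simp only: mult_ac)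
  also have "\<dots> = bker y t * s powr of_real (1 / 2 - 2 * real k) * lead k s" unfolding E ..
  also have "s powr of_real (1 / 2 - 2 * real k) = of_real (x powr (1 / 2 - 2 * real k)) * t powr of_real (1 / 2 - 2 * real k)"
    unfolding s_def by (rule powr_times_of_real[OF x t(1)])
  finally show ?thesis unfolding s_def t_def by (simp only: mult_ac)
qed

text \<open>Re (t + 1/t) = 1 + 1/(1 + u^2) <= 2 - u^2/2 for |u| <= 1. Integrating this Gaussian
  gains 1/sqrt y, the factor n^(-1/4) in the error term.\<close>

lemma norm_bker_le:
  assumes "\<bar>u\<bar> \<le> 1" "y \<ge> 0"
  shows "norm (bker y (bline u)) \<le> exp y * exp (- (y / 4 * u\<^sup>2))"
proof -
  have pos: "1 + u\<^sup>2 > 0" by (simp add: add_pos_nonneg)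
  have "u\<^sup>2 \<le> 1" using assms by (simp add: abs_square_le_1)
  then have "u\<^sup>2 * u\<^sup>2 \<le> u\<^sup>2 * 1" by (intro mult_left_mono) auto
  then have "1 \<le> (1 - u\<^sup>2 / 2) * (1 + u\<^sup>2)" by (simp add: algebra_simps)
  then have "1 / (1 + u\<^sup>2) \<le> 1 - u\<^sup>2 / 2" using pos by (simp add: divide_le_eq)
  then have "y / 2 * (1 + 1 / (1 + u\<^sup>2)) \<le> y / 2 * (1 + (1 - u\<^sup>2 / 2))"
    using assms by (intro mult_left_mono add_left_mono) auto
  also have "\<dots> = y + - (y / 4 * u\<^sup>2)" by (simp add: algebra_simps)
  finally have le: "y / 2 * (1 + 1 / (1 + u\<^sup>2)) \<le> y + - (y / 4 * u\<^sup>2)" .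
  have "Re (1 / bline u) = 1 / (1 + u\<^sup>2)" by (simp add: Re_divide)
  then have "norm (bker y (bline u)) = exp (y / 2 * (1 + 1 / (1 + u\<^sup>2)))"
    by (simp add: bker_def norm_exp_eq_Re)
  also have "\<dots> \<le> exp (y + - (y / 4 * u\<^sup>2))" using le by (simp only: exp_le_cancel_iff)
  finally show ?thesis by (simp only: exp_add)
qed

lemma Re_Lam_le:
  obtains C where "\<And>x. 0 < x \<Longrightarrow> x \<le> 1 \<Longrightarrow> Re (Lam (of_real x)) \<le> pi\<^sup>2 / 6 / x + C"
proof -
  obtain K where K: "K > 0" "\<And>s. s \<in> sector \<Longrightarrow> s \<noteq> 0 \<Longrightarrow> norm s \<le> 1 \<Longrightarrow>
    norm (LamD s - of_real (- ln (2 * pi) / 2)) \<le> K * norm s ^ 2"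
    by (rule LamD_asymp') (rule that)
  define c where "c = - ln (2 * pi) / 2"
  have "Re (Lam (of_real x)) \<le> pi\<^sup>2 / 6 / x + (c + K)" if x: "0 < x" "x \<le> 1" for x
  proof -
    have "Re (LamD (of_real x) - of_real c) \<le> norm (LamD (of_real x) - of_real c)" by (rule complex_Re_le_cmod)
    also have "\<dots> \<le> K * x\<^sup>2"
      using K(2)[of "of_real x"] of_real_in_sector[of x] x unfolding c_def by simp
    also have "\<dots> \<le> K * 1" using K(1) x by (intro mult_left_mono) (auto simp: power_le_one)
    finally have "Re (LamD (of_real x)) \<le> c + K" by simp
    moreover have "Re (LamD (of_real x)) = Re (Lam (of_real x)) - pi\<^sup>2 / 6 / x - ln x / 2 + x / 24"
    proof -
      have "of_real (pi\<^sup>2 / 6) / complex_of_real x = of_real (pi\<^sup>2 / 6 / x)" by simp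
      moreover have "Ln (of_real x) = of_real (ln x)" using x by (simp add: Ln_of_real)
      ultimately show ?thesis unfolding LamD_def by (simp only:) simp
    qed
    moreover have "ln x \<le> 0" using x by simp
    ultimately show ?thesis using x by linarith
  qed
  then show ?thesis using that by blast
qed

definition coef0 :: "nat \<Rightarrow> real" where "coef0 k = (2 * pi) powr (- 1 / 2) * alpha k"
definition coef1 :: "nat \<Rightarrow> real" where "coef1 k = (2 * pi) powr (- 1 / 2) * beta k"

lemma exp2_lead_coef: "exp2 (lead k) (of_real (coef0 k)) (of_real (coef1 k))"
  unfolding coef0_def coef1_def by (rule exp2_lead)

text \<open>The linear term of \<open>lead\<close> contributes s = x t and so raises the power of t
  by one. The remainder is integrated against the Gaussian bound. Since |t| <= 2, x <= 1/2 keeps s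
  in the unit disc.\<close>

lemma inner_estimate:
  obtains C where "C \<ge> 0"
    "\<And>n x y. 0 < x \<Longrightarrow> x \<le> 1 / 2 \<Longrightarrow> y > 0 \<Longrightarrow> (real n - 1 / 24) * x = y / 2 \<Longrightarrow> pi\<^sup>2 / 6 / x = y / 2 \<Longrightarrow>
      norm (integral {-1..1} (\<lambda>u. moment_gf k (of_real x * bline u) * exp (of_nat n * (of_real x * bline u)))
        - of_real (x powr (1 / 2 - 2 * real k)) * (of_real (coef0 k) * Jint (1 / 2 - 2 * real k) y
            + of_real (coef1 k * x) * Jint (3 / 2 - 2 * real k) y))
      \<le> C * (x powr (5 / 2 - 2 * real k) * exp y * sqrt (1 / y))"
proof -
  obtain K where K: "K \<ge> 0" "\<And>s. s \<in> sector \<Longrightarrow> s \<noteq> 0 \<Longrightarrow> norm s \<le> 1 \<Longrightarrow>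
      norm (lead k s - (of_real (coef0 k) + of_real (coef1 k) * s)) \<le> K * norm s ^ 2"
    by (rule exp2E[OF exp2_lead_coef[of k]]) (rule that)
  define a where "a = 1 / 2 - 2 * real k"
  have "norm (integral {-1..1} (\<lambda>u. moment_gf k (of_real x * bline u) * exp (of_nat n * (of_real x * bline u)))
        - of_real (x powr a) * (of_real (coef0 k) * Jint a y + of_real (coef1 k * x) * Jint (a + 1) y))
      \<le> 8 * K * sqrt (4 * pi) * (x powr (a + 2) * exp y * sqrt (1 / y))"
    if x: "0 < x" "x \<le> 1 / 2" and y: "y > 0" and rel: "(real n - 1 / 24) * x = y / 2" "pi\<^sup>2 / 6 / x = y / 2" for n x y
  proof -
    define F where "F = (\<lambda>u. moment_gf k (of_real x * bline u) * exp (of_nat n * (of_real x * bline u)))"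
    define M where "M = (\<lambda>u. of_real (x powr a) * (of_real (coef0 k) * (bline u powr of_real a * bker y (bline u))
        + of_real (coef1 k * x) * (bline u powr of_real (a + 1) * bker y (bline u))))"
    have MI: "(M has_integral of_real (x powr a) * (of_real (coef0 k) * Jint a y + of_real (coef1 k * x) * Jint (a + 1) y)) {-1..1}"
      unfolding M_def by (intro has_integral_mult_right has_integral_add Jint_has_integral)
    have "pi / x \<ge> 1" using x pi_gt3 by (simp add: le_divide_eq)
    then have sub: "{-1..1} \<subseteq> {- (pi / x)..pi / x}" by auto
    have FI: "F integrable_on {-1..1}"
      unfolding F_def
      by (rule integrable_on_subinterval[OF has_integral_integrable[OF coefficient_integral[OF x(1)]] sub])
    define g where "g = (\<lambda>u. 8 * K * x powr (a + 2) * exp y * exp (- (y / 4 * u\<^sup>2)))"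
    have gU: "(g has_integral 8 * K * x powr (a + 2) * exp y * sqrt (pi / (y / 4))) UNIV"
      unfolding g_def by (intro has_integral_mult_right gauss_has_integral) (use y in simp)
    have gI: "g integrable_on {-1..1}"
      unfolding g_def by (intro integrable_continuous_interval continuous_intros)
    have le: "norm (F u - M u) \<le> g u" if u: "u \<in> {-1..1}" for u
    proof -
      define t where "t = bline u"
      define s where "s = of_real x * t"
      have t: "t \<noteq> 0" "1 \<le> norm t" "norm t \<le> 2"
      proof -
        show "t \<noteq> 0" by (simp add: t_def)
        show "1 \<le> norm t" using complex_Re_le_cmod[of t] by (simp add: t_def)
        show "norm t \<le> 2" using cmod_le[of t] u by (auto simp: t_def)
      qed
      have ns: "norm s = x * norm t" using x by (simp add: s_def norm_mult)
      have "s \<in> sector" using x u by (auto simp: s_def t_def sector_def abs_mult mult_left_le)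
      moreover have "s \<noteq> 0" using x t by (simp add: s_def)
      moreover have "norm s \<le> 1" unfolding ns using mult_mono[OF x(2) t(3)] x by simp
      ultimately have "norm (lead k s - (of_real (coef0 k) + of_real (coef1 k) * s)) \<le> K * norm s ^ 2" by (rule K(2))
      also have "norm s ^ 2 \<le> (x * 2)\<^sup>2" unfolding ns using t x by (intro power_mono mult_left_mono) auto
      also have "K * (x * 2)\<^sup>2 = 4 * K * x\<^sup>2" by (simp add: power2_eq_square)
      finally have L: "norm (lead k s - (of_real (coef0 k) + of_real (coef1 k) * s)) \<le> 4 * K * x\<^sup>2"
        using K(1) by (simp add: mult_left_mono)
      \<comment> \<open>As a <= 1/2 and |t| >= 1, the power is at most |t| <= 2, whatever k
        is.\<close>
      have "norm t powr a \<le> norm t powr 1" using t(2) by (intro powr_mono) (auto simp: a_def)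
      then have ta: "norm t powr a \<le> 2" using t by simp
      have "F u - M u = of_real (x powr a) * (t powr of_real a * bker y t) * (lead k s - (of_real (coef0 k) + of_real (coef1 k) * s))"
        unfolding F_def M_def integrand_eq[OF x(1) rel] t_def[symmetric] s_def[symmetric] a_def[symmetric] powr_add_one[OF t(1)]
        by (simp add: s_def algebra_simps)
      then have "norm (F u - M u) = x powr a * (norm t powr a * norm (bker y t)) * norm (lead k s - (of_real (coef0 k) + of_real (coef1 k) * s))"
        using t by (simp add: norm_mult norm_powr_of_real)
      also have "\<dots> \<le> x powr a * (2 * (exp y * exp (- (y / 4 * u\<^sup>2)))) * (4 * K * x\<^sup>2)"
        unfolding t_def using u y K(1) ta L
        by (intro mult_mono mult_nonneg_nonneg norm_bker_le) (auto simp: t_def)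
      also have "\<dots> = 8 * K * (x powr a * x\<^sup>2) * exp y * exp (- (y / 4 * u\<^sup>2))" by simp
      also have "x powr a * x\<^sup>2 = x powr (a + 2)" using x by (simp add: powr_add powr_numeral)
      finally show ?thesis by (simp only: g_def)
    qed
    have "norm (integral {-1..1} (\<lambda>u. F u - M u)) \<le> integral {-1..1} g"
      by (rule integral_norm_bound_integral) (use FI MI gI le in \<open>auto intro: integrable_diff has_integral_integrable\<close>)
    also have "integral {-1..1} (\<lambda>u. F u - M u) = integral {-1..1} F - integral {-1..1} M"
      using FI MI by (intro integral_diff) (auto intro: has_integral_integrable)
    also have "integral {-1..1} M = of_real (x powr a) * (of_real (coef0 k) * Jint a y + of_real (coef1 k * x) * Jint (a + 1) y)"
      by (rule integral_unique[OF MI])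
    also have "integral {-1..1} g \<le> 8 * K * x powr (a + 2) * exp y * sqrt (pi / (y / 4))"
      by (rule has_integral_subset_le[OF _ integrable_integral[OF gI] gU]) (use K(1) in \<open>auto simp: g_def\<close>)
    also have "sqrt (pi / (y / 4)) = sqrt (4 * pi) * sqrt (1 / y)"
      unfolding real_sqrt_mult[symmetric] by (simp add: mult.commute)
    finally show ?thesis unfolding F_def by (simp only: mult_ac)
  qed
  moreover have "a + 1 = 3 / 2 - 2 * real k" "a + 2 = 5 / 2 - 2 * real k" by (simp_all add: a_def)
  ultimately show ?thesis using that[of "8 * K * sqrt (4 * pi)"] K(1) unfolding a_def by simp
qed

text \<open>Here \<open>Lam_minor\<close> saves e^(-1/(40 x)), while \<open>quasi\<close> costs no
  more than a power of 1/x.\<close>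

lemma outer_estimate:
  obtains C where "C \<ge> 0"
    "\<And>n x y u. 0 < x \<Longrightarrow> x \<le> 1 \<Longrightarrow> (real n - 1 / 24) * x = y / 2 \<Longrightarrow> pi\<^sup>2 / 6 / x = y / 2 \<Longrightarrow> 1 \<le> \<bar>u\<bar> \<Longrightarrow> x * \<bar>u\<bar> \<le> pi \<Longrightarrow>
      norm (moment_gf k (of_real x * bline u) * exp (of_nat n * (of_real x * bline u)))
      \<le> C * (x powr (- 2 * real k) * exp (y - 1 / (40 * x)))"
proof -
  obtain Q where Q: "Q \<ge> 0" "\<And>s. 0 < Re s \<Longrightarrow> Re s \<le> 1 \<Longrightarrow> norm (quasi k s) \<le> Q / Re s ^ (2 * k)"
    using norm_quasi_le[of k] by blast
  obtain C where C: "\<And>x. 0 < x \<Longrightarrow> x \<le> 1 \<Longrightarrow> Re (Lam (of_real x)) \<le> pi\<^sup>2 / 6 / x + C"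
    by (rule Re_Lam_le) (rule that)
  have "norm (moment_gf k (of_real x * bline u) * exp (of_nat n * (of_real x * bline u)))
      \<le> Q * exp (C + 1) * (x powr (- 2 * real k) * exp (y - 1 / (40 * x)))"
    if x: "0 < x" "x \<le> 1" and rel: "(real n - 1 / 24) * x = y / 2" "pi\<^sup>2 / 6 / x = y / 2"
      and u: "1 \<le> \<bar>u\<bar>" "x * \<bar>u\<bar> \<le> pi" for n x y u
  proof -
    define s where "s = of_real x * bline u"
    have s: "Re s = x" by (simp add: s_def)
    have "Re (Lam s) + real n * x \<le> (pi\<^sup>2 / 6 / x + C) - 1 / (40 * x) + ((real n - 1 / 24) * x + x / 24)"
      using Lam_minor[OF x u] C[OF x] unfolding s_def by (simp add: algebra_simps)
    also have "\<dots> \<le> y - 1 / (40 * x) + (C + 1)" unfolding rel using x by simp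
    finally have e: "exp (Re (Lam s) + real n * x) \<le> exp (y - 1 / (40 * x) + (C + 1))" by simp
    have "norm (moment_gf k s * exp (of_nat n * s)) = exp (Re (Lam s) + real n * x) * norm (quasi k s)"
      using x s by (simp add: moment_gf_eq norm_mult norm_exp_eq_Re exp_add)
    also have "\<dots> \<le> exp (y - 1 / (40 * x) + (C + 1)) * (Q / x ^ (2 * k))"
      using Q(2)[of s] s x by (intro mult_mono e) auto
    also have "x powr (- 2 * real k) = 1 / x ^ (2 * k)"
    proof -
      have "x powr (- 2 * real k) = x powr (- real (2 * k))" by simp
      also have "\<dots> = 1 / x ^ (2 * k)" unfolding powr_minus powr_realpow[OF x(1)] by (simp add: inverse_eq_divide)
      finally show ?thesis .
    qed
    then have "exp (y - 1 / (40 * x) + (C + 1)) * (Q / x ^ (2 * k)) = Q * exp (C + 1) * (x powr (- 2 * real k) * exp (y - 1 / (40 * x)))"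
      unfolding exp_add by simp
    finally show ?thesis unfolding s_def .
  qed
  then show ?thesis using that[of "Q * exp (C + 1)"] Q(1) by simp
qed

text \<open>The two outer pieces have length at most pi/x each, which costs one further power of
  1/x.\<close>

lemma circle_estimate:
  obtains C where "C \<ge> 0"
    "\<And>n x y. 0 < x \<Longrightarrow> x \<le> 1 / 2 \<Longrightarrow> y > 0 \<Longrightarrow> (real n - 1 / 24) * x = y / 2 \<Longrightarrow> pi\<^sup>2 / 6 / x = y / 2 \<Longrightarrow>
      norm (of_real (2 * pi / x) * of_int (crank_moment (2 * k) n)
        - of_real (x powr (1 / 2 - 2 * real k)) * (of_real (coef0 k) * Jint (1 / 2 - 2 * real k) y
            + of_real (coef1 k * x) * Jint (3 / 2 - 2 * real k) y))
      \<le> C * (x powr (5 / 2 - 2 * real k) * exp y * sqrt (1 / y) + x powr (- 2 * real k - 1) * exp (y - 1 / (40 * x)))"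
proof -
  obtain A where A: "A \<ge> 0"
    "\<And>n x y. 0 < x \<Longrightarrow> x \<le> 1 / 2 \<Longrightarrow> y > 0 \<Longrightarrow> (real n - 1 / 24) * x = y / 2 \<Longrightarrow> pi\<^sup>2 / 6 / x = y / 2 \<Longrightarrow>
      norm (integral {-1..1} (\<lambda>u. moment_gf k (of_real x * bline u) * exp (of_nat n * (of_real x * bline u)))
        - of_real (x powr (1 / 2 - 2 * real k)) * (of_real (coef0 k) * Jint (1 / 2 - 2 * real k) y
            + of_real (coef1 k * x) * Jint (3 / 2 - 2 * real k) y))
      \<le> A * (x powr (5 / 2 - 2 * real k) * exp y * sqrt (1 / y))"
    by (rule inner_estimate[of k]) (rule that)
  obtain B where B: "B \<ge> 0"
    "\<And>n x y u. 0 < x \<Longrightarrow> x \<le> 1 \<Longrightarrow> (real n - 1 / 24) * x = y / 2 \<Longrightarrow> pi\<^sup>2 / 6 / x = y / 2 \<Longrightarrow> 1 \<le> \<bar>u\<bar> \<Longrightarrow> x * \<bar>u\<bar> \<le> pi \<Longrightarrow>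
      norm (moment_gf k (of_real x * bline u) * exp (of_nat n * (of_real x * bline u)))
      \<le> B * (x powr (- 2 * real k) * exp (y - 1 / (40 * x)))"
    by (rule outer_estimate[of k]) (rule that)
  have "norm (of_real (2 * pi / x) * of_int (crank_moment (2 * k) n)
        - of_real (x powr (1 / 2 - 2 * real k)) * (of_real (coef0 k) * Jint (1 / 2 - 2 * real k) y
            + of_real (coef1 k * x) * Jint (3 / 2 - 2 * real k) y))
      \<le> (A + 2 * pi * B) * (x powr (5 / 2 - 2 * real k) * exp y * sqrt (1 / y) + x powr (- 2 * real k - 1) * exp (y - 1 / (40 * x)))"
    if x: "0 < x" "x \<le> 1 / 2" and y: "y > 0" and rel: "(real n - 1 / 24) * x = y / 2" "pi\<^sup>2 / 6 / x = y / 2" for n x y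
  proof -
    define F where "F = (\<lambda>u. moment_gf k (of_real x * bline u) * exp (of_nat n * (of_real x * bline u)))"
    define R where "R = pi / x"
    define b where "b = B * (x powr (- 2 * real k) * exp (y - 1 / (40 * x)))"
    have b: "b \<ge> 0" unfolding b_def using B(1) by simp
    have R: "R \<ge> 1" "x * R = pi" using x pi_gt3 by (auto simp: R_def le_divide_eq)
    have F: "(F has_integral of_real (2 * pi / x) * of_int (crank_moment (2 * k) n)) {- R..R}"
      unfolding F_def R_def by (rule coefficient_integral[OF x(1)])
    have FR: "F integrable_on {- R..R}" using F by (rule has_integral_integrable)
    have sub: "F integrable_on {c..d}" if "- R \<le> c" "d \<le> R" for c d
      by (rule integrable_on_subinterval[OF FR]) (use that in auto)
    have "integral {- R..R} F = integral {- R..-1} F + integral {-1..R} F"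
      by (rule Henstock_Kurzweil_Integration.integral_combine[symmetric]) (use R FR in auto)
    also have "integral {-1..R} F = integral {-1..1} F + integral {1..R} F"
      by (rule Henstock_Kurzweil_Integration.integral_combine[symmetric]) (use R sub in auto)
    finally have split: "of_real (2 * pi / x) * of_int (crank_moment (2 * k) n)
        = integral {- R..-1} F + (integral {-1..1} F + integral {1..R} F)"
      using integral_unique[OF F] by simp
    have Fle: "norm (F u) \<le> b" if "1 \<le> \<bar>u\<bar>" "\<bar>u\<bar> \<le> R" for u
    proof -
      have "x * \<bar>u\<bar> \<le> x * R" using that x by (intro mult_left_mono) auto
      then show ?thesis unfolding F_def b_def by (intro B(2) rel that) (use x R in auto)
    qed
    have o1: "norm (integral {- R..-1} F) \<le> b * R"
    proof -
      have "norm (integral {- R..-1} F) \<le> b * measure lborel {- R..-1}"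
        by (rule has_integral_bound_real[OF b _ integrable_integral[OF sub], of "{}"]) (use R Fle in auto)
      also have "\<dots> \<le> b * R" using R b by (intro mult_left_mono) auto
      finally show ?thesis .
    qed
    have o2: "norm (integral {1..R} F) \<le> b * R"
    proof -
      have "norm (integral {1..R} F) \<le> b * measure lborel {1..R}"
        by (rule has_integral_bound_real[OF b _ integrable_integral[OF sub], of "{}"]) (use R Fle in auto)
      also have "\<dots> \<le> b * R" using R b by (intro mult_left_mono) auto
      finally show ?thesis .
    qed
    define M where "M = of_real (x powr (1 / 2 - 2 * real k)) * (of_real (coef0 k) * Jint (1 / 2 - 2 * real k) y
            + of_real (coef1 k * x) * Jint (3 / 2 - 2 * real k) y)"
    define T1 T2 where "T1 = x powr (5 / 2 - 2 * real k) * exp y * sqrt (1 / y)"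
      and "T2 = x powr (- 2 * real k - 1) * exp (y - 1 / (40 * x))"
    have T: "T1 \<ge> 0" "T2 \<ge> 0" using y by (auto simp: T1_def T2_def)
    have inner: "norm (integral {-1..1} F - M) \<le> A * T1"
      unfolding F_def M_def T1_def by (rule A(2)[OF x y rel])
    have bR: "b * R = pi * B * T2"
      using x unfolding b_def R_def T2_def by (simp add: powr_diff)
    have "of_real (2 * pi / x) * of_int (crank_moment (2 * k) n) - M
        = integral {- R..-1} F + ((integral {-1..1} F - M) + integral {1..R} F)"
      unfolding split by (simp only: algebra_simps)
    also have "norm \<dots> \<le> b * R + (A * T1 + b * R)"
      by (intro norm_triangle_le add_mono o1 o2 inner)
    also have "\<dots> = A * T1 + 2 * pi * B * T2" unfolding bR by simp
    also have "\<dots> \<le> (A + 2 * pi * B) * T1 + (A + 2 * pi * B) * T2"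
      using A(1) B(1) T by (intro add_mono mult_right_mono) auto
    also have "\<dots> = (A + 2 * pi * B) * (T1 + T2)" by (simp only: distrib_left)
    finally show ?thesis unfolding M_def T1_def T2_def .
  qed
  then show ?thesis using that[of "A + 2 * pi * B"] A(1) B(1) by simp
qed

lemma bessel_estimate:
  obtains C where "C \<ge> 0"
    "\<And>n x y. 0 < x \<Longrightarrow> x \<le> 1 / 2 \<Longrightarrow> y \<ge> 1 \<Longrightarrow> (real n - 1 / 24) * x = y / 2 \<Longrightarrow> pi\<^sup>2 / 6 / x = y / 2 \<Longrightarrow>
      \<bar>real_of_int (crank_moment (2 * k) n)
        - (coef0 k * x powr (3 / 2 - 2 * real k) * bessel_I (3 / 2 - 2 * real k) y
           + coef1 k * x powr (5 / 2 - 2 * real k) * bessel_I (5 / 2 - 2 * real k) y)\<bar>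
      \<le> C * (x powr (7 / 2 - 2 * real k) * exp y * sqrt (1 / y) + x powr (- 2 * real k) * exp (y - 1 / (40 * x))
            + x powr (3 / 2 - 2 * real k) * exp (9 / 10 * y))"
proof -
  obtain A where A: "A \<ge> 0"
    "\<And>n x y. 0 < x \<Longrightarrow> x \<le> 1 / 2 \<Longrightarrow> y > 0 \<Longrightarrow> (real n - 1 / 24) * x = y / 2 \<Longrightarrow> pi\<^sup>2 / 6 / x = y / 2 \<Longrightarrow>
      norm (of_real (2 * pi / x) * of_int (crank_moment (2 * k) n)
        - of_real (x powr (1 / 2 - 2 * real k)) * (of_real (coef0 k) * Jint (1 / 2 - 2 * real k) y
            + of_real (coef1 k * x) * Jint (3 / 2 - 2 * real k) y))
      \<le> A * (x powr (5 / 2 - 2 * real k) * exp y * sqrt (1 / y) + x powr (- 2 * real k - 1) * exp (y - 1 / (40 * x)))"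
    by (rule circle_estimate[of k]) (rule that)
  have "Jint_good (1 / 2 - 2 * real k)" using Jint_good[of "2 * k"] by simp
  then obtain B0 where B0: "\<And>y. y \<ge> 1 \<Longrightarrow> norm (Jint (1 / 2 - 2 * real k) y - of_real (2 * pi * bessel_I (3 / 2 - 2 * real k) y)) \<le> B0 * exp (9 / 10 * y)"
    by (auto simp: Jint_good_def)
  \<comment> \<open>For k = 0 the index 3/2 lies outside the range of \<open>Jint_good\<close>, but
    then \<open>coef1 k = 0\<close>; therefore this factor is included in the bound.\<close>
  have "\<exists>B1. \<forall>y\<ge>1. \<bar>coef1 k\<bar> * norm (Jint (3 / 2 - 2 * real k) y - of_real (2 * pi * bessel_I (5 / 2 - 2 * real k) y)) \<le> B1 * exp (9 / 10 * y)"
  proof (cases k)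
    case 0
    then show ?thesis by (auto simp: coef1_def intro!: exI[of _ 0])
  next
    case (Suc m)
    have "Jint_good (3 / 2 - 2 * real k)" using Jint_good[of "2 * m + 1"] by (simp add: Suc)
    then obtain B where B: "\<And>y. y \<ge> 1 \<Longrightarrow> norm (Jint (3 / 2 - 2 * real k) y - of_real (2 * pi * bessel_I (5 / 2 - 2 * real k) y)) \<le> B * exp (9 / 10 * y)"
      by (auto simp: Jint_good_def)
    show ?thesis
    proof (intro exI[of _ "\<bar>coef1 k\<bar> * B"] allI impI)
      fix y :: real assume "y \<ge> 1"
      from mult_left_mono[OF B[OF this], of "\<bar>coef1 k\<bar>"]
      show "\<bar>coef1 k\<bar> * norm (Jint (3 / 2 - 2 * real k) y - of_real (2 * pi * bessel_I (5 / 2 - 2 * real k) y)) \<le> \<bar>coef1 k\<bar> * B * exp (9 / 10 * y)"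
        by (simp add: mult.assoc)
    qed
  qed
  then obtain B1 where B1: "\<And>y. y \<ge> 1 \<Longrightarrow> \<bar>coef1 k\<bar> * norm (Jint (3 / 2 - 2 * real k) y - of_real (2 * pi * bessel_I (5 / 2 - 2 * real k) y)) \<le> B1 * exp (9 / 10 * y)"
    by blast
  define C where "C = A + \<bar>coef0 k\<bar> * \<bar>B0\<bar> + \<bar>B1\<bar>"
  have C: "C \<ge> 0" unfolding C_def using A(1) by simp
  have "\<bar>real_of_int (crank_moment (2 * k) n)
        - (coef0 k * x powr (3 / 2 - 2 * real k) * bessel_I (3 / 2 - 2 * real k) y
           + coef1 k * x powr (5 / 2 - 2 * real k) * bessel_I (5 / 2 - 2 * real k) y)\<bar>
      \<le> C * (x powr (7 / 2 - 2 * real k) * exp y * sqrt (1 / y) + x powr (- 2 * real k) * exp (y - 1 / (40 * x))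
            + x powr (3 / 2 - 2 * real k) * exp (9 / 10 * y))"
    if x: "0 < x" "x \<le> 1 / 2" and y: "y \<ge> 1" and rel: "(real n - 1 / 24) * x = y / 2" "pi\<^sup>2 / 6 / x = y / 2" for n x y
  proof -
    define p where "p = x powr (1 / 2 - 2 * real k)"
    have p: "p \<ge> 0" "x powr (3 / 2 - 2 * real k) = x * p" "x powr (5 / 2 - 2 * real k) = x * x * p"
      "x powr (7 / 2 - 2 * real k) = x * (x * x * p)"
    proof -
      have "x powr (3 / 2 - 2 * real k) = x powr (1 + (1 / 2 - 2 * real k))"
        "x powr (5 / 2 - 2 * real k) = x powr (1 + (1 + (1 / 2 - 2 * real k)))"
        "x powr (7 / 2 - 2 * real k) = x powr (1 + (1 + (1 + (1 / 2 - 2 * real k))))" by simp_all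
      then show "x powr (3 / 2 - 2 * real k) = x * p" "x powr (5 / 2 - 2 * real k) = x * x * p"
        "x powr (7 / 2 - 2 * real k) = x * (x * x * p)"
        using x unfolding p_def powr_add by simp_all
    qed (simp add: p_def)
    define q where "q = x powr (- 2 * real k)"
    have q: "x powr (- 2 * real k - 1) = q / x" using x by (simp add: q_def powr_diff)
    define c I0 I1 J0 J1 where "c = real_of_int (crank_moment (2 * k) n)"
      and "I0 = bessel_I (3 / 2 - 2 * real k) y" and "I1 = bessel_I (5 / 2 - 2 * real k) y"
      and "J0 = Jint (1 / 2 - 2 * real k) y" and "J1 = Jint (3 / 2 - 2 * real k) y"
    define E where "E = exp (9 / 10 * y)"
    have 1: "norm (of_real (2 * pi / x * c) - of_real p * (of_real (coef0 k) * J0 + of_real (coef1 k * x) * J1))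
        \<le> A * (x * x * p * exp y * sqrt (1 / y) + q / x * exp (y - 1 / (40 * x)))"
      using A(2)[OF x _ rel] y unfolding p(3) q p_def[symmetric] J0_def J1_def c_def by simp
    have 2: "norm (of_real p * (of_real (coef0 k) * (J0 - of_real (2 * pi * I0)))) \<le> p * (\<bar>coef0 k\<bar> * (\<bar>B0\<bar> * E))"
    proof -
      have "norm (J0 - of_real (2 * pi * I0)) \<le> B0 * E" using B0[OF y] by (simp only: J0_def I0_def E_def)
      also have "\<dots> \<le> \<bar>B0\<bar> * E" by (intro mult_right_mono) (auto simp: E_def)
      finally show ?thesis unfolding norm_mult norm_of_real using p(1) by (simp add: mult_left_mono)
    qed
    have 3: "norm (of_real p * (of_real (coef1 k * x) * (J1 - of_real (2 * pi * I1)))) \<le> p * (\<bar>B1\<bar> * E)"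
    proof -
      have "\<bar>coef1 k\<bar> * norm (J1 - of_real (2 * pi * I1)) \<le> B1 * E" using B1[OF y] by (simp only: J1_def I1_def E_def)
      also have "\<dots> \<le> \<bar>B1\<bar> * E" by (intro mult_right_mono) (auto simp: E_def)
      finally have le: "\<bar>coef1 k\<bar> * norm (J1 - of_real (2 * pi * I1)) \<le> \<bar>B1\<bar> * E" .
      have "x * (\<bar>coef1 k\<bar> * norm (J1 - of_real (2 * pi * I1))) \<le> 1 * (\<bar>B1\<bar> * E)"
        by (rule mult_mono[OF _ le]) (use x in auto)
      moreover have "\<bar>coef1 k * x\<bar> = x * \<bar>coef1 k\<bar>" using x by (simp add: abs_mult)
      ultimately have "\<bar>coef1 k * x\<bar> * norm (J1 - of_real (2 * pi * I1)) \<le> \<bar>B1\<bar> * E"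
        by (simp only: mult.assoc mult_1_left)
      from mult_left_mono[OF this p(1)] show ?thesis
        by (simp only: norm_mult norm_of_real abs_of_nonneg[OF p(1)])
    qed
    have "2 * pi / x * (c - (coef0 k * (x * p) * I0 + coef1 k * (x * x * p) * I1))
        = 2 * pi / x * c - p * (coef0 k * (2 * pi * I0) + coef1 k * x * (2 * pi * I1))"
      using x by (simp add: field_simps)
    then have "of_real (2 * pi / x * (c - (coef0 k * (x * p) * I0 + coef1 k * (x * x * p) * I1)))
        = complex_of_real (2 * pi / x * c) - of_real p * (of_real (coef0 k) * of_real (2 * pi * I0) + of_real (coef1 k * x) * of_real (2 * pi * I1))"
      by (simp only: of_real_diff of_real_mult of_real_add)
    also have "\<dots> = (of_real (2 * pi / x * c) - of_real p * (of_real (coef0 k) * J0 + of_real (coef1 k * x) * J1))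
          + (of_real p * (of_real (coef0 k) * (J0 - of_real (2 * pi * I0)))
          + of_real p * (of_real (coef1 k * x) * (J1 - of_real (2 * pi * I1))))"
      by (simp only: algebra_simps)
    also have "norm \<dots> \<le> A * (x * x * p * exp y * sqrt (1 / y) + q / x * exp (y - 1 / (40 * x)))
        + (p * (\<bar>coef0 k\<bar> * (\<bar>B0\<bar> * E)) + p * (\<bar>B1\<bar> * E))"
      by (intro norm_triangle_le add_mono 1 2 3)
    finally have "2 * pi / x * \<bar>c - (coef0 k * (x * p) * I0 + coef1 k * (x * x * p) * I1)\<bar>
      \<le> A * (x * x * p * exp y * sqrt (1 / y) + q / x * exp (y - 1 / (40 * x)))
        + (p * (\<bar>coef0 k\<bar> * (\<bar>B0\<bar> * E)) + p * (\<bar>B1\<bar> * E))"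
      unfolding norm_of_real abs_mult using x by simp
    then have "x * (2 * pi / x * \<bar>c - (coef0 k * (x * p) * I0 + coef1 k * (x * x * p) * I1)\<bar>)
      \<le> x * (A * (x * x * p * exp y * sqrt (1 / y) + q / x * exp (y - 1 / (40 * x)))
        + (p * (\<bar>coef0 k\<bar> * (\<bar>B0\<bar> * E)) + p * (\<bar>B1\<bar> * E)))"
      using x by (intro mult_left_mono) auto
    also have "x * (2 * pi / x * \<bar>c - (coef0 k * (x * p) * I0 + coef1 k * (x * x * p) * I1)\<bar>)
        = 2 * pi * \<bar>c - (coef0 k * (x * p) * I0 + coef1 k * (x * x * p) * I1)\<bar>"
      using x by simp
    also have "1 * \<bar>c - (coef0 k * (x * p) * I0 + coef1 k * (x * x * p) * I1)\<bar> \<le> \<dots>"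
      using pi_gt3 by (intro mult_right_mono) auto
    also have "x * (A * (x * x * p * exp y * sqrt (1 / y) + q / x * exp (y - 1 / (40 * x)))
        + (p * (\<bar>coef0 k\<bar> * (\<bar>B0\<bar> * E)) + p * (\<bar>B1\<bar> * E)))
        = A * (x * (x * x * p) * exp y * sqrt (1 / y)) + A * (q * exp (y - 1 / (40 * x)))
        + (\<bar>coef0 k\<bar> * \<bar>B0\<bar> + \<bar>B1\<bar>) * (x * p * E)"
      using x by (simp add: algebra_simps)
    also have "\<dots> \<le> C * (x * (x * x * p) * exp y * sqrt (1 / y)) + C * (q * exp (y - 1 / (40 * x))) + C * (x * p * E)"
      unfolding C_def q_def E_def using x y p(1) A(1)
      by (intro add_mono mult_right_mono) auto
    finally show ?thesis
      unfolding p(2,3,4) c_def I0_def I1_def E_def q_def by (simp only: distrib_left mult_1_left)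
  qed
  then show ?thesis using that[of C] C by blast
qed

text \<open>The powers of 2 pi come from the constant of the logarithm, from \<open>alpha\<close> or
  \<open>beta\<close>, and from x. Their exponents add up to 1 and to 0, which is why pi appears in
  the first term only.\<close>

lemma main_terms:
  assumes "X > 0" "x = 2 * pi / sqrt X"
  shows "coef0 k * x powr (3 / 2 - 2 * real k) = pi * crank_xi k * X powr (real k - 3 / 4)"
    and "coef1 k * x powr (5 / 2 - 2 * real k) = crank_xi' k * X powr (real k - 5 / 4)"
proof -
  have "X powr (- 1 / 2) = 1 / sqrt X"
    using assms(1) powr_half_sqrt[of X] powr_minus_divide[of X "1 / 2"] by simp
  then have x': "x = (2 * pi) * X powr (- 1 / 2)" unfolding assms(2) by simp
  have x: "x powr p = (2 * pi) powr p * X powr (- p / 2)" for p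
  proof -
    have "x powr p = (2 * pi) powr p * (X powr (- 1 / 2)) powr p" unfolding x' by (rule powr_mult)
    then show ?thesis by (simp only: powr_powr) simp
  qed
  have "coef0 k * x powr (3 / 2 - 2 * real k)
      = ((2 * pi) powr (- 1 / 2) * (2 * pi) powr real (2 * k) * (2 * pi) powr (3 / 2 - 2 * real k)) * (crank_xi k / 2)
        * X powr (- (3 / 2 - 2 * real k) / 2)"
    using powr_realpow[of "2 * pi" "2 * k"] unfolding x coef0_def alpha_eq by simp
  also have "(2 * pi) powr (- 1 / 2) * (2 * pi) powr real (2 * k) * (2 * pi) powr (3 / 2 - 2 * real k)
      = (2 * pi) powr (- 1 / 2 + real (2 * k) + (3 / 2 - 2 * real k))"
    by (simp only: powr_add)
  also have "- 1 / 2 + real (2 * k) + (3 / 2 - 2 * real k) = 1" by simp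
  also have "(2 * pi) powr 1 = 2 * pi" by simp
  also have "- (3 / 2 - 2 * real k) / 2 = real k - 3 / 4" by simp
  finally show "coef0 k * x powr (3 / 2 - 2 * real k) = pi * crank_xi k * X powr (real k - 3 / 4)" by simp
  show "coef1 k * x powr (5 / 2 - 2 * real k) = crank_xi' k * X powr (real k - 5 / 4)"
  proof (cases "k = 0")
    case False
    then obtain m where k: "k = Suc m" by (cases k) auto
    have "coef1 k * x powr (5 / 2 - 2 * real k)
        = ((2 * pi) powr (- 1 / 2) * (2 * pi) powr real (2 * m) * (2 * pi) powr (5 / 2 - 2 * real k)) * crank_xi' k
          * X powr (- (5 / 2 - 2 * real k) / 2)"
      unfolding x coef1_def beta_eq' k using powr_realpow[of "2 * pi" "2 * m"]
      by (simp only: diff_Suc_1 mult_ac) (simp del: of_nat_Suc of_nat_mult)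
    also have "(2 * pi) powr (- 1 / 2) * (2 * pi) powr real (2 * m) * (2 * pi) powr (5 / 2 - 2 * real k)
        = (2 * pi) powr (- 1 / 2 + real (2 * m) + (5 / 2 - 2 * real k))"
      by (simp only: powr_add)
    also have "- 1 / 2 + real (2 * m) + (5 / 2 - 2 * real k) = 0" by (simp add: k)
    also have "(2 * pi) powr 0 = 1" by simp
    also have "- (5 / 2 - 2 * real k) / 2 = real k - 5 / 4" by simp
    finally show ?thesis by (simp only: mult_1_left)
  qed (simp add: coef1_def beta_eq' crank_xi'_def del: beta.simps)
qed

lemma powr_le_of_between:
  assumes "1 \<le> v" "v \<le> (2 :: real)"
  shows "v powr p \<le> 2 powr \<bar>p\<bar>"
proof -
  have "v powr p \<le> v powr \<bar>p\<bar>" using assms by (intro powr_mono) auto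
  also have "\<dots> \<le> 2 powr \<bar>p\<bar>" using assms by (intro powr_mono2) auto
  finally show ?thesis .
qed

text \<open>(1 + t)^4 <= e^(4t) at t = sqrt n/560, a quarter of sqrt n/140. The power n^(-2) is what
  the error term of the theorem asks for.\<close>

lemma exp_neg_le:
  assumes "n \<ge> 1" "w \<ge> sqrt n / 140"
  shows "exp (- w) \<le> 560 ^ 4 * n powr (- 2)"
proof -
  have n: "n > 0" "sqrt n ^ 4 = n ^ 2"
    using assms power_mult[of "sqrt n" 2 2] by auto
  have "(sqrt n / 560) ^ 4 \<le> (1 + sqrt n / 560) ^ 4" using assms by (intro power_mono) auto
  also have "\<dots> \<le> exp (sqrt n / 560) ^ 4" using assms by (intro power_mono exp_ge_add_one_self) auto
  also have "\<dots> = exp (sqrt n / 140)" using exp_of_nat_mult[of 4 "sqrt n / 560"] by simp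
  also have "\<dots> \<le> exp w" using assms by simp
  finally have "n ^ 2 / 560 ^ 4 \<le> exp w" unfolding power_divide n(2) .
  then have "inverse (exp w) \<le> inverse (n ^ 2 / 560 ^ 4)" using n by (intro le_imp_inverse_le) auto
  also have "\<dots> = 560 ^ 4 * n powr (- 2)" using n(1) by (simp only: powr_neg_numeral inverse_divide times_divide_eq_right mult_1_right)
  finally show ?thesis by (simp only: exp_minus)
qed

text \<open>For n >= 8, sqrt X >= 13 > 4 pi, which is x <= 1/2. From (4.7)^2 n <= X <= 25 n follow
  the bounds on x sqrt n. As 1/(40 x) = sqrt X/(80 pi) and y/140 = pi sqrt X/840, the last one holds
  because 80 pi^2 < 840.\<close>

lemma saddle_bounds:
  assumes "n \<ge> 8"
  defines "X \<equiv> 24 * real n - 1" and "y \<equiv> crank_y n"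
  defines "x \<equiv> 2 * pi / sqrt X"
  shows "X > 0" "0 < x" "x \<le> 1 / 2" "(real n - 1 / 24) * x = y / 2" "pi\<^sup>2 / 6 / x = y / 2"
    "sqrt (real n) \<le> y" "1 \<le> x * sqrt (real n)" "x * sqrt (real n) \<le> 2" "y / 140 \<le> 1 / (40 * x)"
proof -
  have n: "real n \<ge> 8" using assms by simp
  show X: "X > 0" using n by (simp add: X_def)
  define r where "r = sqrt X"
  have r: "r > 0" "r * r = X" using X by (auto simp: r_def)
  have y: "y = pi / 6 * r" by (simp add: y_def crank_y_def r_def X_def)
  have x: "x = 2 * pi / r" by (simp add: x_def r_def)
  show "0 < x" using r x by simp
  have "13 \<le> r"
    unfolding r_def by (rule real_le_rsqrt) (use n in \<open>simp add: X_def\<close>)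
  have pi: "3 < pi" "pi < 3.1416" using pi_gt3 pi_approx by auto
  then show "x \<le> 1 / 2" using \<open>13 \<le> r\<close> by (simp add: x divide_le_eq)
  have N: "real n - 1 / 24 = r * r / 24" unfolding r(2) X_def by simp
  show "(real n - 1 / 24) * x = y / 2" unfolding N using r(1) by (simp add: x y)
  show "pi\<^sup>2 / 6 / x = y / 2" using r(1) by (simp add: x y power2_eq_square)
  define m where "m = sqrt (real n)"
  have m: "m > 0" "m * m = real n" using n by (auto simp: m_def)
  have rm1: "2 * m \<le> r"
    unfolding m_def r_def by (rule real_le_rsqrt) (use n in \<open>simp add: power_mult_distrib X_def\<close>)
  have rm2: "r \<le> 5 * m"
    unfolding m_def r_def by (rule real_le_lsqrt) (use n in \<open>simp_all add: power_mult_distrib X_def\<close>)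
  have rm3: "4.7 * m \<le> r"
    unfolding m_def r_def by (rule real_le_rsqrt) (use n in \<open>simp add: power_mult_distrib X_def power2_eq_square\<close>)
  have "1 / 2 * r \<le> pi / 6 * r" using pi r by (intro mult_right_mono) auto
  then show "sqrt (real n) \<le> y" using rm1 unfolding y m_def[symmetric] by linarith
  have xm: "x * sqrt (real n) = 2 * pi * m / r" by (simp add: x m_def)
  have "5 * m \<le> 2 * pi * m" using pi m by (intro mult_right_mono) auto
  then have "r \<le> 2 * pi * m" using rm2 by linarith
  then show "1 \<le> x * sqrt (real n)" unfolding xm using r(1) by (simp only: le_divide_eq_1_pos)
  have "2 * pi * m \<le> 9.4 * m" using pi m by (intro mult_right_mono) auto
  then have "2 * pi * m \<le> 2 * r" using rm3 by linarith
  then show "x * sqrt (real n) \<le> 2" unfolding xm using r(1) by (simp only: pos_divide_le_eq)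
  have "pi * pi \<le> 3.1416 * 3.1416" using pi by (intro mult_mono) auto
  then have "(pi * pi) * r \<le> 10 * r" using r by (intro mult_right_mono) auto
  then have "pi * pi * r / (840 * pi) \<le> 10 * r / (840 * pi)" using pi by (intro divide_right_mono) auto
  moreover have "y / 140 = pi * pi * r / (840 * pi)" by (simp add: y)
  moreover have "10 * r / (840 * pi) \<le> 1 / (40 * x)" using r(1) by (simp add: x divide_simps)
  ultimately show "y / 140 \<le> 1 / (40 * x)" by linarith
qed

text \<open>As x sqrt n lies in [1, 2], a power x^p is n^(-p/2) up to the factor 2^|p|. The first
  term is the true error; the other two are exponentially smaller than e^y and are crudely bounded
  with n^(-2).\<close>

lemma error_terms:
  fixes k :: nat
  assumes n: "n \<ge> 8"
  defines "y \<equiv> crank_y n"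
  defines "x \<equiv> 2 * pi / sqrt (24 * real n - 1)"
  defines "T \<equiv> real n powr (real k - 7 / 4) * real n powr (- 1 / 4) * exp y"
  shows "x powr (7 / 2 - 2 * real k) * exp y * sqrt (1 / y) \<le> 2 powr \<bar>7 / 2 - 2 * real k\<bar> * T"
    and "x powr (- 2 * real k) * exp (y - 1 / (40 * x)) \<le> 2 powr \<bar>- 2 * real k\<bar> * 560 ^ 4 * T"
    and "x powr (3 / 2 - 2 * real k) * exp (9 / 10 * y) \<le> 2 powr \<bar>3 / 2 - 2 * real k\<bar> * 560 ^ 4 * T"
proof -
  note b = saddle_bounds[OF n, folded y_def x_def]
  have N: "real n \<ge> 1" "real n > 0" using n by auto
  define m where "m = sqrt (real n)"
  have m: "m > 0" "m = real n powr (1 / 2)" using N by (auto simp: m_def powr_half_sqrt)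
  have y: "y > 0" using b(6) N by (meson less_le_trans real_sqrt_gt_zero)
  have xp: "x powr p \<le> 2 powr \<bar>p\<bar> * real n powr (- p / 2)" for p
  proof -
    have "m * real n powr (- 1 / 2) = 1" unfolding m(2) using N by (simp add: powr_add[symmetric])
    then have "x powr p = ((x * m) * real n powr (- 1 / 2)) powr p" by (simp only: mult.assoc mult_1_right)
    also have "\<dots> = (x * m) powr p * (real n powr (- 1 / 2)) powr p"
      by (rule powr_mult)
    also have "(real n powr (- 1 / 2)) powr p = real n powr (- p / 2)" by (simp add: powr_powr)
    finally have "x powr p = (x * m) powr p * real n powr (- p / 2)" .
    also have "\<dots> \<le> 2 powr \<bar>p\<bar> * real n powr (- p / 2)"
      using b(7,8) by (intro mult_right_mono powr_le_of_between) (auto simp: m_def)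
    finally show ?thesis .
  qed
  have T: "T = real n powr (real k - 2) * exp y" unfolding T_def by (simp add: powr_add[symmetric])
  have "1 / y \<le> 1 / m" using b(6) m y unfolding m_def[symmetric] by (intro divide_left_mono) auto
  then have "sqrt (1 / y) \<le> sqrt (1 / m)" by simp
  also have "\<dots> = real n powr (- 1 / 4)"
  proof -
    have "1 / m = real n powr (- 1 / 2)" using m by (simp add: powr_minus inverse_eq_divide)
    then show ?thesis using m powr_half_sqrt[of "1 / m"] by (simp add: powr_powr)
  qed
  finally have sq: "sqrt (1 / y) \<le> real n powr (- 1 / 4)" .
  have "x powr (7 / 2 - 2 * real k) * exp y * sqrt (1 / y)
      \<le> (2 powr \<bar>7 / 2 - 2 * real k\<bar> * real n powr (- (7 / 2 - 2 * real k) / 2)) * exp y * real n powr (- 1 / 4)"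
    using y by (intro mult_mono xp sq) auto
  also have "- (7 / 2 - 2 * real k) / 2 = real k - 7 / 4" by simp
  finally show "x powr (7 / 2 - 2 * real k) * exp y * sqrt (1 / y) \<le> 2 powr \<bar>7 / 2 - 2 * real k\<bar> * T"
    by (simp add: T_def mult_ac)
  have e1: "exp (y - 1 / (40 * x)) \<le> 560 ^ 4 * real n powr (- 2) * exp y"
  proof -
    have "exp (- (1 / (40 * x))) \<le> 560 ^ 4 * real n powr (- 2)"
      by (rule exp_neg_le[OF N(1)]) (use b(6,9) in linarith)
    then have "exp y * exp (- (1 / (40 * x))) \<le> exp y * (560 ^ 4 * real n powr (- 2))" by (intro mult_left_mono) auto
    then show ?thesis by (simp add: exp_add[symmetric] mult_ac)
  qed
  have e2: "exp (9 / 10 * y) \<le> 560 ^ 4 * real n powr (- 2) * exp y"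
  proof -
    have "exp (- (y / 10)) \<le> 560 ^ 4 * real n powr (- 2)"
      by (rule exp_neg_le[OF N(1)]) (use b(6) y in linarith)
    then have "exp y * exp (- (y / 10)) \<le> exp y * (560 ^ 4 * real n powr (- 2))" by (intro mult_left_mono) auto
    moreover have "y + - (y / 10) = 9 / 10 * y" by simp
    ultimately show ?thesis by (simp add: exp_add[symmetric] mult_ac)
  qed
  have "x powr (- 2 * real k) * exp (y - 1 / (40 * x))
      \<le> (2 powr \<bar>- 2 * real k\<bar> * real n powr (- (- 2 * real k) / 2)) * (560 ^ 4 * real n powr (- 2) * exp y)"
    by (intro mult_mono xp e1) auto
  also have "\<dots> = 2 powr \<bar>- 2 * real k\<bar> * 560 ^ 4 * (real n powr (- (- 2 * real k) / 2) * real n powr (- 2)) * exp y"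
    by (simp only: mult_ac)
  also have "real n powr (- (- 2 * real k) / 2) * real n powr (- 2) = real n powr (real k - 2)"
    by (simp add: powr_add[symmetric])
  finally show "x powr (- 2 * real k) * exp (y - 1 / (40 * x)) \<le> 2 powr \<bar>- 2 * real k\<bar> * 560 ^ 4 * T"
    by (simp only: T mult.assoc)
  have "x powr (3 / 2 - 2 * real k) * exp (9 / 10 * y)
      \<le> (2 powr \<bar>3 / 2 - 2 * real k\<bar> * real n powr (- (3 / 2 - 2 * real k) / 2)) * (560 ^ 4 * real n powr (- 2) * exp y)"
    by (intro mult_mono xp e2) auto
  also have "\<dots> = 2 powr \<bar>3 / 2 - 2 * real k\<bar> * 560 ^ 4 * (real n powr (- (3 / 2 - 2 * real k) / 2) * real n powr (- 2)) * exp y"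
    by (simp only: mult_ac)
  also have "real n powr (- (3 / 2 - 2 * real k) / 2) * real n powr (- 2) = real n powr (real k - 3 / 4 - 2)"
    unfolding powr_add[symmetric] by (rule arg_cong[where f = "(powr) (real n)"]) (simp add: field_simps)
  also have "2 powr \<bar>3 / 2 - 2 * real k\<bar> * 560 ^ 4 * real n powr (real k - 3 / 4 - 2) * exp y
      \<le> 2 powr \<bar>3 / 2 - 2 * real k\<bar> * 560 ^ 4 * real n powr (real k - 2) * exp y"
    using N by (intro mult_right_mono mult_left_mono powr_mono) auto
  finally show "x powr (3 / 2 - 2 * real k) * exp (9 / 10 * y) \<le> 2 powr \<bar>3 / 2 - 2 * real k\<bar> * 560 ^ 4 * T"
    by (simp only: T mult.assoc)
qed

theorem theorem2p1:
  fixes k :: nat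
  shows "(\<lambda>n::nat. real_of_int (crank_moment (2 * k) n)
            - (pi * crank_xi k * (24 * real n - 1) powr (real k - 3 / 4)
                 * bessel_I (3 / 2 - 2 * real k) (crank_y n)
               + crank_xi' k * (24 * real n - 1) powr (real k - 5 / 4)
                 * bessel_I (3 / 2 - 2 * real k + 1) (crank_y n)))
         \<in> O(\<lambda>n. real n powr (real k - 7 / 4) * real n powr (- 1 / 4) * exp (crank_y n))"
proof -
  obtain C where C: "C \<ge> 0"
    "\<And>n x y. 0 < x \<Longrightarrow> x \<le> 1 / 2 \<Longrightarrow> y \<ge> 1 \<Longrightarrow> (real n - 1 / 24) * x = y / 2 \<Longrightarrow> pi\<^sup>2 / 6 / x = y / 2 \<Longrightarrow>
      \<bar>real_of_int (crank_moment (2 * k) n)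
        - (coef0 k * x powr (3 / 2 - 2 * real k) * bessel_I (3 / 2 - 2 * real k) y
           + coef1 k * x powr (5 / 2 - 2 * real k) * bessel_I (5 / 2 - 2 * real k) y)\<bar>
      \<le> C * (x powr (7 / 2 - 2 * real k) * exp y * sqrt (1 / y) + x powr (- 2 * real k) * exp (y - 1 / (40 * x))
            + x powr (3 / 2 - 2 * real k) * exp (9 / 10 * y))"
    by (rule bessel_estimate[of k]) (rule that)
  define c where "c = 2 powr \<bar>7 / 2 - 2 * real k\<bar> + 2 powr \<bar>- 2 * real k\<bar> * 560 ^ 4
    + 2 powr \<bar>3 / 2 - 2 * real k\<bar> * 560 ^ 4"
  show ?thesis
  proof (rule bigoI[where c = "C * c"], rule eventually_mono[OF eventually_ge_at_top[of 8]])
    fix n :: nat assume n: "n \<ge> 8"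
    define x y where "x = 2 * pi / sqrt (24 * real n - 1)" and "y = crank_y n"
    define T where "T = real n powr (real k - 7 / 4) * real n powr (- 1 / 4) * exp y"
    note b = saddle_bounds[OF n, folded x_def y_def]
    have "1 \<le> sqrt (real n)" using n by simp
    then have "y \<ge> 1" using b(6) by linarith
    have "\<bar>real_of_int (crank_moment (2 * k) n)
        - (coef0 k * x powr (3 / 2 - 2 * real k) * bessel_I (3 / 2 - 2 * real k) y
           + coef1 k * x powr (5 / 2 - 2 * real k) * bessel_I (5 / 2 - 2 * real k) y)\<bar>
      \<le> C * (x powr (7 / 2 - 2 * real k) * exp y * sqrt (1 / y) + x powr (- 2 * real k) * exp (y - 1 / (40 * x))
            + x powr (3 / 2 - 2 * real k) * exp (9 / 10 * y))"
      by (rule C(2)[OF b(2,3) \<open>y \<ge> 1\<close> b(4,5)])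
    also have "\<dots> \<le> C * (2 powr \<bar>7 / 2 - 2 * real k\<bar> * T + 2 powr \<bar>- 2 * real k\<bar> * 560 ^ 4 * T
        + 2 powr \<bar>3 / 2 - 2 * real k\<bar> * 560 ^ 4 * T)"
      unfolding T_def x_def y_def by (intro mult_left_mono add_mono error_terms n C(1))
    also have "\<dots> = C * c * T" by (simp only: c_def distrib_right mult.assoc)
    also have "coef0 k * x powr (3 / 2 - 2 * real k) = pi * crank_xi k * (24 * real n - 1) powr (real k - 3 / 4)"
      by (rule main_terms(1)[OF b(1) x_def])
    also have "coef1 k * x powr (5 / 2 - 2 * real k) = crank_xi' k * (24 * real n - 1) powr (real k - 5 / 4)"
      by (rule main_terms(2)[OF b(1) x_def])
    also have "5 / 2 - 2 * real k = 3 / 2 - 2 * real k + 1" by simp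
    finally show "norm (real_of_int (crank_moment (2 * k) n)
            - (pi * crank_xi k * (24 * real n - 1) powr (real k - 3 / 4)
                 * bessel_I (3 / 2 - 2 * real k) (crank_y n)
               + crank_xi' k * (24 * real n - 1) powr (real k - 5 / 4)
                 * bessel_I (3 / 2 - 2 * real k + 1) (crank_y n)))
         \<le> C * c * norm (real n powr (real k - 7 / 4) * real n powr (- 1 / 4) * exp (crank_y n))"
      by (simp add: T_def y_def)
  qed
qed

end
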